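(* Let $\mathbb{K}\in\{\mathbb{R},\mathbb{C}\}$ and let $(\mathfrak{F},\ell)$ be an $L_\infty[1]$-algebra over $\mathbb{K}$ whose underlying cochain complex $\mathfrak{F}=(\mathfrak{F}^0\xrightarrow{\mathrm{d}}\mathfrak{F}^1)$ is concentrated in degrees $\{0,1\}$, with $\mathfrak{F}^0$ and $\mathfrak{F}^1$ finite-dimensional vector spaces. If the cohomology $\mathsf{H}^1\mathfrak{F}=0$ is trivial, then there exists an algebra Møller map $K:(\mathrm{Sym}\,\mathfrak{F}^\ast[[\lambda]],\delta_0)\to(\mathrm{Sym}\,\mathfrak{F}^\ast[[\lambda]],\delta_0+\delta)$. Explicitly, it is the morphism of commutative graded algebras defined on generators by $$K(\varphi)=\varphi+\delta s(\varphi),\qquad K(\varphi^\ddagger)=\varphi^\ddagger,$$ for all $\varphi\in(\mathfrak{F}^0)^\ast$ and $\varphi^\ddagger\in(\mathfrak{F}^1)^\ast$, where $s:(\mathfrak{F}^0)^\ast\to(\mathfrak{F}^1)^\ast$ is a linear map satisfying $s\,\delta_0=\mathrm{id}$ on $(\mathfrak{F}^1)^\ast$ (such an $s$ exists).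
   Context: Complexes are cochain complexes of $\mathbb{K}$-vector spaces (differential of degree $+1$), with Koszul signs throughout. $\underline{\mathrm{hom}}(V,W)$ is the internal hom complex with differential $\partial(L)=\mathrm{d}L-(-1)^{|L|}L\mathrm{d}$. $\mathrm{Sym}\,V=\bigoplus_{n\ge0}(V^{\otimes n})_{\Sigma_n}$ is the graded symmetric algebra. An $L_\infty[1]$-algebra $(\mathfrak{F},\ell)$ is a cochain complex $(\mathfrak{F},\mathrm{d})$ with degree $1$ linear maps $\ell_n:\mathrm{Sym}^n\mathfrak{F}\to\mathfrak{F}$, $n\ge1$, with $\ell_1=\mathrm{d}$, satisfying for all $n\geq 1$ $$\sum_{i+j=n+1}\ell_i\,(\ell_j\otimes\mathrm{id}^{\otimes (i-1)})\sum_{\sigma\in\mathrm{Sh}(j,i-1)}\gamma_\sigma=0,$$ where $\mathrm{Sh}(j,i-1)$ are the shuffles and $\gamma_\sigma$ is the permutation action with Koszul signs. $\mathfrak{F}^\ast=\underline{\mathrm{hom}}(\mathfrak{F},\mathbb{K})$ is the dual complex; here $(\mathfrak{F}^0)^\ast$ sits in degree $0$ and $(\mathfrak{F}^1)^\ast$ in degree $-1$. Dualizing $\ell_n$ gives degree $1$ maps $\ell_n^\ast:\mathfrak{F}^\ast\to(\mathrm{Sym}^n\mathfrak{F})^\ast\cong\mathrm{Sym}^n\mathfrak{F}^\ast$, $\ell_n^\ast(\varphi)=-(-1)^{|\varphi|}\varphi\circ\ell_n$, where $\varphi_1\cdots\varphi_n\in\mathrm{Sym}^n\mathfrak{F}^\ast$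 is identified with the functional $\sum_{\sigma\in\Sigma_n}(\varphi_1\otimes\cdots\otimes\varphi_n)\circ\gamma_\sigma$ on $\mathrm{Sym}^n\mathfrak{F}$. The Chevalley-Eilenberg differential $\delta_{\mathrm{CE}}=\delta_0+\delta$ is the $\mathbb{K}[[\lambda]]$-linear degree $1$ derivation of $\mathrm{Sym}\,\mathfrak{F}^\ast[[\lambda]]$ ($\lambda$ a formal parameter of degree $0$) given on generators by $\delta_0=\ell_1^\ast$ and $\delta=\sum_{n\ge2}\lambda^{n-1}\ell_n^\ast$ (both $\delta_0$ and $\delta$ extended as derivations). The homotopy Jacobi identities give $(\delta_0+\delta)^2=0$. A Møller map is a cochain map $K=\sum_{n\ge0}\lambda^nK_n:(\mathrm{Sym}\,\mathfrak{F}^\ast[[\lambda]],\delta_0)\to(\mathrm{Sym}\,\mathfrak{F}^\ast[[\lambda]],\delta_0+\delta)$, with $K_n$ degree $0$ linear endomorphisms of $\mathrm{Sym}\,\mathfrak{F}^\ast$ and $K_0=\mathrm{id}$; i.e. $(\delta_0+\delta)K=K\delta_0$. An algebra Møller map is a Møller map that also preserves the multiplication and unit of the symmetric algebra. *)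

theory Defs
  imports
    Complex_Main
    "HOL-Library.FuncSet"
    "HOL-Library.Function_Algebras"
    "HOL-Library.Poly_Mapping"
    "HOL-Computational_Algebra.Formal_Power_Series"
    "HOL-Combinatorics.Permutations"
    "HOL-Algebra.QuotRing"
begin

section \<open>Graded vector spaces and Koszul signs\<close>

text \<open>
  A graded vector space is a family \<open>V :: int \<Rightarrow> 'v set\<close> of linear subspaces of an ambient vector
  space. The ambient space only provides the operations: the components \<open>V i\<close> are not required to
  be independent in it, and the graded vector space that is meant is the external one. A
  homogeneous element is accordingly a pair \<open>(i, v)\<close> with \<open>v \<in> V i\<close>, its degree being \<open>i\<close>.
\<close>

definition homog :: "(int \<Rightarrow> 'v set) \<Rightarrow> (int \<times> 'v) set" where
  "homog V = (SIGMA i:UNIV. V i)"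

definition total_degree :: "(int \<times> 'v) list \<Rightarrow> int" where
  "total_degree xs = sum_list (map fst xs)"

text \<open>
  The permutation action is
  \<open>\<gamma>\<^sub>\<sigma> (v\<^sub>1 \<otimes> \<dots> \<otimes> v\<^sub>n) = \<plusminus> v\<^bsub>\<sigma>(1)\<^esub> \<otimes> \<dots> \<otimes> v\<^bsub>\<sigma>(n)\<^esub>\<close> with the sign below, i.e. the tensor is
  \<^const>\<open>permute_list\<close>. With this convention a shuffle \<open>\<sigma> \<in> Sh(j, n - j)\<close> moves
  \<open>v\<^bsub>\<sigma>(1)\<^esub>, \<dots>, v\<^bsub>\<sigma>(j)\<^esub>\<close>, in their original order, to the front.
\<close>

definition koszul_sign :: "(nat \<Rightarrow> nat) \<Rightarrow> (int \<times> 'v) list \<Rightarrow> 'k::field" where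
  "koszul_sign \<sigma> xs =
     (\<Prod>(a, b) \<in> {(a, b). a < b \<and> b < length xs \<and> \<sigma> b < \<sigma> a}.
        (-1) powi (fst (xs ! \<sigma> a) * fst (xs ! \<sigma> b)))"

definition shuffle_perms :: "nat \<Rightarrow> nat \<Rightarrow> (nat \<Rightarrow> nat) set" where
  "shuffle_perms j k =
     {\<sigma>. \<sigma> permutes {..<j + k} \<and> strict_mono_on {..<j} \<sigma> \<and> strict_mono_on {j..<j + k} \<sigma>}"


section \<open>\<open>L\<^sub>\<infinity>[1]\<close>-algebras\<close>

text \<open>
  All brackets are collected in one function on lists of homogeneous elements, \<open>\<ell>\<^sub>n\<close> being its
  restriction to lists of length \<open>n \<ge> 1\<close>. A linear map on the coinvariants
  \<open>Sym\<^sup>n F = (F\<^sup>\<otimes>\<^sup>n)\<^bsub>\<Sigma>\<^sub>n\<^esub>\<close> is a multilinear map that is invariant under all \<open>\<gamma>\<^sub>\<sigma>\<close>.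
  The differential is \<open>\<ell>\<^sub>1\<close>, and the Jacobi identity for \<open>n = 1\<close> says that it squares to zero.
\<close>

locale linf1_algebra = vector_space scale
  for scale :: "'k::field \<Rightarrow> 'v::ab_group_add \<Rightarrow> 'v" +
  fixes F :: "int \<Rightarrow> 'v set"
    and br :: "(int \<times> 'v) list \<Rightarrow> 'v"
  assumes component_subspace: "subspace (F i)"
    and br_degree:
      "\<lbrakk>xs \<in> lists (homog F); xs \<noteq> []\<rbrakk> \<Longrightarrow> br xs \<in> F (total_degree xs + 1)"
    and br_add:
      "\<lbrakk>xs \<in> lists (homog F); ys \<in> lists (homog F); u \<in> F i; v \<in> F i\<rbrakk> \<Longrightarrow>
         br (xs @ (i, u + v) # ys) = br (xs @ (i, u) # ys) + br (xs @ (i, v) # ys)"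
    and br_scale:
      "\<lbrakk>xs \<in> lists (homog F); ys \<in> lists (homog F); u \<in> F i\<rbrakk> \<Longrightarrow>
         br (xs @ (i, scale c u) # ys) = scale c (br (xs @ (i, u) # ys))"
    and br_symmetric:
      "\<lbrakk>xs \<in> lists (homog F); xs \<noteq> []; \<sigma> permutes {..<length xs}\<rbrakk> \<Longrightarrow>
         scale (koszul_sign \<sigma> xs) (br (permute_list \<sigma> xs)) = br xs"
    and homotopy_jacobi:
      "\<lbrakk>xs \<in> lists (homog F); xs \<noteq> []\<rbrakk> \<Longrightarrow>
         (\<Sum>j = 1..length xs. \<Sum>\<sigma> \<in> shuffle_perms j (length xs - j).
            scale (koszul_sign \<sigma> xs)
              (let ys = permute_list \<sigma> xs in
               br ((total_degree (take j ys) + 1, br (take j ys)) # drop j ys))) = 0"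

definition finite_dimensional_subspace :: "('k::field \<Rightarrow> 'v::ab_group_add \<Rightarrow> 'v) \<Rightarrow> 'v set \<Rightarrow> bool" where
  "finite_dimensional_subspace scale S \<longleftrightarrow> (\<exists>B. finite B \<and> module.span scale B = S)"

definition cocycles :: "(int \<Rightarrow> 'v::ab_group_add set) \<Rightarrow> ((int \<times> 'v) list \<Rightarrow> 'v) \<Rightarrow> int \<Rightarrow> 'v set" where
  "cocycles F br i = {v \<in> F i. br [(i, v)] = 0}"

definition coboundaries :: "(int \<Rightarrow> 'v::ab_group_add set) \<Rightarrow> ((int \<times> 'v) list \<Rightarrow> 'v) \<Rightarrow> int \<Rightarrow> 'v set" where
  "coboundaries F br i = (\<lambda>u. br [(i - 1, u)]) ` F (i - 1)"

text \<open>The zero vector of the quotient space below is the class \<open>coboundaries F br i\<close>.\<close>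

definition cohomology :: "(int \<Rightarrow> 'v::ab_group_add set) \<Rightarrow> ((int \<times> 'v) list \<Rightarrow> 'v) \<Rightarrow> int \<Rightarrow> 'v set set" where
  "cohomology F br i =
     cocycles F br i //
       {(x, y). x \<in> cocycles F br i \<and> y \<in> cocycles F br i \<and> x - y \<in> coboundaries F br i}"

definition trivial_cohomology :: "(int \<Rightarrow> 'v::ab_group_add set) \<Rightarrow> ((int \<times> 'v) list \<Rightarrow> 'v) \<Rightarrow> int \<Rightarrow> bool" where
  "trivial_cohomology F br i \<longleftrightarrow> cohomology F br i = {coboundaries F br i}"


section \<open>The dual complex\<close>

definition fun_scale :: "'k::field \<Rightarrow> ('v \<Rightarrow> 'k) \<Rightarrow> ('v \<Rightarrow> 'k)" where
  "fun_scale c \<phi> = (\<lambda>v. c * \<phi> v)"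

text \<open>
  The degree \<open>i\<close> part of the dual is \<open>(F\<^bsup>-i\<^esup>)\<^sup>*\<close>. Functionals are made unique as HOL functions
  by letting them vanish outside \<open>F (-i)\<close>.
\<close>

definition graded_dual :: "('k::field \<Rightarrow> 'v::ab_group_add \<Rightarrow> 'v) \<Rightarrow> (int \<Rightarrow> 'v set) \<Rightarrow> int \<Rightarrow> ('v \<Rightarrow> 'k) set" where
  "graded_dual scale F i =
     {\<phi>. (\<forall>u \<in> F (-i). \<forall>v \<in> F (-i). \<phi> (u + v) = \<phi> u + \<phi> v) \<and>
         (\<forall>c. \<forall>v \<in> F (-i). \<phi> (scale c v) = c * \<phi> v) \<and>
         (\<forall>v. v \<notin> F (-i) \<longrightarrow> \<phi> v = 0)}"

text \<open>
  For \<open>\<phi>\<close> of degree \<open>i\<close>: \<open>\<ell>\<^sub>1\<^sup>*(\<phi>) = -(-1)\<^sup>i \<phi> \<circ> d\<close>, which is also \<open>\<partial>\<phi>\<close> in the internal hom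
  complex.
\<close>

definition dual_diff ::
  "(int \<Rightarrow> 'v set) \<Rightarrow> ((int \<times> 'v) list \<Rightarrow> 'v) \<Rightarrow> int \<Rightarrow> ('v \<Rightarrow> 'k::field) \<Rightarrow> ('v \<Rightarrow> 'k)" where
  "dual_diff F br i \<phi> =
     (\<lambda>v. if v \<in> F (- i - 1) then - ((-1) powi i) * \<phi> (br [(- i - 1, v)]) else 0)"


section \<open>The graded symmetric algebra\<close>

text \<open>
  Words under concatenation, written additively so that \<open>'a word \<Rightarrow>\<^sub>0 'k\<close> with the
  convolution product of \<^theory>\<open>HOL-Library.Poly_Mapping\<close> is the free associative algebra on \<open>'a\<close>.
\<close>

datatype 'a word = Word (letters: "'a list")

instantiation word :: (type) monoid_add
begin
definition "0 = Word []"
definition "u + v = Word (letters u @ letters v)"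
instance by standard (simp_all add: zero_word_def plus_word_def)
end

type_synonym ('w, 'k) free_alg = "(int \<times> 'w) word \<Rightarrow>\<^sub>0 'k"

definition letter :: "int \<times> 'w \<Rightarrow> ('w, 'k::field) free_alg" where
  "letter x = Poly_Mapping.single (Word [x]) 1"

definition const :: "'k::field \<Rightarrow> ('w, 'k) free_alg" where
  "const c = Poly_Mapping.single 0 c"

definition free_ring :: "(int \<Rightarrow> 'w set) \<Rightarrow> ('w, 'k::field) free_alg ring" where
  "free_ring V =
     \<lparr>carrier = {p. Poly_Mapping.keys p \<subseteq> Word ` lists (homog V)},
      mult = (*), one = 1, zero = 0, add = (+)\<rparr>"

text \<open>
  The first two families of relations turn the free algebra on the homogeneous elements into the
  tensor algebra \<open>\<Oplus>\<^sub>n V\<^sup>\<otimes>\<^sup>n\<close>; the third passes to the coinvariants \<open>(V\<^sup>\<otimes>\<^sup>n)\<^bsub>\<Sigma>\<^sub>n\<^esub>\<close>.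
\<close>

definition sym_relations ::
  "('k::field \<Rightarrow> 'w::ab_group_add \<Rightarrow> 'w) \<Rightarrow> (int \<Rightarrow> 'w set) \<Rightarrow> ('w, 'k) free_alg set" where
  "sym_relations scale V =
     {letter (i, u + v) - letter (i, u) - letter (i, v) | i u v. u \<in> V i \<and> v \<in> V i} \<union>
     {letter (i, scale c u) - const c * letter (i, u) | i c u. u \<in> V i} \<union>
     {letter (i, u) * letter (j, v) - const ((-1) powi (i * j)) * letter (j, v) * letter (i, u)
        | i j u v. u \<in> V i \<and> v \<in> V j}"

definition sym_ideal ::
  "('k::field \<Rightarrow> 'w::ab_group_add \<Rightarrow> 'w) \<Rightarrow> (int \<Rightarrow> 'w set) \<Rightarrow> ('w, 'k) free_alg set" where
  "sym_ideal scale V = Idl\<^bsub>free_ring V\<^esub> (sym_relations scale V)"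

definition Sym ::
  "('k::field \<Rightarrow> 'w::ab_group_add \<Rightarrow> 'w) \<Rightarrow> (int \<Rightarrow> 'w set) \<Rightarrow> ('w, 'k) free_alg set ring" where
  "Sym scale V = free_ring V Quot sym_ideal scale V"

definition sym_class ::
  "('k::field \<Rightarrow> 'w::ab_group_add \<Rightarrow> 'w) \<Rightarrow> (int \<Rightarrow> 'w set) \<Rightarrow> ('w, 'k) free_alg \<Rightarrow> ('w, 'k) free_alg set" where
  "sym_class scale V p = sym_ideal scale V +>\<^bsub>free_ring V\<^esub> p"

definition sym_gen ::
  "('k::field \<Rightarrow> 'w::ab_group_add \<Rightarrow> 'w) \<Rightarrow> (int \<Rightarrow> 'w set) \<Rightarrow> int \<times> 'w \<Rightarrow> ('w, 'k) free_alg set" where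
  "sym_gen scale V x = sym_class scale V (letter x)"

text \<open>The unit map of the algebra; scalar multiplication by \<open>c\<close> is multiplication by its value at \<open>c\<close>.\<close>

definition sym_scalar ::
  "('k::field \<Rightarrow> 'w::ab_group_add \<Rightarrow> 'w) \<Rightarrow> (int \<Rightarrow> 'w set) \<Rightarrow> 'k \<Rightarrow> ('w, 'k) free_alg set" where
  "sym_scalar scale V c = sym_class scale V (const c)"

definition sym_degree ::
  "('k::field \<Rightarrow> 'w::ab_group_add \<Rightarrow> 'w) \<Rightarrow> (int \<Rightarrow> 'w set) \<Rightarrow> int \<Rightarrow> ('w, 'k) free_alg set set" where
  "sym_degree scale V d =
     sym_class scale V ` {p \<in> carrier (free_ring V).
       \<forall>w \<in> Poly_Mapping.keys p. total_degree (letters w) = d}"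

definition sym_power_degree ::
  "('k::field \<Rightarrow> 'w::ab_group_add \<Rightarrow> 'w) \<Rightarrow> (int \<Rightarrow> 'w set) \<Rightarrow> nat \<Rightarrow> int \<Rightarrow> ('w, 'k) free_alg set set" where
  "sym_power_degree scale V n d =
     sym_class scale V ` {p \<in> carrier (free_ring V).
       \<forall>w \<in> Poly_Mapping.keys p. length (letters w) = n \<and> total_degree (letters w) = d}"


section \<open>Dual brackets\<close>

definition dual_eval :: "int \<times> ('v \<Rightarrow> 'k) \<Rightarrow> int \<times> 'v \<Rightarrow> 'k::field" where
  "dual_eval \<phi> x = (if fst \<phi> + fst x = 0 then snd \<phi> (snd x) else 0)"

text \<open>
  \<open>(\<phi>\<^sub>1 \<otimes> \<dots> \<otimes> \<phi>\<^sub>n)(v\<^sub>1 \<otimes> \<dots> \<otimes> v\<^sub>n)\<close>: the Koszul sign arises from moving each \<open>\<phi>\<^sub>b\<close> past all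
  \<open>v\<^sub>a\<close> with \<open>a < b\<close>.
\<close>

definition tensor_eval :: "(int \<times> ('v \<Rightarrow> 'k)) list \<Rightarrow> (int \<times> 'v) list \<Rightarrow> 'k::field" where
  "tensor_eval \<phi>s xs =
     (\<Prod>(a, b) \<in> {(a, b). a < b \<and> b < length xs}. (-1) powi (fst (\<phi>s ! b) * fst (xs ! a))) *
     (\<Prod>a < length xs. dual_eval (\<phi>s ! a) (xs ! a))"

text \<open>The functional \<open>\<Sum>\<^sub>\<sigma> (\<phi>\<^sub>1 \<otimes> \<dots> \<otimes> \<phi>\<^sub>n) \<circ> \<gamma>\<^sub>\<sigma>\<close> on \<open>Sym\<^sup>n F\<close>, extended linearly in the word
  \<open>\<phi>\<^sub>1 \<cdots> \<phi>\<^sub>n\<close>.\<close>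

definition word_pairing :: "(int \<times> ('v \<Rightarrow> 'k)) list \<Rightarrow> (int \<times> 'v) list \<Rightarrow> 'k::field" where
  "word_pairing \<phi>s xs =
     (if length \<phi>s = length xs
      then \<Sum>\<sigma> | \<sigma> permutes {..<length xs}. koszul_sign \<sigma> xs * tensor_eval \<phi>s (permute_list \<sigma> xs)
      else 0)"

definition pairing :: "('v \<Rightarrow> 'k, 'k) free_alg \<Rightarrow> (int \<times> 'v) list \<Rightarrow> 'k::field" where
  "pairing p xs =
     (\<Sum>w \<in> Poly_Mapping.keys p. Poly_Mapping.lookup p w * word_pairing (letters w) xs)"

text \<open>
  \<open>\<ell>\<^sub>n\<^sup>*(\<phi>)\<close> for \<open>\<phi>\<close> of degree \<open>i\<close>: the element of \<open>Sym\<^sup>n F\<^sup>*\<close> of degree \<open>i + 1\<close> that the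
  identification \<open>Sym\<^sup>n F\<^sup>* \<cong> (Sym\<^sup>n F)\<^sup>*\<close> sends to \<open>-(-1)\<^sup>i \<phi> \<circ> \<ell>\<^sub>n\<close>.
\<close>

definition dual_bracket ::
  "('k::field \<Rightarrow> 'v::ab_group_add \<Rightarrow> 'v) \<Rightarrow> (int \<Rightarrow> 'v set) \<Rightarrow> ((int \<times> 'v) list \<Rightarrow> 'v) \<Rightarrow>
     nat \<Rightarrow> int \<times> ('v \<Rightarrow> 'k) \<Rightarrow> ('v \<Rightarrow> 'k, 'k) free_alg set" where
  "dual_bracket scale F br n \<phi> =
     (THE X. X \<in> sym_power_degree fun_scale (graded_dual scale F) n (fst \<phi> + 1) \<and>
        (\<forall>p \<in> X. \<forall>xs \<in> lists (homog F). length xs = n \<longrightarrow>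
           pairing p xs = - ((-1) powi fst \<phi>) * dual_eval \<phi> (total_degree xs + 1, br xs)))"


section \<open>Formal power series and derivations\<close>

definition power_series_ring :: "('a, 'm) ring_scheme \<Rightarrow> (nat \<Rightarrow> 'a) ring" where
  "power_series_ring R =
     \<lparr>carrier = UNIV \<rightarrow> carrier R,
      mult = (\<lambda>f g n. \<Oplus>\<^bsub>R\<^esub>i\<in>{..n}. f i \<otimes>\<^bsub>R\<^esub> g (n - i)),
      one = (\<lambda>n. if n = 0 then \<one>\<^bsub>R\<^esub> else \<zero>\<^bsub>R\<^esub>),
      zero = (\<lambda>n. \<zero>\<^bsub>R\<^esub>),
      add = (\<lambda>f g n. f n \<oplus>\<^bsub>R\<^esub> g n)\<rparr>"

definition ps_const :: "('a, 'm) ring_scheme \<Rightarrow> 'a \<Rightarrow> nat \<Rightarrow> 'a" where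
  "ps_const R a = (\<lambda>n. if n = 0 then a else \<zero>\<^bsub>R\<^esub>)"

context
  fixes scale :: "'k::field \<Rightarrow> 'w::ab_group_add \<Rightarrow> 'w"
    and V :: "int \<Rightarrow> 'w set"
begin

definition SymPS :: "(nat \<Rightarrow> ('w, 'k) free_alg set) ring" where
  "SymPS = power_series_ring (Sym scale V)"

text \<open>The unit map of \<open>Sym V[[\<lambda>]]\<close> as an algebra over \<open>'k[[\<lambda>]]\<close>.\<close>

definition ps_scalar :: "'k fps \<Rightarrow> nat \<Rightarrow> ('w, 'k) free_alg set" where
  "ps_scalar c = (\<lambda>n. sym_scalar scale V (fps_nth c n))"

definition ps_degree :: "int \<Rightarrow> (nat \<Rightarrow> ('w, 'k) free_alg set) set" where
  "ps_degree d = UNIV \<rightarrow> sym_degree scale V d"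

definition ps_gen :: "int \<times> 'w \<Rightarrow> nat \<Rightarrow> ('w, 'k) free_alg set" where
  "ps_gen x = ps_const (Sym scale V) (sym_gen scale V x)"

definition ps_linear ::
  "((nat \<Rightarrow> ('w, 'k) free_alg set) \<Rightarrow> (nat \<Rightarrow> ('w, 'k) free_alg set)) \<Rightarrow> bool" where
  "ps_linear D \<longleftrightarrow>
     D \<in> carrier SymPS \<rightarrow> carrier SymPS \<and>
     (\<forall>x \<in> carrier SymPS. \<forall>y \<in> carrier SymPS. D (x \<oplus>\<^bsub>SymPS\<^esub> y) = D x \<oplus>\<^bsub>SymPS\<^esub> D y) \<and>
     (\<forall>c. \<forall>x \<in> carrier SymPS.
        D (ps_scalar c \<otimes>\<^bsub>SymPS\<^esub> x) = ps_scalar c \<otimes>\<^bsub>SymPS\<^esub> D x)"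

definition degree1_derivation ::
  "((nat \<Rightarrow> ('w, 'k) free_alg set) \<Rightarrow> (nat \<Rightarrow> ('w, 'k) free_alg set)) \<Rightarrow> bool" where
  "degree1_derivation D \<longleftrightarrow>
     ps_linear D \<and>
     (\<forall>d. D ` ps_degree d \<subseteq> ps_degree (d + 1)) \<and>
     (\<forall>d. \<forall>x \<in> ps_degree d. \<forall>y \<in> carrier SymPS.
        D (x \<otimes>\<^bsub>SymPS\<^esub> y) =
          D x \<otimes>\<^bsub>SymPS\<^esub> y \<oplus>\<^bsub>SymPS\<^esub>
          ps_scalar (fps_const ((-1) powi d)) \<otimes>\<^bsub>SymPS\<^esub> (x \<otimes>\<^bsub>SymPS\<^esub> D y))"

text \<open>The derivation with prescribed values \<open>g\<close> on the generators, undefined off the carrier.\<close>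

definition derivation_extending ::
  "(int \<times> 'w \<Rightarrow> nat \<Rightarrow> ('w, 'k) free_alg set) \<Rightarrow>
     (nat \<Rightarrow> ('w, 'k) free_alg set) \<Rightarrow> (nat \<Rightarrow> ('w, 'k) free_alg set)" where
  "derivation_extending g =
     (THE D. D \<in> extensional (carrier SymPS) \<and> degree1_derivation D \<and>
        (\<forall>x \<in> homog V. D (ps_gen x) = g x))"

definition cga_morphism ::
  "((nat \<Rightarrow> ('w, 'k) free_alg set) \<Rightarrow> (nat \<Rightarrow> ('w, 'k) free_alg set)) \<Rightarrow> bool" where
  "cga_morphism K \<longleftrightarrow>
     K \<in> ring_hom SymPS SymPS \<and> ps_linear K \<and> (\<forall>d. K ` ps_degree d \<subseteq> ps_degree d)"

definition degree0_endomorphism ::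
  "(('w, 'k) free_alg set \<Rightarrow> ('w, 'k) free_alg set) \<Rightarrow> bool" where
  "degree0_endomorphism L \<longleftrightarrow>
     L \<in> carrier (Sym scale V) \<rightarrow> carrier (Sym scale V) \<and>
     (\<forall>x \<in> carrier (Sym scale V). \<forall>y \<in> carrier (Sym scale V).
        L (x \<oplus>\<^bsub>Sym scale V\<^esub> y) = L x \<oplus>\<^bsub>Sym scale V\<^esub> L y) \<and>
     (\<forall>c. \<forall>x \<in> carrier (Sym scale V).
        L (sym_scalar scale V c \<otimes>\<^bsub>Sym scale V\<^esub> x) = sym_scalar scale V c \<otimes>\<^bsub>Sym scale V\<^esub> L x) \<and>
     (\<forall>d. L ` sym_degree scale V d \<subseteq> sym_degree scale V d)"

end


section \<open>The Chevalley-Eilenberg differential and Moller maps\<close>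

context
  fixes scale :: "'k::field \<Rightarrow> 'v::ab_group_add \<Rightarrow> 'v"
    and F :: "int \<Rightarrow> 'v set"
    and br :: "(int \<times> 'v) list \<Rightarrow> 'v"
begin

abbreviation CE :: "(nat \<Rightarrow> ('v \<Rightarrow> 'k, 'k) free_alg set) ring" where
  "CE \<equiv> SymPS fun_scale (graded_dual scale F)"

definition CE_gen :: "int \<times> ('v \<Rightarrow> 'k) \<Rightarrow> nat \<Rightarrow> ('v \<Rightarrow> 'k, 'k) free_alg set" where
  "CE_gen = ps_gen fun_scale (graded_dual scale F)"

definition delta0 ::
  "(nat \<Rightarrow> ('v \<Rightarrow> 'k, 'k) free_alg set) \<Rightarrow> (nat \<Rightarrow> ('v \<Rightarrow> 'k, 'k) free_alg set)" where
  "delta0 = derivation_extending fun_scale (graded_dual scale F)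
     (\<lambda>(i, \<phi>). CE_gen (i + 1, dual_diff F br i \<phi>))"

text \<open>The coefficient of \<open>\<lambda>\<^sup>k\<close> in \<open>\<Sum>\<^bsub>n \<ge> 2\<^esub> \<lambda>\<^bsup>n-1\<^esup> \<ell>\<^sub>n\<^sup>*\<close> is \<open>\<ell>\<^bsub>k+1\<^esub>\<^sup>*\<close> for \<open>k \<ge> 1\<close>.\<close>

definition delta ::
  "(nat \<Rightarrow> ('v \<Rightarrow> 'k, 'k) free_alg set) \<Rightarrow> (nat \<Rightarrow> ('v \<Rightarrow> 'k, 'k) free_alg set)" where
  "delta = derivation_extending fun_scale (graded_dual scale F)
     (\<lambda>\<phi> k. if k = 0 then \<zero>\<^bsub>Sym fun_scale (graded_dual scale F)\<^esub>
             else dual_bracket scale F br (k + 1) \<phi>)"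

definition moller_map ::
  "((nat \<Rightarrow> ('v \<Rightarrow> 'k, 'k) free_alg set) \<Rightarrow> (nat \<Rightarrow> ('v \<Rightarrow> 'k, 'k) free_alg set)) \<Rightarrow> bool" where
  "moller_map K \<longleftrightarrow>
     (\<exists>Kn :: nat \<Rightarrow> ('v \<Rightarrow> 'k, 'k) free_alg set \<Rightarrow> ('v \<Rightarrow> 'k, 'k) free_alg set.
        (\<forall>n. degree0_endomorphism fun_scale (graded_dual scale F) (Kn n)) \<and>
        (\<forall>x \<in> carrier (Sym fun_scale (graded_dual scale F)). Kn 0 x = x) \<and>
        (\<forall>f \<in> carrier CE. \<forall>m.
           K f m = (\<Oplus>\<^bsub>Sym fun_scale (graded_dual scale F)\<^esub>n\<in>{..m}. Kn n (f (m - n))))) \<and>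
     (\<forall>f \<in> carrier CE. delta0 (K f) \<oplus>\<^bsub>CE\<^esub> delta (K f) = K (delta0 f))"

definition algebra_moller_map ::
  "((nat \<Rightarrow> ('v \<Rightarrow> 'k, 'k) free_alg set) \<Rightarrow> (nat \<Rightarrow> ('v \<Rightarrow> 'k, 'k) free_alg set)) \<Rightarrow> bool" where
  "algebra_moller_map K \<longleftrightarrow> moller_map K \<and> K \<in> ring_hom CE CE"

definition delta0_retraction :: "(('v \<Rightarrow> 'k) \<Rightarrow> ('v \<Rightarrow> 'k)) \<Rightarrow> bool" where
  "delta0_retraction s \<longleftrightarrow>
     s \<in> graded_dual scale F 0 \<rightarrow> graded_dual scale F (-1) \<and>
     (\<forall>\<phi> \<in> graded_dual scale F 0. \<forall>\<psi> \<in> graded_dual scale F 0. s (\<phi> + \<psi>) = s \<phi> + s \<psi>) \<and>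
     (\<forall>c. \<forall>\<phi> \<in> graded_dual scale F 0. s (fun_scale c \<phi>) = fun_scale c (s \<phi>)) \<and>
     (\<forall>\<chi> \<in> graded_dual scale F (-1). s (dual_diff F br (-1) \<chi>) = \<chi>)"

definition moller_on_generators ::
  "(('v \<Rightarrow> 'k) \<Rightarrow> ('v \<Rightarrow> 'k)) \<Rightarrow>
     ((nat \<Rightarrow> ('v \<Rightarrow> 'k, 'k) free_alg set) \<Rightarrow> (nat \<Rightarrow> ('v \<Rightarrow> 'k, 'k) free_alg set)) \<Rightarrow> bool" where
  "moller_on_generators s K \<longleftrightarrow>
     cga_morphism fun_scale (graded_dual scale F) K \<and>
     (\<forall>\<phi> \<in> graded_dual scale F 0.
        K (CE_gen (0, \<phi>)) = CE_gen (0, \<phi>) \<oplus>\<^bsub>CE\<^esub> delta (CE_gen (-1, s \<phi>))) \<and>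
     (\<forall>\<chi> \<in> graded_dual scale F (-1). K (CE_gen (-1, \<chi>)) = CE_gen (-1, \<chi>))"

end

end

theory Submission
  imports Defs
begin

text \<open>
  Maps out of \<open>Sym V[[\<lambda>]]\<close> are constructed from their values on words of generators, first on power
  series over the free algebra and then modulo the ideal of relations; a linear map over the formal
  power series is determined by its values on words. In characteristic zero, averaging over
  permutations identifies words in the dual basis with graded symmetric multilinear functionals,
  which makes the dual brackets, and hence the Chevalley-Eilenberg differential, explicit.

  Both sides of \<open>(\<delta>\<^sub>0 + \<delta>) K = K \<delta>\<^sub>0\<close> are derivations along the algebra morphism \<open>K\<close>, so the
  identity need only be checked on generators. On \<open>(F\<^sup>0)\<^sup>*\<close> it holds because \<open>Sym F\<^sup>*\<close> has no
  elements of positive degree. On \<open>\<chi> \<in> (F\<^sup>1)\<^sup>*\<close> it reads \<open>\<delta>\<^sub>0 \<chi> + \<delta> \<chi> = \<delta>\<^sub>0 \<chi> + \<delta> s \<delta>\<^sub>0 \<chi>\<close>, which is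
  \<open>s \<delta>\<^sub>0 = id\<close>. Since \<open>H\<^sup>1 F = 0\<close> makes the differential surjective onto \<open>F\<^sup>1\<close>, precomposition with a
  linear right inverse of it provides such an \<open>s\<close>.
\<close>

section \<open>The free algebra and the graded symmetric algebra\<close>

text \<open>\<open>delta0\<close>, \<open>delta\<close> and \<open>dual_bracket\<close> are definite
  descriptions, so nothing can be computed with them before existence and uniqueness are known. This
  forces the two long constructions: extending values from generators to derivations, and inverting
  the identification of symmetric words with functionals.

  Maps on power series are only assumed linear over the formal parameter. Writing f = f_0 +
  \<lambda> f' gives D f = D f_0 + \<lambda> D f', so the n-th coefficient of D f is governed by
  finitely many coefficients of f. This stands in for \<lambda>-adic continuity and is why values on
  words determine a map.

  The dual has nonzero generators in degrees 0 and -1 only, so a word of positive degree must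
  contain a zero letter; hence the absence of positive degrees. The leading coefficient of K is the
  identity because \<delta> starts with the dual of the binary bracket, at order \<lambda>.\<close>

lemma keys_span_induct [consumes 1, case_names zero single add]:
  fixes p :: "'a \<Rightarrow>\<^sub>0 'b::comm_monoid_add"
  assumes "Poly_Mapping.keys p \<subseteq> S"
    and zero: "P 0"
    and single: "\<And>w c. w \<in> S \<Longrightarrow> P (Poly_Mapping.single w c)"
    and add: "\<And>a b. P a \<Longrightarrow> P b \<Longrightarrow> P (a + b)"
  shows "P p"
proof -
  have "P (\<Sum>w\<in>A. Poly_Mapping.single w (Poly_Mapping.lookup p w))" if "finite A" "A \<subseteq> S" for A
    using that by (induction A rule: finite_induct) (auto intro: zero single add)
  moreover have "(\<Sum>w\<in>Poly_Mapping.keys p. Poly_Mapping.single w (Poly_Mapping.lookup p w)) = p"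
  proof (rule poly_mapping_eqI)
    fix k
    show "Poly_Mapping.lookup (\<Sum>w\<in>Poly_Mapping.keys p. Poly_Mapping.single w (Poly_Mapping.lookup
        p w)) k
      = Poly_Mapping.lookup p k"
      by (simp add: lookup_sum lookup_single when_def in_keys_iff)
  qed
  ultimately show ?thesis
    using assms(1) by (metis finite_keys)
qed

text \<open>Terms may cancel in \<open>p + q\<close>, so its support can be smaller than the union
  of the two supports. On that union all three sums can be compared, because
  \<open>h w 0 = 0\<close>.\<close>

lemma sum_keys_add:
  fixes h :: "'a \<Rightarrow> 'b::ab_group_add \<Rightarrow> 'c::comm_monoid_add"
  assumes zero: "\<And>w. h w 0 = 0" and add: "\<And>w a b. h w (a + b) = h w a + h w b"
  shows "(\<Sum>w\<in>Poly_Mapping.keys (p + q). h w (Poly_Mapping.lookup (p + q) w)) =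
    (\<Sum>w\<in>Poly_Mapping.keys p. h w (Poly_Mapping.lookup p w)) +
    (\<Sum>w\<in>Poly_Mapping.keys q. h w (Poly_Mapping.lookup q w))"
proof -
  let ?A = "Poly_Mapping.keys p \<union> Poly_Mapping.keys q"
  have *: "(\<Sum>w\<in>Poly_Mapping.keys r. h w (Poly_Mapping.lookup r w)) =
      (\<Sum>w\<in>?A. h w (Poly_Mapping.lookup r w))" if "Poly_Mapping.keys r \<subseteq> ?A" for r
    by (rule sum.mono_neutral_left) (use that in \<open>auto simp: in_keys_iff zero\<close>)
  show ?thesis
    unfolding *[OF Poly_Mapping.keys_add] *[OF Un_upper1] *[OF Un_upper2]
    by (simp add: lookup_add add sum.distrib)
qed

lemma sum_keys_single:
  assumes "\<And>w. h w 0 = 0"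
  shows "(\<Sum>w\<in>Poly_Mapping.keys (Poly_Mapping.single v c). h w (Poly_Mapping.lookup
      (Poly_Mapping.single v c) w)) = h v c"
  using assms by (cases "c = 0") simp_all

section \<open>Words, scalars and signs in the free algebra\<close>

definition monomial :: "(int \<times> 'w) list \<Rightarrow> ('w, 'k::field) free_alg" where
  "monomial xs = Poly_Mapping.single (Word xs) 1"

lemma monomial_Nil: "monomial [] = 1"
  by (simp add: monomial_def zero_word_def[symmetric])

lemma monomial_append: "monomial (xs @ ys) = monomial xs * monomial ys"
  by (simp add: monomial_def mult_single plus_word_def)

lemma letter_eq_monomial: "letter x = monomial [x]"
  by (simp add: letter_def monomial_def)

lemma monomial_Cons: "monomial (x # xs) = letter x * monomial xs"
  by (simp add: letter_eq_monomial flip: monomial_append)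

lemma single_eq_monomial: "Poly_Mapping.single w c = const c * monomial (letters w)"
  by (simp add: monomial_def const_def mult_single)

lemma const_mult: "const (a * b) = const a * const b"
  by (simp add: const_def mult_single)

lemma const_add: "const (a + b) = const a + const b"
  by (simp add: const_def single_add)

lemma const_sum: "const (sum f A) = (\<Sum>x\<in>A. const (f x))"
  by (induction A rule: infinite_finite_induct) (simp_all add: const_add, simp_all add: const_def)

lemma const_0 [simp]: "const 0 = 0" and const_1 [simp]: "const 1 = 1"
  by (simp_all add: const_def)

lemma const_uminus: "const (- a) = - const a"
  by (simp add: const_def single_uminus)

lemma const_commute: "const c * p = p * const c"
  by (induction p rule: keys_span_induct[OF subset_UNIV])
    (simp_all add: algebra_simps, simp add: const_def mult_single mult.commute)

lemma const_left_commute: "p * (const c * q) = const c * (p * q)"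
  by (metis const_commute mult.assoc)

text \<open>The sign is available in every ring, whereas \<open>(-1) powi d\<close> asks for
  inverses: Koszul signs multiply scalars, elements of the free algebra and power series
  alike.\<close>

definition parity_sign :: "int \<Rightarrow> 'a::ring_1" where
  "parity_sign d = (if even d then 1 else -1)"

lemma minus_one_powi: "(-1 :: 'k::field) powi d = parity_sign d"
  by (simp add: parity_sign_def power_int_minus_left)

lemma const_parity_sign: "const (parity_sign d) = parity_sign d"
  by (simp add: parity_sign_def const_uminus)

lemma parity_sign_square: "parity_sign d * parity_sign d = 1"
  by (simp add: parity_sign_def)

lemma parity_sign_0 [simp]: "parity_sign 0 = 1"
  by (simp add: parity_sign_def)

section \<open>Representatives of symmetric algebra elements and the ideal of relations\<close>

locale graded_vector_space = vector_space scale
  for scale :: "'k::field \<Rightarrow> 'w::ab_group_add \<Rightarrow> 'w" +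
  fixes V :: "int \<Rightarrow> 'w set"
  assumes component_subspace: "subspace (V i)"
begin

definition words :: "('w, 'k) free_alg set" where
  "words = {p. Poly_Mapping.keys p \<subseteq> Word ` lists (homog V)}"

definition homog_words :: "int \<Rightarrow> ('w, 'k) free_alg set" where
  "homog_words d = {p \<in> words. \<forall>w \<in> Poly_Mapping.keys p. total_degree (letters w) = d}"

abbreviation "I \<equiv> sym_ideal scale V"
abbreviation "R \<equiv> free_ring V :: ('w, 'k) free_alg ring"

lemma free_ring_simps [simp]:
  "carrier R = words" "mult R = (*)" "one R = 1" "zero R = 0" "add R = (+)"
  by (simp_all add: free_ring_def words_def)

lemma words_induct [consumes 1, case_names zero monomial add]:
  assumes "p \<in> words" "P 0"
    and "\<And>xs c. xs \<in> lists (homog V) \<Longrightarrow> P (const c * monomial xs)"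
    and "\<And>a b. P a \<Longrightarrow> P b \<Longrightarrow> P (a + b)"
  shows "P p"
  using assms(1)[unfolded words_def mem_Collect_eq]
  by (rule keys_span_induct) (use assms in \<open>auto simp: single_eq_monomial simp flip:
      in_lists_conv_set\<close>)

lemma homog_words_induct [consumes 1, case_names zero monomial add]:
  assumes "p \<in> homog_words d" "P 0"
    and "\<And>xs c. xs \<in> lists (homog V) \<Longrightarrow> total_degree xs = d \<Longrightarrow> P (const c * monomial xs)"
    and "\<And>a b. P a \<Longrightarrow> P b \<Longrightarrow> P (a + b)"
  shows "P p"
proof -
  have "Poly_Mapping.keys p \<subseteq> {Word xs | xs. xs \<in> lists (homog V) \<and> total_degree xs = d}"
    using assms(1) by (force simp: homog_words_def words_def)
  then show ?thesis
    by (rule keys_span_induct) (use assms in \<open>auto simp: single_eq_monomial simp flip: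
        in_lists_conv_set\<close>)
qed

lemma homog_words_subset: "homog_words d \<subseteq> words"
  by (auto simp: homog_words_def)

lemma words_0 [simp]: "0 \<in> words"
  by (simp add: words_def)

lemma words_1 [simp]: "1 \<in> words"
  by (auto simp: words_def zero_word_def)

lemma words_const [simp]: "const c \<in> words"
  by (auto simp: words_def zero_word_def const_def)

lemma words_monomial [simp]: "xs \<in> lists (homog V) \<Longrightarrow> monomial xs \<in> words"
  by (auto simp: words_def monomial_def)

lemma words_letter [simp]: "x \<in> homog V \<Longrightarrow> letter x \<in> words"
  by (simp add: letter_eq_monomial)

lemma words_add [simp]: "p \<in> words \<Longrightarrow> q \<in> words \<Longrightarrow> p + q \<in> words"
  using Poly_Mapping.keys_add[of p q] by (auto simp: words_def)

lemma words_uminus [simp]: "p \<in> words \<Longrightarrow> - p \<in> words"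
  by (auto simp: words_def)

lemma words_diff [simp]: "p \<in> words \<Longrightarrow> q \<in> words \<Longrightarrow> p - q \<in> words"
  using words_add[of p "- q"] by simp

lemma words_mult [simp]: "p \<in> words \<Longrightarrow> q \<in> words \<Longrightarrow> p * q \<in> words"
  unfolding words_def using keys_mult[of p q] by (fastforce simp: plus_word_def dest!: subsetD)

lemma words_sum: "(\<And>x. x \<in> A \<Longrightarrow> f x \<in> words) \<Longrightarrow> sum f A \<in> words"
  by (induction A rule: infinite_finite_induct) auto

lemma homog_words_0 [simp]: "0 \<in> homog_words d"
  by (simp add: homog_words_def)

lemma homog_words_add [simp]: "p \<in> homog_words d \<Longrightarrow> q \<in> homog_words d \<Longrightarrow> p + q \<in> homog_words d"
  using Poly_Mapping.keys_add[of p q] by (auto simp: homog_words_def)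

lemma homog_words_mult:
  assumes "p \<in> homog_words d" "q \<in> homog_words e"
  shows "p * q \<in> homog_words (d + e)"
proof -
  have "total_degree (letters w) = d + e" if w: "w \<in> Poly_Mapping.keys (p * q)" for w
  proof -
    obtain a b where "w = a + b" "a \<in> Poly_Mapping.keys p" "b \<in> Poly_Mapping.keys q"
      using w keys_mult[of p q] by blast
    then show ?thesis
      using assms by (simp add: homog_words_def plus_word_def total_degree_def)
  qed
  then show ?thesis
    using assms by (simp add: homog_words_def)
qed

lemma homog_words_monomial:
  "xs \<in> lists (homog V) \<Longrightarrow> monomial xs \<in> homog_words (total_degree xs)"
  by (simp add: homog_words_def) (simp add: monomial_def)

lemma homog_words_letter: "(i, v) \<in> homog V \<Longrightarrow> letter (i, v) \<in> homog_words i"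
  using homog_words_monomial[of "[(i, v)]"] by (simp add: letter_eq_monomial total_degree_def)

lemma homog_words_const: "const c \<in> homog_words 0"
  by (simp add: homog_words_def) (simp add: const_def total_degree_def zero_word_def)

lemma homog_words_const_mult: "p \<in> homog_words d \<Longrightarrow> const c * p \<in> homog_words d"
  using homog_words_mult[OF homog_words_const, of p d c] by simp

lemma homog_words_1: "1 \<in> homog_words 0"
  using homog_words_const[of 1] by simp

lemma free_ring: "ring R"
proof (rule ringI)
  show "abelian_group R"
    by (rule abelian_groupI) (auto simp: algebra_simps intro!: bexI[of _ "- x" for x])
  show "Group.monoid R"
    by (rule monoidI) (auto simp: algebra_simps)
qed (auto simp: algebra_simps)

lemma zero_in_homog [simp]: "(i, 0) \<in> homog V"
  by (simp add: homog_def subspace_0 component_subspace)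

lemma sym_relations_subset: "sym_relations scale V \<subseteq> words"
proof -
  have [simp]: "V i \<noteq> {}" for i using subspace_0[OF component_subspace[of i]] by auto
  have [simp]: "u \<in> V i \<Longrightarrow> (i, u) \<in> homog V" for i u by (simp add: homog_def)
  show ?thesis
    unfolding sym_relations_def
    by (auto intro!: words_diff words_mult words_letter simp: homog_def
        intro: subspace_add[OF component_subspace] subspace_scale[OF component_subspace])
qed

lemma ideal_sym: "ideal I R"
  unfolding sym_ideal_def by (rule ring.genideal_ideal[OF free_ring]) (simp add:
      sym_relations_subset)

lemma sym_relations_in_ideal: "sym_relations scale V \<subseteq> I"
  unfolding sym_ideal_def by (rule ring.genideal_self[OF free_ring]) (simp add:
      sym_relations_subset)

lemma ideal_0 [simp]: "0 \<in> I"
  using additive_subgroup.zero_closed[OF ideal.axioms(1)[OF ideal_sym]] by simp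

lemma ideal_add [simp]: "p \<in> I \<Longrightarrow> q \<in> I \<Longrightarrow> p + q \<in> I"
  using additive_subgroup.a_closed[OF ideal.axioms(1)[OF ideal_sym]] by simp

lemma ideal_mult_left: "a \<in> words \<Longrightarrow> p \<in> I \<Longrightarrow> a * p \<in> I"
  using ideal.I_l_closed[OF ideal_sym] by simp

lemma ideal_mult_right: "a \<in> words \<Longrightarrow> p \<in> I \<Longrightarrow> p * a \<in> I"
  using ideal.I_r_closed[OF ideal_sym] by simp

lemma ideal_uminus [simp]: "p \<in> I \<Longrightarrow> - p \<in> I"
  using ideal_mult_left[of "const (-1)" p] by (simp add: const_uminus)

lemma ideal_diff [simp]: "p \<in> I \<Longrightarrow> q \<in> I \<Longrightarrow> p - q \<in> I"
  using ideal_add[of p "- q"] by simp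

lemma ideal_sum: "(\<And>x. x \<in> A \<Longrightarrow> f x \<in> I) \<Longrightarrow> sum f A \<in> I"
  by (induction A rule: infinite_finite_induct) auto

lemma ideal_parity_sign: "p \<in> I \<Longrightarrow> parity_sign d * p \<in> I"
  by (simp add: parity_sign_def)

text \<open>A generated ideal is an intersection of ideals, which says little about its elements.
  The sums of scaled relations flanked by two words already form a two-sided ideal, so they exhaust
  \<open>I\<close>.\<close>

lemma sym_ideal_induct [consumes 1, case_names zero relation add]:
  assumes "p \<in> I"
    and zero: "P 0"
    and rel: "\<And>c xs r ys. xs \<in> lists (homog V) \<Longrightarrow> ys \<in> lists (homog V) \<Longrightarrow>
      r \<in> sym_relations scale V \<Longrightarrow> P (const c * (monomial xs * r * monomial ys))"
    and add: "\<And>a b. P a \<Longrightarrow> P b \<Longrightarrow> P (a + b)"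
  shows "P p"
proof -
  define B where "B = {const c * (monomial xs * r * monomial ys) | c xs r ys.
    xs \<in> lists (homog V) \<and> ys \<in> lists (homog V) \<and> r \<in> sym_relations scale V}"
  \<comment> \<open>The closure of \<open>B\<close> under sums, taken as an intersection so that the
    induction rule \<open>Sind\<close> is immediate.\<close>
  define S where "S = \<Inter>{T. 0 \<in> T \<and> B \<subseteq> T \<and> (\<forall>a\<in>T. \<forall>b\<in>T. a + b \<in> T)}"
  have S0: "0 \<in> S" and SB: "\<And>b. b \<in> B \<Longrightarrow> b \<in> S"
    and Sadd: "\<And>a b. a \<in> S \<Longrightarrow> b \<in> S \<Longrightarrow> a + b \<in> S"
    by (auto simp: S_def)
  have Sind: "Q s" if "s \<in> S" "Q 0" "\<And>b. b \<in> B \<Longrightarrow> Q b" "\<And>a b. Q a \<Longrightarrow> Q b \<Longrightarrow> Q (a + b)" for Q s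
  proof -
    have "S \<subseteq> {s. Q s}" unfolding S_def by (rule Inter_lower) (use that in auto)
    then show ?thesis using that(1) by auto
  qed
  have BI: "const c * (monomial xs * r * monomial ys) \<in> B"
    if "xs \<in> lists (homog V)" "ys \<in> lists (homog V)" "r \<in> sym_relations scale V" for c xs r ys
    using that by (auto simp: B_def)
  have Bw: "b \<in> words" if "b \<in> B" for b
    using that sym_relations_subset unfolding B_def by (auto intro!: words_mult words_monomial)
  have Sw: "S \<subseteq> words"
  proof
    fix s assume "s \<in> S" then show "s \<in> words" by (rule Sind) (auto simp: Bw)
  qed
  have left: "a * s \<in> S" if "s \<in> S" "a \<in> words" for a s
    using that(1)
  proof (rule Sind)
    fix b assume "b \<in> B"
    then obtain c xs r ys where b: "b = const c * (monomial xs * r * monomial ys)"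
      "xs \<in> lists (homog V)" "ys \<in> lists (homog V)" "r \<in> sym_relations scale V"
      by (auto simp: B_def)
    \<comment> \<open>Scalars are central, so a term of \<open>a\<close> is absorbed: its word into
      the left word of \<open>b\<close>, its coefficient into the scalar.\<close>
    show "a * b \<in> S" using that(2)
    proof (induction rule: words_induct)
      case (monomial us d)
      have "const d * monomial us * b = const (d * c) * (monomial (us @ xs) * r * monomial ys)"
        by (simp only: b const_mult monomial_append mult.assoc const_left_commute[of "monomial us"])
      also have "\<dots> \<in> B" using b monomial by (intro BI) simp_all
      finally show ?case by (rule SB)
    qed (auto simp: S0 Sadd distrib_right)
  qed (auto simp: S0 Sadd distrib_left)
  have right: "s * a \<in> S" if "s \<in> S" "a \<in> words" for a s
    using that(1)
  proof (rule Sind)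
    fix b assume "b \<in> B"
    then obtain c xs r ys where b: "b = const c * (monomial xs * r * monomial ys)"
      "xs \<in> lists (homog V)" "ys \<in> lists (homog V)" "r \<in> sym_relations scale V"
      by (auto simp: B_def)
    show "b * a \<in> S" using that(2)
    proof (induction rule: words_induct)
      case (monomial us d)
      have "b * (const d * monomial us) = const (d * c) * (monomial xs * r * monomial (ys @ us))"
        unfolding b const_mult monomial_append
        by (simp only: mult.assoc const_left_commute[of _ d])
      also have "\<dots> \<in> B" using b monomial by (intro BI) simp_all
      finally show ?case by (rule SB)
    qed (auto simp: S0 Sadd distrib_left)
  qed (auto simp: S0 Sadd distrib_right)
  interpret R: ring R by (rule free_ring)
  have minus: "\<ominus>\<^bsub>R\<^esub> s = - s" if "s \<in> words" for s
    using that by (intro R.minus_equality) auto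
  have Sminus: "- s \<in> S" if "s \<in> S" for s
    using left[OF that, of "const (-1)"] by (simp add: const_uminus)
  have "ideal S R"
  proof (rule idealI)
    show "subgroup S (add_monoid R)"
    proof (rule subgroup.intro)
      fix x assume "x \<in> S"
      then show "inv\<^bsub>add_monoid R\<^esub> x \<in> S"
        using minus[of x] Sw Sminus[of x] by (auto simp: a_inv_def)
    qed (use S0 Sadd Sw in auto)
  qed (auto simp: free_ring left right)
  moreover have "sym_relations scale V \<subseteq> S"
  proof
    fix r assume "r \<in> sym_relations scale V"
    then show "r \<in> S" using SB[OF BI[of "[]" "[]" r 1]] by (simp add: monomial_Nil)
  qed
  ultimately have "I \<subseteq> S"
    unfolding sym_ideal_def by (intro ring.genideal_minimal[OF free_ring]) auto
  then have "p \<in> S" using assms(1) by auto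
  then show ?thesis by (rule Sind) (auto simp: B_def zero add intro!: rel)
qed

end

section \<open>Power series over the graded symmetric algebra\<close>

definition coeffs_in :: "'a set \<Rightarrow> 'a::zero fps set" where
  "coeffs_in A = {f. \<forall>n. fps_nth f n \<in> A}"

lemma coeffs_in_nth: "f \<in> coeffs_in A \<Longrightarrow> fps_nth f n \<in> A"
  by (simp add: coeffs_in_def)

lemma coeffs_in_mono: "A \<subseteq> B \<Longrightarrow> coeffs_in A \<subseteq> coeffs_in B"
  by (auto simp: coeffs_in_def)

lemma coeffs_in_mult:
  fixes A B C :: "'a::semiring_0 set"
  assumes "f \<in> coeffs_in A" "g \<in> coeffs_in B"
    and "\<And>a b. a \<in> A \<Longrightarrow> b \<in> B \<Longrightarrow> a * b \<in> C"
    and "0 \<in> C" "\<And>a b. a \<in> C \<Longrightarrow> b \<in> C \<Longrightarrow> a + b \<in> C"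
  shows "f * g \<in> coeffs_in C"
proof -
  have sum: "sum h S \<in> C" if "\<And>x. x \<in> S \<Longrightarrow> h x \<in> C" for h :: "nat \<Rightarrow> 'a" and S
    using that by (induction S rule: infinite_finite_induct) (auto simp: assms)
  show ?thesis
    using assms(1-3) by (auto simp: coeffs_in_def fps_mult_nth intro!: sum)
qed

text \<open>The \<lambda>-linear extension of \<open>L\<close>, that is, the sum of all \<lambda>^i
  L(f_i). The values of \<open>L\<close> are themselves power series, since \<delta> sends a
  generator to a series in \<lambda>.\<close>

definition ps_extend :: "('a \<Rightarrow> 'b fps) \<Rightarrow> 'a fps \<Rightarrow> 'b::comm_monoid_add fps" where
  "ps_extend L f = Abs_fps (\<lambda>n. \<Sum>i\<le>n. fps_nth (L (fps_nth f i)) (n - i))"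

lemma ps_extend_const: "L 0 = 0 \<Longrightarrow> ps_extend L (fps_const a) = L a"
proof (rule fps_ext)
  fix n assume "L 0 = 0"
  then have "fps_nth (ps_extend L (fps_const a)) n = (\<Sum>i\<in>{0::nat}. fps_nth (L (fps_nth (fps_const
      a) i)) (n - i))"
    unfolding ps_extend_def fps_nth_Abs_fps by (intro sum.mono_neutral_right) auto
  then show "fps_nth (ps_extend L (fps_const a)) n = fps_nth (L a) n" by simp
qed

lemma ps_extend_add:
  assumes "\<And>a b. L (a + b) = L a + L b"
  shows "ps_extend L (f + g) = ps_extend L f + ps_extend L g"
  by (rule fps_ext) (simp add: ps_extend_def assms sum.distrib)

lemma ps_extend_X:
  fixes L :: "'a::semiring_1 \<Rightarrow> 'b::semiring_1 fps"
  assumes "L 0 = 0"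
  shows "ps_extend L (fps_X * f) = fps_X * ps_extend L f"
proof (rule fps_ext)
  fix n
  show "fps_nth (ps_extend L (fps_X * f)) n = fps_nth (fps_X * ps_extend L f) n"
  proof (cases n)
    case (Suc m)
    show ?thesis unfolding Suc ps_extend_def fps_nth_Abs_fps
      by (simp add: sum.atMost_Suc_shift assms del: sum.atMost_Suc)
  qed (simp add: ps_extend_def assms)
qed

lemma ps_extend_coeffs_in:
  assumes "f \<in> coeffs_in A" "\<And>a. a \<in> A \<Longrightarrow> L a \<in> coeffs_in B"
    and "0 \<in> B" "\<And>a b. a \<in> B \<Longrightarrow> b \<in> B \<Longrightarrow> a + b \<in> B"
  shows "ps_extend L f \<in> coeffs_in B"
proof -
  have sum: "sum h S \<in> B" if "\<And>x. x \<in> S \<Longrightarrow> h x \<in> B" for h :: "nat \<Rightarrow> _" and S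
    using that by (induction S rule: infinite_finite_induct) (auto simp: assms)
  show ?thesis
    using assms(1,2) by (auto simp: coeffs_in_def ps_extend_def intro!: sum)
qed

lemma fps_eq_const_plus_X: "f = fps_const (fps_nth f 0) + fps_X * fps_shift 1 f"
    for f :: "'a::semiring_1 fps"
proof (rule fps_ext)
  fix n show "fps_nth f n = fps_nth (fps_const (fps_nth f 0) + fps_X * fps_shift 1 f) n"
    by (cases n) auto
qed

text \<open>Linearity over the formal parameter reduces the vanishing of the \<open>n\<close>-th coefficient to
  that of lower coefficients at shifted arguments.\<close>

lemma bilinear_ps_zero:
  fixes B :: "'a::semiring_1 fps \<Rightarrow> 'b::semiring_1 fps \<Rightarrow> 'c::semiring_1 fps"
  assumes add1: "\<And>f f' g. B (f + f') g = B f g + B f' g"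
    and add2: "\<And>f g g'. B f (g + g') = B f g + B f g'"
    and X1: "\<And>f g. B (fps_X * f) g = fps_X * B f g"
    and X2: "\<And>f g. B f (fps_X * g) = fps_X * B f g"
    and const: "\<And>a b. a \<in> S \<Longrightarrow> b \<in> T \<Longrightarrow> B (fps_const a) (fps_const b) = 0"
    and "f \<in> coeffs_in S" "g \<in> coeffs_in T"
  shows "B f g = 0"
proof -
  have "fps_nth (B f g) n = 0" if "f \<in> coeffs_in S" "g \<in> coeffs_in T" for n f g
    using that
  proof (induction n arbitrary: f g rule: less_induct)
    case (less n)
    let ?a = "fps_const (fps_nth f 0)" and ?b = "fps_const (fps_nth g 0)"
    let ?f = "fps_shift 1 f" and ?g = "fps_shift 1 g"
    have mem: "?f \<in> coeffs_in S" "?g \<in> coeffs_in T"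
      using less.prems by (auto simp: coeffs_in_def)
    have "B f g = B (?a + fps_X * ?f) g" using fps_eq_const_plus_X[of f] by simp
    also have "\<dots> = B ?a g + fps_X * B ?f g" by (simp add: add1 X1)
    also have "B ?a g = B ?a (?b + fps_X * ?g)" using fps_eq_const_plus_X[of g] by simp
    also have "\<dots> = fps_X * B ?a ?g"
      using less.prems by (simp add: add2 X2 const coeffs_in_nth)
    finally have eq: "B f g = fps_X * B ?a ?g + fps_X * B ?f g" .
    \<comment> \<open>The constant series \<open>?a\<close> need not lie in
      \<open>coeffs_in S\<close>, as 0 may be missing from \<open>S\<close>, so the induction
      hypothesis does not apply to \<open>B ?a ?g\<close>. That term is reached through
      \<open>B f ?g = B ?a ?g + fps_X * B ?f ?g\<close>, which is where the index
      \<open>n - 2\<close> comes from.\<close>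
    have "fps_nth (B f ?g) (n - 1) = 0" "fps_nth (B ?f g) (n - 1) = 0"
        "fps_nth (B ?f ?g) (n - 2) = 0" if "n \<noteq> 0"
      using less.IH[of "n - 1" f ?g] less.IH[of "n - 1" ?f g] less.IH[of "n - 2" ?f ?g]
        that mem less.prems by auto
    moreover have "B f ?g = B ?a ?g + fps_X * B ?f ?g"
      using fps_eq_const_plus_X[of f] by (metis add1 X1)
    ultimately show ?case
      unfolding eq by (auto simp: numeral_2_eq_2 split: if_splits)
  qed
  then show ?thesis using assms(6,7) by (intro fps_ext) auto
qed

abbreviation scalar_series :: "'k::field fps \<Rightarrow> ('w, 'k) free_alg fps" where
  "scalar_series c \<equiv> Abs_fps (\<lambda>n. const (fps_nth c n))"

lemma parity_sign_fps: "fps_const (parity_sign d) = parity_sign d"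
  by (simp add: parity_sign_def flip: fps_const_neg)

lemma scalar_series_X: "scalar_series fps_X = fps_X"
  by (rule fps_ext) (simp add: fps_X_def)

lemma scalar_series_const: "scalar_series (fps_const c) = fps_const (const c)"
  by (rule fps_ext) simp

lemma scalar_series_parity_sign: "scalar_series (fps_const (parity_sign d)) = parity_sign d"
  using scalar_series_const[of "parity_sign d"] by (simp only: const_parity_sign parity_sign_fps)

section \<open>Quotient maps onto the symmetric algebra and onto its power series\<close>

context graded_vector_space
begin

abbreviation "S \<equiv> Sym scale V"
abbreviation "cls \<equiv> sym_class scale V"

lemma sym_class_altdef: "cls p = {q. q - p \<in> I}"
proof (intro Set.set_eqI iffI)
  fix q assume "q \<in> {q. q - p \<in> I}"
  then show "q \<in> cls p"
    unfolding sym_class_def a_r_coset_def' by (auto intro!: bexI[of _ "q - p"])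
qed (auto simp: sym_class_def a_r_coset_def')

lemma sym_class_eq_iff: "cls p = cls q \<longleftrightarrow> p - q \<in> I"
proof
  assume "p - q \<in> I"
  then have "r - p \<in> I \<longleftrightarrow> r - q \<in> I" for r
    using ideal_add[of "r - p" "p - q"] ideal_diff[of "r - q" "p - q"] by auto
  then show "cls p = cls q" by (simp add: sym_class_altdef)
next
  assume "cls p = cls q"
  moreover have "p \<in> cls p" by (simp add: sym_class_altdef)
  ultimately show "p - q \<in> I" by (simp add: sym_class_altdef)
qed

lemma sym_class_eqI: "p - q \<in> I \<Longrightarrow> cls p = cls q"
  by (simp add: sym_class_eq_iff)

lemma ring_Sym: "ring S"
  unfolding Sym_def by (rule ideal.quotient_is_ring[OF ideal_sym])

lemma Sym_carrier: "carrier S = cls ` words"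
  by (auto simp: Sym_def FactRing_def A_RCOSETS_def' sym_class_def)

lemma Sym_mult: "p \<in> words \<Longrightarrow> q \<in> words \<Longrightarrow> cls p \<otimes>\<^bsub>S\<^esub> cls q = cls (p * q)"
  using ideal.rcoset_mult_add[OF ideal_sym] by (simp add: Sym_def FactRing_simps sym_class_def)

lemma Sym_add: "p \<in> words \<Longrightarrow> q \<in> words \<Longrightarrow> cls p \<oplus>\<^bsub>S\<^esub> cls q = cls (p + q)"
  using ideal.a_rcos_sum[OF ideal_sym] by (simp add: Sym_def FactRing_simps sym_class_def)

lemma Sym_one: "\<one>\<^bsub>S\<^esub> = cls 1"
  by (simp add: Sym_def FactRing_simps sym_class_def)

lemma Sym_zero: "\<zero>\<^bsub>S\<^esub> = cls 0"
  by (simp add: Sym_def FactRing_simps sym_class_altdef)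

lemma Sym_finsum:
  assumes "\<And>i. i \<in> A \<Longrightarrow> f i \<in> words"
  shows "(\<Oplus>\<^bsub>S\<^esub>i\<in>A. cls (f i)) = cls (sum f A)"
proof -
  interpret ring S by (rule ring_Sym)
  show ?thesis using assms
  proof (induction A rule: infinite_finite_induct)
    case (insert x A)
    then have "(\<Oplus>\<^bsub>S\<^esub>i\<in>insert x A. cls (f i)) = cls (f x) \<oplus>\<^bsub>S\<^esub> (\<Oplus>\<^bsub>S\<^esub>i\<in>A. cls (f i))"
      by (intro finsum_insert) (auto simp: Sym_carrier)
    with insert show ?case by (simp add: Sym_add words_sum)
  qed (simp_all add: Sym_zero finsum_infinite)
qed

lemma cls_words [simp]: "p \<in> words \<Longrightarrow> cls p \<in> carrier S"
  by (simp add: Sym_carrier)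

lemma sym_degree_eq: "sym_degree scale V d = cls ` homog_words d"
  by (simp add: sym_degree_def homog_words_def)

abbreviation "A \<equiv> SymPS scale V"
abbreviation "P \<equiv> coeffs_in words"
abbreviation "J \<equiv> coeffs_in I"
abbreviation "H d \<equiv> coeffs_in (homog_words d)"

text \<open>The bridge between two kinds of ring: series over the free algebra form a type-class
  ring, in which ordinary algebraic simplification works, while \<open>SymPS\<close> is a ring on a
  carrier set. The map is onto by \<open>SymPS_carrier\<close> and has kernel \<open>J\<close> by
  \<open>series_class_eq_iff\<close>.\<close>

definition series_class :: "('w, 'k) free_alg fps \<Rightarrow> nat \<Rightarrow> ('w, 'k) free_alg set" where
  "series_class f = (\<lambda>n. cls (fps_nth f n))"

abbreviation "\<pi> \<equiv> series_class"

lemma series_class_eq_iff: "\<pi> f = \<pi> g \<longleftrightarrow> f - g \<in> J"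
  by (simp add: series_class_def fun_eq_iff sym_class_eq_iff coeffs_in_def)

lemma P_0 [simp]: "0 \<in> P" and P_1 [simp]: "1 \<in> P"
  and P_add [simp]: "f \<in> P \<Longrightarrow> g \<in> P \<Longrightarrow> f + g \<in> P"
  and P_uminus [simp]: "f \<in> P \<Longrightarrow> - f \<in> P"
  and P_diff [simp]: "f \<in> P \<Longrightarrow> g \<in> P \<Longrightarrow> f - g \<in> P"
  and P_scalar_series [simp]: "scalar_series c \<in> P"
  and P_const [simp]: "a \<in> words \<Longrightarrow> fps_const a \<in> P"
  and P_parity_sign [simp]: "parity_sign d \<in> P"
  by (auto simp: coeffs_in_def parity_sign_def fps_one_def)

lemma P_mult [simp]: "f \<in> P \<Longrightarrow> g \<in> P \<Longrightarrow> f * g \<in> P"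
  by (rule coeffs_in_mult[where A = words and B = words]) auto

lemma J_0 [simp]: "0 \<in> J"
  and J_add [simp]: "f \<in> J \<Longrightarrow> g \<in> J \<Longrightarrow> f + g \<in> J"
  and J_uminus [simp]: "f \<in> J \<Longrightarrow> - f \<in> J"
  and J_diff [simp]: "f \<in> J \<Longrightarrow> g \<in> J \<Longrightarrow> f - g \<in> J"
  and J_const [simp]: "a \<in> I \<Longrightarrow> fps_const a \<in> J"
  by (auto simp: coeffs_in_def)

lemma J_parity_sign: "f \<in> J \<Longrightarrow> parity_sign d * f \<in> J"
  by (simp add: parity_sign_def)

lemma J_mult_left: "f \<in> P \<Longrightarrow> g \<in> J \<Longrightarrow> f * g \<in> J"
  by (rule coeffs_in_mult[where A = words and B = I]) (auto intro: ideal_mult_left)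

lemma J_mult_right: "f \<in> P \<Longrightarrow> g \<in> J \<Longrightarrow> g * f \<in> J"
  by (rule coeffs_in_mult[where A = I and B = words]) (auto intro: ideal_mult_right)

lemma H_subset: "f \<in> H d \<Longrightarrow> f \<in> P"
  using coeffs_in_mono[OF homog_words_subset] by auto

lemma H_0 [simp]: "0 \<in> H d" and H_1: "1 \<in> H 0"
  and H_add: "f \<in> H d \<Longrightarrow> g \<in> H d \<Longrightarrow> f + g \<in> H d"
  and H_const: "a \<in> homog_words d \<Longrightarrow> fps_const a \<in> H d"
  by (auto simp: coeffs_in_def fps_one_def homog_words_1)

lemma H_mult: "f \<in> H d \<Longrightarrow> g \<in> H e \<Longrightarrow> f * g \<in> H (d + e)"
  by (rule coeffs_in_mult[where A = "homog_words d" and B = "homog_words e"])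
    (auto intro: homog_words_mult)

lemma H_parity_sign: "f \<in> H d \<Longrightarrow> parity_sign e * f \<in> H d"
  using homog_words_const_mult[of _ d "-1"] by (auto simp: coeffs_in_def parity_sign_def
      const_uminus)

text \<open>Coefficients of a series over the quotient can be lifted independently of each other,
  since any sequence of representatives is a power series.\<close>

lemma SymPS_carrier: "carrier A = \<pi> ` P"
proof -
  have "f \<in> \<pi> ` P" if "f \<in> UNIV \<rightarrow> carrier S" for f
  proof -
    have "\<forall>n. \<exists>p. p \<in> words \<and> f n = cls p" using that by (auto simp: Sym_carrier Pi_def)
    then obtain p where "\<And>n. p n \<in> words" "\<And>n. f n = cls (p n)" by metis
    then show ?thesis
      by (intro image_eqI[of _ _ "Abs_fps p"]) (auto simp: series_class_def coeffs_in_def)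
  qed
  then show ?thesis
    by (auto simp: SymPS_def power_series_ring_def series_class_def coeffs_in_def)
qed

lemma series_class_in_carrier [simp]: "f \<in> P \<Longrightarrow> \<pi> f \<in> carrier A"
  by (simp add: SymPS_carrier)

lemma SymPS_add: "f \<in> P \<Longrightarrow> g \<in> P \<Longrightarrow> \<pi> f \<oplus>\<^bsub>A\<^esub> \<pi> g = \<pi> (f + g)"
  by (simp add: SymPS_def power_series_ring_def series_class_def fun_eq_iff Sym_add coeffs_in_def)

lemma SymPS_mult: "f \<in> P \<Longrightarrow> g \<in> P \<Longrightarrow> \<pi> f \<otimes>\<^bsub>A\<^esub> \<pi> g = \<pi> (f * g)"
  by (simp add: SymPS_def power_series_ring_def series_class_def fun_eq_iff Sym_mult coeffs_in_def
      fps_mult_nth Sym_finsum atLeast0AtMost)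

lemma SymPS_zero: "\<zero>\<^bsub>A\<^esub> = \<pi> 0"
  by (simp add: SymPS_def power_series_ring_def series_class_def Sym_zero)

lemma SymPS_one: "\<one>\<^bsub>A\<^esub> = \<pi> 1"
  by (auto simp: SymPS_def power_series_ring_def series_class_def Sym_zero Sym_one fun_eq_iff)

lemma ring_SymPS: "ring A"
proof (rule ringI)
  show "abelian_group A"
  proof (rule abelian_groupI)
    fix x assume "x \<in> carrier A"
    then obtain f where "f \<in> P" "x = \<pi> f" by (auto simp: SymPS_carrier)
    then show "\<exists>y\<in>carrier A. y \<oplus>\<^bsub>A\<^esub> x = \<zero>\<^bsub>A\<^esub>"
      by (intro bexI[of _ "\<pi> (- f)"]) (simp_all add: SymPS_add SymPS_zero)
  qed (auto simp: SymPS_carrier SymPS_add SymPS_zero algebra_simps)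
  show "Group.monoid A"
    by (rule monoidI) (auto simp: SymPS_carrier SymPS_mult SymPS_one mult.assoc)
qed (auto simp: SymPS_carrier SymPS_mult SymPS_add distrib_left distrib_right)

lemma ps_scalar_eq: "ps_scalar scale V c = \<pi> (scalar_series c)"
  by (simp add: ps_scalar_def sym_scalar_def series_class_def)

lemma ps_const_eq: "ps_const S (cls p) = \<pi> (fps_const p)"
  by (rule ext) (simp add: ps_const_def series_class_def Sym_zero)

lemma ps_gen_eq: "ps_gen scale V x = \<pi> (fps_const (letter x))"
  by (simp add: ps_gen_def sym_gen_def ps_const_eq)

lemma ps_degree_eq: "ps_degree scale V d = \<pi> ` H d"
proof -
  have "f \<in> \<pi> ` H d" if "f \<in> UNIV \<rightarrow> sym_degree scale V d" for f
  proof -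
    have "\<forall>n. \<exists>p. p \<in> homog_words d \<and> f n = cls p" using that by (auto simp: sym_degree_eq Pi_def)
    then obtain p where "\<And>n. p n \<in> homog_words d" "\<And>n. f n = cls (p n)" by metis
    then show ?thesis
      by (intro image_eqI[of _ _ "Abs_fps p"]) (auto simp: series_class_def coeffs_in_def)
  qed
  then show ?thesis
    by (auto simp: ps_degree_def series_class_def coeffs_in_def sym_degree_eq)
qed

lemma ps_scalar_in_carrier [simp]: "ps_scalar scale V c \<in> carrier A"
  by (simp add: ps_scalar_eq)

lemma ps_gen_in_carrier [simp]: "x \<in> homog V \<Longrightarrow> ps_gen scale V x \<in> carrier A"
  by (simp add: ps_gen_eq)

lemma ps_degree_subset: "ps_degree scale V d \<subseteq> carrier A"
  by (auto simp: ps_degree_eq H_subset)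

end

section \<open>Derivations and morphisms on representatives\<close>

definition word_extend ::
    "((int \<times> 'w) list \<Rightarrow> ('w, 'k) free_alg fps) \<Rightarrow> ('w, 'k::field) free_alg \<Rightarrow> ('w, 'k) free_alg fps"
        where
  "word_extend W p =
    (\<Sum>w\<in>Poly_Mapping.keys p. fps_const (const (Poly_Mapping.lookup p w)) * W (letters w))"

lemma word_extend_add: "word_extend W (p + q) = word_extend W p + word_extend W q"
  unfolding word_extend_def
  by (rule sum_keys_add) (simp_all add: const_add distrib_right flip: fps_const_add)

lemma word_extend_0 [simp]: "word_extend W 0 = 0"
  by (simp add: word_extend_def)

lemma word_extend_const_monomial [simp]:
  "word_extend W (const c * monomial xs) = fps_const (const c) * W xs"
proof -
  have "word_extend W (Poly_Mapping.single (Word xs) c) = fps_const (const c) * W xs"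
    unfolding word_extend_def by (subst sum_keys_single) auto
  then show ?thesis by (simp add: single_eq_monomial)
qed

lemma word_extend_monomial [simp]: "word_extend W (monomial xs) = W xs"
  using word_extend_const_monomial[of W 1 xs] by simp

lemma free_alg_induct [case_names zero monomial add]:
  assumes "P 0" "\<And>xs c. P (const c * monomial xs)" "\<And>a b. P a \<Longrightarrow> P b \<Longrightarrow> P (a + b)"
  shows "P p"
  by (induction p rule: keys_span_induct[OF subset_UNIV]) (auto simp: assms single_eq_monomial)

lemma word_extend_const_mult: "word_extend W (const c * p) = fps_const (const c) * word_extend W p"
proof (induction p rule: free_alg_induct)
  case (monomial xs d)
  have "word_extend W (const (c * d) * monomial xs) = fps_const (const (c * d)) * W xs"
    by (rule word_extend_const_monomial)
  then show ?case by (simp add: const_mult mult.assoc flip: fps_const_mult)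
qed (simp_all add: distrib_left word_extend_add)

lemma word_extend_uminus: "word_extend W (- p) = - word_extend W p"
  using word_extend_const_mult[of W "-1" p] by (simp add: const_uminus flip: fps_const_neg)

lemma word_extend_diff: "word_extend W (p - q) = word_extend W p - word_extend W q"
  using word_extend_add[of W p "- q"] by (simp add: word_extend_uminus)

lemma word_extend_parity_sign: "word_extend W (parity_sign d * p) = parity_sign d * word_extend W p"
  by (simp add: parity_sign_def word_extend_uminus)

lemma fps_const_const_commute: "fps_const (const c) * f = f * fps_const (const c)"
  by (rule fps_ext) (simp add: const_commute)

lemma parity_sign_add: "parity_sign (i + j) = parity_sign i * parity_sign j"
  by (simp add: parity_sign_def)

abbreviation series_extend ::
    "((int \<times> 'w) list \<Rightarrow> ('w, 'k::field) free_alg fps) \<Rightarrow> ('w, 'k) free_alg fps \<Rightarrow> ('w, 'k) free_alg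
        fps" where
  "series_extend W \<equiv> ps_extend (word_extend W)"

lemmas series_extend_add = ps_extend_add[of "word_extend W", OF word_extend_add] for W
lemmas series_extend_X = ps_extend_X[of "word_extend W", OF word_extend_0] for W
lemmas series_extend_const = ps_extend_const[of "word_extend W", OF word_extend_0] for W

lemma series_extend_0 [simp]: "series_extend W 0 = 0"
  using series_extend_const[of W 0] by simp

lemma series_extend_uminus: "series_extend W (- f) = - series_extend W f"
  using series_extend_add[of W f "- f"] by (simp add: add_eq_0_iff)

lemma series_extend_diff: "series_extend W (f - g) = series_extend W f - series_extend W g"
  using series_extend_add[of W f "- g"] by (simp add: series_extend_uminus)

lemma fps_X_left_commute: "f * (fps_X * g) = fps_X * (f * g)" for f :: "'a::semiring_1 fps"
  by (metis fps_mult_fps_X_commute mult.assoc)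

text \<open>The difference of the two sides is additive and \<lambda>-linear in each argument, so
  \<open>bilinear_ps_zero\<close> leaves only constant series to check. The product rules
  \<open>series_extend_morphism_mult\<close> and \<open>series_extend_derivation_mult\<close> follow
  the same pattern.\<close>

lemma series_extend_scalar:
  "series_extend W (scalar_series c * f) = scalar_series c * series_extend W f"
proof -
  have "series_extend W (scalar_series c * f) - scalar_series c * series_extend W f = 0"
  proof (rule bilinear_ps_zero[where S = "range const" and T = UNIV
        and B = "\<lambda>f g. series_extend W (f * g) - f * series_extend W g"], goal_cases)
    case (5 a b)
    then show ?case by (auto simp: series_extend_const word_extend_const_mult)
  qed (auto simp: algebra_simps series_extend_add series_extend_X coeffs_in_def fps_X_left_commute)
  then show ?thesis by simp
qed

fun derivation_word ::
    "(int \<times> 'w \<Rightarrow> ('w, 'k) free_alg fps) \<Rightarrow> (int \<times> 'w) list \<Rightarrow> ('w, 'k::field) free_alg fps" where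
  "derivation_word G [] = 0"
| "derivation_word G (x # xs) = G x * fps_const (monomial xs) +
    parity_sign (fst x) * fps_const (letter x) * derivation_word G xs"

text \<open>The recursion peels off single letters. For a cut at an arbitrary place the signs of all
  letters on the left multiply up to the sign of their total degree.\<close>

lemma derivation_word_append:
  "derivation_word G (xs @ ys) = derivation_word G xs * fps_const (monomial ys) +
    parity_sign (total_degree xs) * fps_const (monomial xs) * derivation_word G ys"
proof (induction xs)
  case (Cons x xs)
  show ?case
    by (simp add: Cons monomial_append monomial_Cons total_degree_def parity_sign_add
        flip: fps_const_mult)
      (auto simp: parity_sign_def algebra_simps simp del: fps_const_mult)
qed (simp add: total_degree_def monomial_Nil)

definition morphism_word ::
    "(int \<times> 'w \<Rightarrow> ('w, 'k) free_alg fps) \<Rightarrow> (int \<times> 'w) list \<Rightarrow> ('w, 'k::field) free_alg fps" where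
  "morphism_word k xs = prod_list (map k xs)"

lemma word_extend_morphism_mult:
  "word_extend (morphism_word k) (p * q) = word_extend (morphism_word k) p * word_extend
      (morphism_word k) q"
proof (induction p rule: free_alg_induct)
  case (monomial xs c)
  show ?case
  proof (induction q rule: free_alg_induct)
    case (monomial ys d)
    have "const c * monomial xs * (const d * monomial ys) = const (c * d) * monomial (xs @ ys)"
      by (simp add: const_mult monomial_append mult.assoc const_left_commute[of "monomial xs"])
    then have "word_extend (morphism_word k) (const c * monomial xs * (const d * monomial ys)) =
        fps_const (const c) * fps_const (const d) * (morphism_word k xs * morphism_word k ys)"
      by (simp only: word_extend_const_monomial) (simp add: morphism_word_def const_mult)
    also have "\<dots> = fps_const (const c) * morphism_word k xs * (fps_const (const d) * morphism_word
        k ys)"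
      by (simp only: fps_const_const_commute[of d] mult.assoc)
    finally show ?case by simp
  qed (simp_all add: distrib_left word_extend_add)
qed (simp_all add: distrib_right word_extend_add)

lemma series_extend_morphism_mult:
  "series_extend (morphism_word k) (f * g) = series_extend (morphism_word k) f * series_extend
      (morphism_word k) g"
proof -
  let ?E = "series_extend (morphism_word k)"
  have "?E (f * g) - ?E f * ?E g = 0"
  proof (rule bilinear_ps_zero[where S = UNIV and T = UNIV
        and B = "\<lambda>f g. ?E (f * g) - ?E f * ?E g"], goal_cases)
    case (5 a b)
    then show ?case by (simp add: series_extend_const word_extend_morphism_mult)
  qed (auto simp: algebra_simps series_extend_add series_extend_X coeffs_in_def fps_X_left_commute)
  then show ?thesis by simp
qed

context graded_vector_space
begin

lemma word_extend_derivation_mult: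
  assumes "p \<in> homog_words d"
  shows "word_extend (derivation_word G) (p * q) =
    word_extend (derivation_word G) p * fps_const q +
    parity_sign d * fps_const p * word_extend (derivation_word G) q"
  using assms
proof (induction rule: homog_words_induct)
  case (monomial xs c)
  show ?case
  proof (induction q rule: free_alg_induct)
    case (monomial ys b)
    have "const c * monomial xs * (const b * monomial ys) = const (c * b) * monomial (xs @ ys)"
      by (simp add: const_mult monomial_append mult.assoc const_left_commute[of "monomial xs"])
    then have "word_extend (derivation_word G) (const c * monomial xs * (const b * monomial ys)) =
        fps_const (const c) * fps_const (const b) * (derivation_word G xs * fps_const (monomial
            ys) +
          parity_sign d * fps_const (monomial xs) * derivation_word G ys)"
      using \<open>total_degree xs = d\<close>
      by (simp only: word_extend_const_monomial derivation_word_append)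
        (simp only: const_mult flip: fps_const_mult)
    also have "\<dots> = fps_const (const c) * derivation_word G xs * (fps_const (const b) * fps_const
        (monomial ys)) +
        parity_sign d * (fps_const (const c) * fps_const (monomial xs)) * (fps_const (const b) *
            derivation_word G ys)"
      by (simp only: fps_const_const_commute[of b] mult.assoc distrib_left distrib_right)
        (simp add: parity_sign_def del: fps_const_mult)
    finally show ?case by simp
  qed (simp_all add: distrib_left word_extend_add algebra_simps flip: fps_const_add)
qed (simp_all add: algebra_simps word_extend_add flip: fps_const_add)

lemma series_extend_derivation_mult:
  assumes "f \<in> H d"
  shows "series_extend (derivation_word G) (f * g) =
    series_extend (derivation_word G) f * g +
    parity_sign d * f * series_extend (derivation_word G) g"
proof -
  let ?E = "series_extend (derivation_word G)"
  have "?E (f * g) - (?E f * g + parity_sign d * f * ?E g) = 0"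
  proof (rule bilinear_ps_zero[where S = "homog_words d" and T = UNIV
        and B = "\<lambda>f g. ?E (f * g) - (?E f * g + parity_sign d * f * ?E g)"], goal_cases)
    case (5 a b)
    then show ?case by (simp add: series_extend_const word_extend_derivation_mult)
  qed (use assms in \<open>auto simp: algebra_simps series_extend_add series_extend_X coeffs_in_def
        fps_X_left_commute parity_sign_def\<close>)
  then show ?thesis by simp
qed

text \<open>The relations exchange neighbouring letters only. Pushing the letter through the word
  one step at a time multiplies the signs, and the exponents add up to
  \<open>j * total_degree xs\<close>.\<close>

lemma graded_commute_letter:
  assumes "(j, v) \<in> homog V" "xs \<in> lists (homog V)"
  shows "letter (j, v) * monomial xs - parity_sign (j * total_degree xs) * (monomial xs * letter
      (j, v)) \<in> I"
  using assms(2)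
proof (induction xs)
  case Nil
  then show ?case by (simp add: total_degree_def monomial_Nil)
next
  case (Cons x xs)
  obtain i u where x: "x = (i, u)" by fastforce
  let ?s = "parity_sign (j * i)" and ?t = "parity_sign (j * total_degree xs)"
  let ?v = "letter (j, v)" and ?u = "letter (i, u)"
  have mem: "(i, u) \<in> homog V" using Cons x by auto
  have "?v * ?u - ?s * ?u * ?v \<in> sym_relations scale V"
    using assms(1) mem unfolding sym_relations_def minus_one_powi const_parity_sign homog_def
        by blast
  then have "?v * ?u - ?s * ?u * ?v \<in> I"
    using sym_relations_in_ideal by blast
  then have 1: "(?v * ?u - ?s * ?u * ?v) * monomial xs \<in> I"
    using Cons by (intro ideal_mult_right) simp_all
  have 2: "?s * (?u * (?v * monomial xs - ?t * (monomial xs * ?v))) \<in> I"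
    using Cons mem by (intro ideal_parity_sign ideal_mult_left) auto
  have st: "parity_sign (j * total_degree (x # xs)) = ?s * ?t"
    by (simp add: x total_degree_def parity_sign_add distrib_left)
  have "?v * monomial (x # xs) - parity_sign (j * total_degree (x # xs)) * (monomial (x # xs) *
      ?v) =
      (?v * ?u - ?s * ?u * ?v) * monomial xs + ?s * (?u * (?v * monomial xs - ?t * (monomial xs *
          ?v)))"
    unfolding st unfolding monomial_Cons x by (auto simp: parity_sign_def algebra_simps)
  then show ?case using ideal_add[OF 1 2] by (rule ssubst)
qed

lemma graded_commute_monomial:
  assumes "xs \<in> lists (homog V)" "ys \<in> lists (homog V)"
  shows "monomial xs * monomial ys - parity_sign (total_degree xs * total_degree ys) * (monomial
      ys * monomial xs) \<in> I"
  using assms(1)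
proof (induction xs)
  case Nil
  then show ?case by (simp add: total_degree_def monomial_Nil)
next
  case (Cons x xs)
  obtain i u where x: "x = (i, u)" by fastforce
  let ?s = "parity_sign (i * total_degree ys)" and ?t = "parity_sign (total_degree xs *
      total_degree ys)"
  let ?x = "letter (i, u)" and ?m = "monomial xs" and ?n = "monomial ys"
  have mem: "(i, u) \<in> homog V" using Cons x by auto
  have 1: "?x * (?m * ?n - ?t * (?n * ?m)) \<in> I"
    using Cons mem by (intro ideal_mult_left) auto
  have 2: "?t * ((?x * ?n - ?s * (?n * ?x)) * ?m) \<in> I"
    using Cons mem assms by (intro ideal_parity_sign ideal_mult_right graded_commute_letter) auto
  have st: "parity_sign (total_degree (x # xs) * total_degree ys) = ?s * ?t"
    by (simp add: x total_degree_def parity_sign_add distrib_right)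
  have "monomial (x # xs) * ?n - parity_sign (total_degree (x # xs) * total_degree ys) * (?n *
      monomial (x # xs)) =
      ?x * (?m * ?n - ?t * (?n * ?m)) + ?t * ((?x * ?n - ?s * (?n * ?x)) * ?m)"
    unfolding st unfolding monomial_Cons x by (auto simp: parity_sign_def algebra_simps)
  then show ?case using ideal_add[OF 1 2] by (rule ssubst)
qed

lemma graded_commute:
  assumes "p \<in> homog_words d" "q \<in> homog_words e"
  shows "p * q - parity_sign (d * e) * (q * p) \<in> I"
  using assms(1)
proof (induction rule: homog_words_induct)
  case (monomial xs a)
  show ?case using assms(2)
  proof (induction rule: homog_words_induct)
    case (monomial ys b)
    let ?s = "parity_sign (d * e)" and ?m = "monomial xs" and ?n = "monomial ys"
    have "const a * (const b * (?m * ?n - ?s * (?n * ?m))) \<in> I"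
      using graded_commute_monomial[of xs ys] monomial \<open>total_degree xs = d\<close> \<open>xs \<in> _\<close>
      by (intro ideal_mult_left) auto
    also have "const a * (const b * (?m * ?n - ?s * (?n * ?m))) =
        const a * ?m * (const b * ?n) - ?s * (const b * ?n * (const a * ?m))"
      using const_left_commute[of ?m b ?n] const_left_commute[of ?n a ?m] const_commute[of a
          "const b"]
      by (auto simp: parity_sign_def right_diff_distrib mult.assoc const_left_commute[of "const a"
          b])
    finally show ?case .
  next
    case (add p q)
    then show ?case
      using ideal_add[OF add] by (simp add: algebra_simps)
  qed simp
next
  case (add a b)
  then show ?case
    using ideal_add[OF add] by (simp add: algebra_simps)
qed simp

lemma graded_commute_series:
  assumes "f \<in> H d" "g \<in> H e"
  shows "f * g - parity_sign (d * e) * (g * f) \<in> J"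
  unfolding coeffs_in_def
proof (intro CollectI allI)
  fix n
  \<comment> \<open>The Cauchy product is summed backwards, so that equal pairs of coefficients of
    \<open>f\<close> and \<open>g\<close> meet under one sum and \<open>graded_commute\<close>
    applies termwise.\<close>
  have gf: "fps_nth (g * f) n = (\<Sum>i = 0..n. fps_nth g (n - i) * fps_nth f i)"
    unfolding fps_mult_nth by (subst sum.atLeastAtMost_rev) (auto intro!: sum.cong)
  have "fps_nth (f * g - parity_sign (d * e) * (g * f)) n =
      fps_nth (f * g) n - parity_sign (d * e) * fps_nth (g * f) n"
    by (simp add: parity_sign_def)
  also have "\<dots> = (\<Sum>i=0..n. fps_nth f i * fps_nth g (n - i) -
      parity_sign (d * e) * (fps_nth g (n - i) * fps_nth f i))"
    unfolding gf by (simp add: fps_mult_nth sum_subtractf sum_distrib_left)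
  also have "\<dots> \<in> I"
    using assms by (intro ideal_sum graded_commute) (auto simp: coeffs_in_nth)
  finally show "fps_nth (f * g - parity_sign (d * e) * (g * f)) n \<in> I" .
qed

end

section \<open>Descent to the graded symmetric algebra\<close>

context graded_vector_space
begin

lemma P_X [simp]: "fps_X \<in> P"
  by (simp add: coeffs_in_def fps_X_def)

lemma ps_scalar_X: "ps_scalar scale V fps_X = \<pi> fps_X"
  and ps_scalar_const: "ps_scalar scale V (fps_const c) = \<pi> (fps_const (const c))"
  and ps_scalar_parity_sign: "ps_scalar scale V (fps_const (parity_sign d)) = \<pi> (parity_sign d)"
  by (simp_all only: ps_scalar_eq scalar_series_X scalar_series_const
      scalar_series_parity_sign[unfolded parity_sign_fps] parity_sign_fps)

text \<open>Descent to the quotient through a chosen representative; \<open>induced_map_eq\<close>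
  shows independence of the choice. The restriction makes the result \<open>extensional\<close>, as
  demanded both by \<open>derivation_extending\<close> and by the uniqueness statement for
  K.\<close>

definition induced_map ::
    "(('w, 'k) free_alg fps \<Rightarrow> ('w, 'k) free_alg fps) \<Rightarrow>
      (nat \<Rightarrow> ('w, 'k) free_alg set) \<Rightarrow> nat \<Rightarrow> ('w, 'k) free_alg set" where
  "induced_map D = restrict (\<lambda>x. \<pi> (D (SOME f. f \<in> P \<and> \<pi> f = x))) (carrier A)"

lemma induced_map_eq:
  assumes "\<And>f g. D (f - g) = D f - D g" "\<And>f. f \<in> J \<Longrightarrow> D f \<in> J" "f \<in> P"
  shows "induced_map D (\<pi> f) = \<pi> (D f)"
proof -
  define g where "g = (SOME g. g \<in> P \<and> \<pi> g = \<pi> f)"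
  have "g \<in> P \<and> \<pi> g = \<pi> f"
    unfolding g_def by (rule someI[of _ f]) (simp add: assms(3))
  then have "D (g - f) \<in> J" by (auto simp: series_class_eq_iff assms(2))
  then show ?thesis
    using assms(1,3) by (simp add: induced_map_def flip: g_def) (simp add: series_class_eq_iff)
qed

lemma word_extend_in_P:
  assumes "\<And>xs. xs \<in> lists (homog V) \<Longrightarrow> W xs \<in> P" "p \<in> words"
  shows "word_extend W p \<in> P"
  using assms(2) by (induction rule: words_induct) (auto simp: word_extend_add assms(1))

lemma series_extend_in_P:
  assumes "\<And>xs. xs \<in> lists (homog V) \<Longrightarrow> W xs \<in> P" "f \<in> P"
  shows "series_extend W f \<in> P"
  using assms(2) by (rule ps_extend_coeffs_in) (auto intro: word_extend_in_P assms(1))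

lemma series_extend_in_H:
  assumes "\<And>xs. xs \<in> lists (homog V) \<Longrightarrow> W xs \<in> H (total_degree xs + e)" "f \<in> H d"
  shows "series_extend W f \<in> H (d + e)"
  using assms(2)
proof (rule ps_extend_coeffs_in)
  fix a assume "a \<in> homog_words d"
  then show "word_extend W a \<in> H (d + e)"
  proof (induction rule: homog_words_induct)
    case (monomial xs c)
    then show ?case using H_mult[OF H_const[OF homog_words_const, of c] assms(1)[of xs]] by simp
  qed (auto simp: word_extend_add H_add)
qed auto

text \<open>Relations flanked by words span the ideal additively up to scalars, so they are the only
  elements to be tested.\<close>

lemma series_extend_in_J:
  assumes "\<And>xs r ys. xs \<in> lists (homog V) \<Longrightarrow> ys \<in> lists (homog V) \<Longrightarrow>
      r \<in> sym_relations scale V \<Longrightarrow> word_extend W (monomial xs * r * monomial ys) \<in> J" "f \<in> J"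
  shows "series_extend W f \<in> J"
  using assms(2)
proof (rule ps_extend_coeffs_in)
  fix a assume "a \<in> I"
  then show "word_extend W a \<in> J"
    by (induction rule: sym_ideal_induct)
      (auto simp: word_extend_add word_extend_const_mult intro!: J_mult_left assms(1))
qed auto

lemma ps_linear_induced:
  assumes P: "\<And>xs. xs \<in> lists (homog V) \<Longrightarrow> W xs \<in> P"
    and J: "\<And>f. f \<in> J \<Longrightarrow> series_extend W f \<in> J"
  shows "ps_linear scale V (induced_map (series_extend W))"
proof -
  have eq: "induced_map (series_extend W) (\<pi> f) = \<pi> (series_extend W f)" if "f \<in> P" for f
    using that by (intro induced_map_eq J series_extend_diff)
  show ?thesis
    unfolding ps_linear_def SymPS_carrier
    by (auto simp: eq SymPS_add SymPS_mult ps_scalar_eq series_extend_add series_extend_scalar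
        series_extend_in_P[OF P])
qed

text \<open>Linearity is asked modulo \<open>J\<close> only: in the free algebra the letter of a sum
  is a new letter, not the sum of letters, so even the identity assignment is linear just modulo the
  relations.\<close>

definition linear_on_generators :: "(int \<times> 'w \<Rightarrow> ('w, 'k) free_alg fps) \<Rightarrow> bool" where
  "linear_on_generators G \<longleftrightarrow>
    (\<forall>i. \<forall>u\<in>V i. \<forall>v\<in>V i. G (i, u + v) - G (i, u) - G (i, v) \<in> J) \<and>
    (\<forall>i c. \<forall>u\<in>V i. G (i, scale c u) - fps_const (const c) * G (i, u) \<in> J)"

lemma sym_relations_cases:
  assumes "r \<in> sym_relations scale V"
  obtains (add) i u v where "u \<in> V i" "v \<in> V i" "r = letter (i, u + v) - letter (i, u) - letter
      (i, v)"
  | (scale) i c u where "u \<in> V i" "r = letter (i, scale c u) - const c * letter (i, u)"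
  | (commute) i j u v where "u \<in> V i" "v \<in> V j"
      "r = letter (i, u) * letter (j, v) - parity_sign (i * j) * (letter (j, v) * letter (i, u))"
  using assms unfolding sym_relations_def minus_one_powi const_parity_sign mult.assoc by blast

lemma homog_words_diff: "p \<in> homog_words d \<Longrightarrow> q \<in> homog_words d \<Longrightarrow> p - q \<in> homog_words d"
  using homog_words_add[of p d "const (-1) * q"] homog_words_const_mult[of q d "-1"]
  by (simp add: const_uminus)

lemma homog_words_parity_sign: "p \<in> homog_words d \<Longrightarrow> parity_sign e * p \<in> homog_words d"
  using homog_words_const_mult[of p d "parity_sign e"] by (simp add: const_parity_sign)

lemma V_subspace [simp]:
  "u \<in> V i \<Longrightarrow> v \<in> V i \<Longrightarrow> u + v \<in> V i" "u \<in> V i \<Longrightarrow> scale c u \<in> V i" "0 \<in> V i"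
  using component_subspace[of i] by (auto simp: subspace_def)

lemma homog_iff [simp]: "(i, u) \<in> homog V \<longleftrightarrow> u \<in> V i"
  by (simp add: homog_def)

text \<open>Serves \<open>derivation_in_J\<close>: the Leibniz rule carries a sign depending on the
  degree of the left factor, so it can be applied to a relation only if the relation is
  homogeneous.\<close>

lemma sym_relations_homogeneous:
  assumes "r \<in> sym_relations scale V"
  shows "\<exists>d. r \<in> homog_words d"
  using assms
proof (cases rule: sym_relations_cases)
  case (add i u v)
  then have "r \<in> homog_words i" by (auto intro!: homog_words_diff homog_words_letter)
  then show ?thesis ..
next
  case (scale i c u)
  then have "r \<in> homog_words i"
    by (auto intro!: homog_words_diff homog_words_letter homog_words_const_mult)
  then show ?thesis ..
next
  case (commute i j u v)
  then have "letter (i, u) * letter (j, v) \<in> homog_words (i + j)"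
    "letter (j, v) * letter (i, u) \<in> homog_words (i + j)"
    using homog_words_mult[OF homog_words_letter[of i u] homog_words_letter[of j v]]
      homog_words_mult[OF homog_words_letter[of j v] homog_words_letter[of i u]]
    by (simp_all add: add.commute)
  then have "r \<in> homog_words (i + j)"
    using commute(3) by (auto intro!: homog_words_diff homog_words_parity_sign)
  then show ?thesis ..
qed

lemma word_extend_letter:
  "word_extend (derivation_word G) (letter x) = G x"
  "word_extend (morphism_word G) (letter x) = G x"
  by (simp_all add: letter_eq_monomial monomial_Nil morphism_word_def)

lemma derivation_word_in_H:
  assumes "\<And>i v. v \<in> V i \<Longrightarrow> G (i, v) \<in> H (i + e)" "xs \<in> lists (homog V)"
  shows "derivation_word G xs \<in> H (total_degree xs + e)"
  using assms(2)
proof (induction xs)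
  case (Cons x xs)
  obtain i v where x: "x = (i, v)" "v \<in> V i" using Cons by (cases x) auto
  have "G x * fps_const (monomial xs) \<in> H (i + e + total_degree xs)"
    using Cons x by (intro H_mult H_const) (auto intro: assms(1) homog_words_monomial)
  moreover have "fps_const (letter x) * derivation_word G xs \<in> H (i + (total_degree xs + e))"
    using Cons x by (intro H_mult H_const) (auto intro: homog_words_letter)
  then have "parity_sign (fst x) * (fps_const (letter x) * derivation_word G xs) \<in> H (i +
      (total_degree xs + e))"
    by (rule H_parity_sign)
  moreover have "i + e + total_degree xs = total_degree (x # xs) + e"
    "i + (total_degree xs + e) = total_degree (x # xs) + e"
    by (simp_all add: x total_degree_def)
  ultimately show ?case
    by (simp only: derivation_word.simps mult.assoc H_add)
qed simp

text \<open>Applied to a commutation relation, the derivation yields two graded commutators, of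
  \<open>G (i, u)\<close> with \<open>v\<close> and of \<open>u\<close> with
  \<open>G (j, v)\<close>. Both lie in \<open>J\<close> by
  \<open>graded_commute_series\<close>.\<close>

lemma derivation_relation_in_J:
  assumes G: "linear_on_generators G" "\<And>i v. v \<in> V i \<Longrightarrow> G (i, v) \<in> H (i + 1)"
    and r: "r \<in> sym_relations scale V"
  shows "word_extend (derivation_word G) r \<in> J"
  using r
proof (cases rule: sym_relations_cases)
  case (add i u v)
  then show ?thesis
    using G(1) by (simp add: word_extend_diff word_extend_letter linear_on_generators_def)
next
  case (scale i c u)
  then show ?thesis
    using G(1) by (simp add: word_extend_diff word_extend_const_mult word_extend_letter
        linear_on_generators_def)
next
  case (commute i j u v)
  let ?u = "letter (i, u)" and ?v = "letter (j, v)"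
  \<comment> \<open>The exponents \<open>(i + 1) * j\<close> and \<open>i * (j + 1)\<close> reflect
    that \<open>G\<close> raises degrees by 1; they equal \<open>i * j\<close> corrected by the
    Leibniz signs.\<close>
  let ?a = "G (i, u) * fps_const ?v - parity_sign ((i + 1) * j) * (fps_const ?v * G (i, u))"
  let ?b = "fps_const ?u * G (j, v) - parity_sign (i * (j + 1)) * (G (j, v) * fps_const ?u)"
  have uv: "?u \<in> homog_words i" "?v \<in> homog_words j"
    using commute by (auto intro: homog_words_letter)
  have 1: "?a \<in> J" and 2: "?b \<in> J"
    using commute G(2) uv by (auto intro!: graded_commute_series H_const)
  have "word_extend (derivation_word G) r = ?a + parity_sign i * ?b"
    unfolding commute(3) word_extend_diff word_extend_parity_sign
      word_extend_derivation_mult[OF uv(1)] word_extend_derivation_mult[OF uv(2)] word_extend_letter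
    by (auto simp: parity_sign_def algebra_simps)
  then show ?thesis using 1 J_parity_sign[OF 2, of i] by simp
qed

text \<open>Each of the three Leibniz terms of a flanked relation contains either the relation
  itself or its derivative, and both lie in the ideal.\<close>

lemma derivation_in_J:
  assumes G: "linear_on_generators G" "\<And>i v. v \<in> V i \<Longrightarrow> G (i, v) \<in> H (i + 1)"
    and f: "f \<in> J"
  shows "series_extend (derivation_word G) f \<in> J"
  using _ f
proof (rule series_extend_in_J)
  fix xs r ys assume xs: "xs \<in> lists (homog V)" "ys \<in> lists (homog V)"
      and r: "r \<in> sym_relations scale V"
  let ?E = "word_extend (derivation_word G)"
  obtain e where e: "r \<in> homog_words e" using sym_relations_homogeneous[OF r] by blast
  have rI: "r \<in> I" using r sym_relations_in_ideal by blast
  have E: "?E (monomial us) \<in> P" if "us \<in> lists (homog V)" for us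
    using H_subset[OF derivation_word_in_H[OF G(2) that]] by simp
  have "?E (monomial xs * (r * monomial ys)) =
      ?E (monomial xs) * (fps_const r * fps_const (monomial ys)) +
      parity_sign (total_degree xs) * (fps_const (monomial xs) * (?E r * fps_const (monomial ys) +
        parity_sign e * (fps_const r * ?E (monomial ys))))"
    by (simp add: word_extend_derivation_mult[OF homog_words_monomial[OF xs(1)]]
        word_extend_derivation_mult[OF e] mult.assoc)
  also have "\<dots> \<in> J"
    using xs rI derivation_relation_in_J[OF G r] E
    by (intro J_add J_mult_left[OF E] J_mult_left[OF P_const] J_parity_sign
        J_mult_right[OF P_const] J_mult_right[OF E] J_const) auto
  finally show "?E (monomial xs * r * monomial ys) \<in> J" by (simp add: mult.assoc)
qed

lemma morphism_word_in_H:
  assumes "\<And>i v. v \<in> V i \<Longrightarrow> G (i, v) \<in> H i" "xs \<in> lists (homog V)"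
  shows "morphism_word G xs \<in> H (total_degree xs)"
  using assms(2)
proof (induction xs)
  case Nil
  show ?case by (simp add: morphism_word_def total_degree_def H_1)
next
  case (Cons x xs)
  then show ?case
    using H_mult[OF assms(1)[of "snd x" "fst x"], of "morphism_word G xs" "total_degree xs"]
    by (cases x) (auto simp: morphism_word_def total_degree_def)
qed

text \<open>By multiplicativity the image of the relation stays flanked by two images of words.
  Commutation relations survive because \<open>G\<close> preserves degrees, so its values commute up
  to the same sign modulo \<open>J\<close>.\<close>

lemma morphism_in_J:
  assumes G: "linear_on_generators G" "\<And>i v. v \<in> V i \<Longrightarrow> G (i, v) \<in> H i"
    and f: "f \<in> J"
  shows "series_extend (morphism_word G) f \<in> J"
  using _ f
proof (rule series_extend_in_J)
  fix xs r ys assume xs: "xs \<in> lists (homog V)" "ys \<in> lists (homog V)"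
      and r: "r \<in> sym_relations scale V"
  let ?E = "word_extend (morphism_word G)"
  have E: "?E (monomial us) \<in> P" if "us \<in> lists (homog V)" for us
    using H_subset[OF morphism_word_in_H[OF G(2) that]] by simp
  have "?E r \<in> J"
    using r
  proof (cases rule: sym_relations_cases)
    case (add i u v)
    then show ?thesis
      using G(1) by (simp add: word_extend_diff word_extend_letter linear_on_generators_def)
  next
    case (scale i c u)
    then show ?thesis
      using G(1) by (simp add: word_extend_diff word_extend_const_mult word_extend_letter
          linear_on_generators_def)
  next
    case (commute i j u v)
    then show ?thesis
      using graded_commute_series[OF G(2)[of u i] G(2)[of v j]]
      by (simp add: word_extend_diff word_extend_parity_sign word_extend_morphism_mult
          word_extend_letter)
  qed
  then show "?E (monomial xs * r * monomial ys) \<in> J"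
    using E[OF xs(1)] E[OF xs(2)] unfolding word_extend_morphism_mult
    by (intro J_mult_left J_mult_right)
qed

text \<open>The target is a bare set with an addition \<open>pl\<close> and a scaling
  \<open>sc\<close>, because maps into power series and maps into \<open>S\<close> are both compared
  in this way.\<close>

lemma Sym_linear_eqI:
  assumes f: "f \<in> carrier S \<rightarrow> X" and g: "g \<in> carrier S \<rightarrow> X"
    and fadd: "\<And>x y. x \<in> carrier S \<Longrightarrow> y \<in> carrier S \<Longrightarrow> f (x \<oplus>\<^bsub>S\<^esub> y) = pl (f x) (f y)"
    and gadd: "\<And>x y. x \<in> carrier S \<Longrightarrow> y \<in> carrier S \<Longrightarrow> g (x \<oplus>\<^bsub>S\<^esub> y) = pl (g x) (g y)"
    and fscale: "\<And>c x. x \<in> carrier S \<Longrightarrow> f (cls (const c) \<otimes>\<^bsub>S\<^esub> x) = sc c (f x)"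
    and gscale: "\<And>c x. x \<in> carrier S \<Longrightarrow> g (cls (const c) \<otimes>\<^bsub>S\<^esub> x) = sc c (g x)"
    and mono: "\<And>xs. xs \<in> lists (homog V) \<Longrightarrow> f (cls (monomial xs)) = g (cls (monomial xs))"
    and x: "x \<in> carrier S"
  shows "f x = g x"
proof -
  obtain p where p: "p \<in> words" "x = cls p" using x by (auto simp: Sym_carrier)
  from p(1) have "p \<in> words \<and> f (cls p) = g (cls p)"
  proof (induction rule: words_induct)
    case zero
    \<comment> \<open>No zero law is known for \<open>pl\<close> and \<open>sc\<close>, so the zero
      class is treated as the scalar 0 times the empty word, where \<open>f\<close> and
      \<open>g\<close> agree.\<close>
    have "cls 0 = cls (const 0) \<otimes>\<^bsub>S\<^esub> cls (monomial [])" by (simp add: Sym_mult)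
    then show ?case
      using mono[of "[]"] fscale[of "cls (monomial [])" 0] gscale[of "cls (monomial [])" 0] by simp
  next
    case (monomial xs c)
    then show ?case
      using fscale[of "cls (monomial xs)" c] gscale[of "cls (monomial xs)" c] mono[of xs]
      by (simp add: Sym_mult)
  next
    case (add a b)
    then show ?case
      using fadd[of "cls a" "cls b"] gadd[of "cls a" "cls b"] by (simp add: Sym_add)
  qed
  then show ?thesis using p by simp
qed

lemma series_class_expand:
  assumes "f \<in> P"
  shows "\<pi> f = \<pi> (fps_const (fps_nth f 0)) \<oplus>\<^bsub>A\<^esub> ps_scalar scale V fps_X \<otimes>\<^bsub>A\<^esub> \<pi> (fps_shift 1 f)"
proof -
  have "fps_shift 1 f \<in> P" using assms by (auto simp: coeffs_in_def)
  then show ?thesis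
    using assms fps_eq_const_plus_X[of f]
    by (simp add: ps_scalar_X SymPS_mult SymPS_add coeffs_in_nth)
qed

lemma SymPS_X_mult_nth:
  assumes "x \<in> carrier A"
  shows "(ps_scalar scale V fps_X \<otimes>\<^bsub>A\<^esub> x) n = (if n = 0 then \<zero>\<^bsub>S\<^esub> else x (n - 1))"
proof -
  obtain f where f: "f \<in> P" "x = \<pi> f" using assms by (auto simp: SymPS_carrier)
  from f show ?thesis
    by (simp add: ps_scalar_X SymPS_mult) (simp add: series_class_def Sym_zero)
qed

lemma SymPS_add_nth: "(x \<oplus>\<^bsub>A\<^esub> y) n = x n \<oplus>\<^bsub>S\<^esub> y n"
  by (simp add: SymPS_def power_series_ring_def)

lemma SymPS_carrier_nth: "x \<in> carrier A \<Longrightarrow> x n \<in> carrier S"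
  by (auto simp: SymPS_carrier series_class_def coeffs_in_def)

text \<open>A recursion in the coefficient index. It gives uniqueness in
  \<open>ps_linear_eqI\<close> and the splitting of a map into components in
  \<open>ps_linear_components\<close>.\<close>

lemma ps_linear_expand_nth:
  assumes D: "ps_linear scale V D" and f: "f \<in> P"
  shows "D (\<pi> f) n = D (\<pi> (fps_const (fps_nth f 0))) n \<oplus>\<^bsub>S\<^esub>
    (if n = 0 then \<zero>\<^bsub>S\<^esub> else D (\<pi> (fps_shift 1 f)) (n - 1))"
proof -
  have shift: "fps_shift 1 f \<in> P" using f by (auto simp: coeffs_in_def)
  interpret ring A by (rule ring_SymPS)
  have "D (\<pi> f) = D (\<pi> (fps_const (fps_nth f 0))) \<oplus>\<^bsub>A\<^esub> ps_scalar scale V fps_X \<otimes>\<^bsub>A\<^esub> D (\<pi> (fps_shift 1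
      f))"
    unfolding series_class_expand[OF f] using D shift f
    by (simp add: ps_linear_def coeffs_in_nth)
  moreover have "D (\<pi> (fps_shift 1 f)) \<in> carrier A"
    using D shift by (auto simp: ps_linear_def)
  ultimately show ?thesis by (simp add: SymPS_add_nth SymPS_X_mult_nth)
qed

lemma ps_linear_add:
  "ps_linear scale V D \<Longrightarrow> x \<in> carrier A \<Longrightarrow> y \<in> carrier A \<Longrightarrow> D (x \<oplus>\<^bsub>A\<^esub> y) = D x \<oplus>\<^bsub>A\<^esub> D y"
  by (simp add: ps_linear_def)

lemma ps_linear_scalar:
  "ps_linear scale V D \<Longrightarrow> x \<in> carrier A \<Longrightarrow>
    D (ps_scalar scale V c \<otimes>\<^bsub>A\<^esub> x) = ps_scalar scale V c \<otimes>\<^bsub>A\<^esub> D x"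
  by (simp add: ps_linear_def)

lemma ps_linear_closed: "ps_linear scale V D \<Longrightarrow> x \<in> carrier A \<Longrightarrow> D x \<in> carrier A"
  by (auto simp: ps_linear_def)

lemma ps_const_in_carrier: "x \<in> carrier S \<Longrightarrow> ps_const S x \<in> carrier A"
  by (auto simp: Sym_carrier ps_const_eq)

lemma ps_const_add: "x \<in> carrier S \<Longrightarrow> y \<in> carrier S \<Longrightarrow>
    ps_const S (x \<oplus>\<^bsub>S\<^esub> y) = ps_const S x \<oplus>\<^bsub>A\<^esub> ps_const S y"
  by (auto simp: Sym_carrier Sym_add ps_const_eq SymPS_add)

lemma ps_const_scalar: "x \<in> carrier S \<Longrightarrow>
    ps_const S (cls (const c) \<otimes>\<^bsub>S\<^esub> x) = ps_scalar scale V (fps_const c) \<otimes>\<^bsub>A\<^esub> ps_const S x"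
  by (auto simp: Sym_carrier Sym_mult ps_const_eq SymPS_mult ps_scalar_const)

lemma ps_linear_eqI:
  assumes D: "ps_linear scale V D" and D': "ps_linear scale V D'"
    and mono: "\<And>xs. xs \<in> lists (homog V) \<Longrightarrow> D (\<pi> (fps_const (monomial xs))) =
        D' (\<pi> (fps_const (monomial xs)))"
    and x: "x \<in> carrier A"
  shows "D x = D' x"
proof -
  obtain f where f: "f \<in> P" "x = \<pi> f" using x by (auto simp: SymPS_carrier)
  have const: "D (ps_const S y) = D' (ps_const S y)" if "y \<in> carrier S" for y
  proof (rule Sym_linear_eqI[where X = "carrier A" and pl = "add A" and
        sc = "\<lambda>c x. ps_scalar scale V (fps_const c) \<otimes>\<^bsub>A\<^esub> x"])
    show "(\<lambda>y. D (ps_const S y)) \<in> carrier S \<rightarrow> carrier A" "(\<lambda>y. D' (ps_const S y)) \<in> carrier S \<rightarrow>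
        carrier A"
      using ps_linear_closed[OF D] ps_linear_closed[OF D'] by (auto simp: ps_const_in_carrier)
    show "D (ps_const S (x \<oplus>\<^bsub>S\<^esub> y)) = D (ps_const S x) \<oplus>\<^bsub>A\<^esub> D (ps_const S y)"
      "D' (ps_const S (x \<oplus>\<^bsub>S\<^esub> y)) = D' (ps_const S x) \<oplus>\<^bsub>A\<^esub> D' (ps_const S y)"
      if "x \<in> carrier S" "y \<in> carrier S" for x y
      using that by (simp_all add: ps_const_add ps_linear_add[OF D] ps_linear_add[OF D']
          ps_const_in_carrier)
    show "D (ps_const S (cls (const c) \<otimes>\<^bsub>S\<^esub> y)) = ps_scalar scale V (fps_const c) \<otimes>\<^bsub>A\<^esub> D (ps_const S y)"
      "D' (ps_const S (cls (const c) \<otimes>\<^bsub>S\<^esub> y)) = ps_scalar scale V (fps_const c) \<otimes>\<^bsub>A\<^esub> D' (ps_const S y)"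
      if "y \<in> carrier S" for c y
      using that by (simp_all add: ps_const_scalar ps_linear_scalar[OF D] ps_linear_scalar[OF D']
          ps_const_in_carrier)
    show "D (ps_const S (cls (monomial xs))) = D' (ps_const S (cls (monomial xs)))"
      if "xs \<in> lists (homog V)" for xs
      using mono[OF that] by (simp add: ps_const_eq)
  qed fact
  \<comment> \<open>The induction ranges over all \<open>f\<close>, since its step passes to
    \<open>fps_shift 1 f\<close>; the constant term is settled by \<open>const\<close>.\<close>
  have "D (\<pi> f) n = D' (\<pi> f) n" for n
    using f(1)
  proof (induction n arbitrary: f)
    case (0 f)
    show ?case
      unfolding ps_linear_expand_nth[OF D 0] ps_linear_expand_nth[OF D' 0]
      using const[of "cls (fps_nth f 0)"] 0 by (simp add: ps_const_eq coeffs_in_nth)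
  next
    case (Suc n f)
    have "fps_shift 1 f \<in> P" using Suc.prems by (auto simp: coeffs_in_def)
    then show ?case
      unfolding ps_linear_expand_nth[OF D Suc.prems] ps_linear_expand_nth[OF D' Suc.prems]
      using const[of "cls (fps_nth f 0)"] Suc by (simp add: ps_const_eq coeffs_in_nth)
  qed
  then show ?thesis using f by auto
qed

lemma series_class_monomial_Cons:
  assumes "x \<in> homog V" "xs \<in> lists (homog V)"
  shows "\<pi> (fps_const (monomial (x # xs))) = ps_gen scale V x \<otimes>\<^bsub>A\<^esub> \<pi> (fps_const (monomial xs))"
  using assms by (simp add: ps_gen_eq SymPS_mult monomial_Cons)

lemma ps_gen_degree: "v \<in> V i \<Longrightarrow> ps_gen scale V (i, v) \<in> ps_degree scale V i"
  by (auto simp: ps_gen_eq ps_degree_eq intro!: H_const homog_words_letter)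

text \<open>Since 1 = 1 * 1 has degree 0, the Leibniz rule gives D 1 = D 1 + D 1.\<close>

lemma degree1_derivation_one:
  assumes "degree1_derivation scale V D"
  shows "D \<one>\<^bsub>A\<^esub> = \<zero>\<^bsub>A\<^esub>"
proof -
  interpret ring A by (rule ring_SymPS)
  have 1: "\<one>\<^bsub>A\<^esub> \<in> ps_degree scale V 0" by (auto simp: SymPS_one ps_degree_eq H_1)
  have D1: "D \<one>\<^bsub>A\<^esub> \<in> carrier A" using assms by (auto simp: degree1_derivation_def ps_linear_def)
  have scalar: "ps_scalar scale V (fps_const ((-1) powi 0)) = \<one>\<^bsub>A\<^esub>"
    unfolding minus_one_powi ps_scalar_parity_sign by (simp add: SymPS_one)
  have "D (\<one>\<^bsub>A\<^esub> \<otimes>\<^bsub>A\<^esub> \<one>\<^bsub>A\<^esub>) = D \<one>\<^bsub>A\<^esub> \<otimes>\<^bsub>A\<^esub> \<one>\<^bsub>A\<^esub> \<oplus>\<^bsub>A\<^esub>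
      ps_scalar scale V (fps_const ((-1) powi 0)) \<otimes>\<^bsub>A\<^esub> (\<one>\<^bsub>A\<^esub> \<otimes>\<^bsub>A\<^esub> D \<one>\<^bsub>A\<^esub>)"
    using assms 1 unfolding degree1_derivation_def by blast
  then have "D \<one>\<^bsub>A\<^esub> = D \<one>\<^bsub>A\<^esub> \<oplus>\<^bsub>A\<^esub> D \<one>\<^bsub>A\<^esub>"
    unfolding scalar using D1 by simp
  then show ?thesis using D1 by (metis add.l_cancel_one')
qed

lemma degree1_derivation_unique:
  assumes D: "degree1_derivation scale V D" and D': "degree1_derivation scale V D'"
    and gen: "\<And>x. x \<in> homog V \<Longrightarrow> D (ps_gen scale V x) = D' (ps_gen scale V x)"
    and x: "x \<in> carrier A"
  shows "D x = D' x"
proof (rule ps_linear_eqI[where D = D and D' = D'])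
  show "ps_linear scale V D" "ps_linear scale V D'" using D D'
      by (auto simp: degree1_derivation_def)
  show "D (\<pi> (fps_const (monomial xs))) = D' (\<pi> (fps_const (monomial xs)))"
      if "xs \<in> lists (homog V)" for xs
    using that
  proof (induction xs)
    case Nil
    then show ?case
      using degree1_derivation_one[OF D] degree1_derivation_one[OF D']
          by (simp add: SymPS_one monomial_Nil)
  next
    case (Cons x xs)
    then have mem: "ps_gen scale V x \<in> ps_degree scale V (fst x)" "\<pi> (fps_const (monomial xs)) \<in>
        carrier A"
      using ps_gen_degree by (cases x, auto)
    with Cons D D' gen show ?case
      unfolding degree1_derivation_def by (simp add: series_class_monomial_Cons)
  qed
qed fact

lemma derivation_exists:
  assumes G: "linear_on_generators G" "\<And>i v. v \<in> V i \<Longrightarrow> G (i, v) \<in> H (i + 1)"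
  defines "D \<equiv> induced_map (series_extend (derivation_word G))"
  shows "D \<in> extensional (carrier A)" "degree1_derivation scale V D"
    "x \<in> homog V \<Longrightarrow> D (ps_gen scale V x) = \<pi> (G x)"
proof -
  let ?E = "series_extend (derivation_word G)"
  have WH: "derivation_word G xs \<in> H (total_degree xs + 1)" if "xs \<in> lists (homog V)" for xs
    using derivation_word_in_H[OF G(2) that] .
  have EP: "?E f \<in> P" if "f \<in> P" for f
    using WH that by (intro series_extend_in_P) (auto intro: H_subset)
  have eq: "D (\<pi> f) = \<pi> (?E f)" if "f \<in> P" for f
    unfolding D_def using that derivation_in_J[OF G]
    by (intro induced_map_eq) (auto simp: series_extend_diff)
  show "D \<in> extensional (carrier A)" by (simp add: D_def induced_map_def)
  have lin: "ps_linear scale V D"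
    unfolding D_def using WH derivation_in_J[OF G]
    by (intro ps_linear_induced) (auto intro: H_subset)
  have deg: "D ` ps_degree scale V d \<subseteq> ps_degree scale V (d + 1)" for d
    unfolding ps_degree_eq by (auto simp: eq H_subset intro!: imageI series_extend_in_H WH)
  have leibniz: "D (\<pi> f \<otimes>\<^bsub>A\<^esub> \<pi> g) = D (\<pi> f) \<otimes>\<^bsub>A\<^esub> \<pi> g \<oplus>\<^bsub>A\<^esub>
      ps_scalar scale V (fps_const ((-1) powi d)) \<otimes>\<^bsub>A\<^esub> (\<pi> f \<otimes>\<^bsub>A\<^esub> D (\<pi> g))"
    if f: "f \<in> H d" and g: "g \<in> P" for f g d
    unfolding minus_one_powi ps_scalar_parity_sign
    using that H_subset[OF f] by (simp add: eq EP SymPS_mult SymPS_add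
        series_extend_derivation_mult mult.assoc)
  show "degree1_derivation scale V D"
    unfolding degree1_derivation_def
  proof (intro conjI allI ballI)
    fix d x y assume "x \<in> ps_degree scale V d" "y \<in> carrier A"
    then show "D (x \<otimes>\<^bsub>A\<^esub> y) = D x \<otimes>\<^bsub>A\<^esub> y \<oplus>\<^bsub>A\<^esub>
      ps_scalar scale V (fps_const ((-1) powi d)) \<otimes>\<^bsub>A\<^esub> (x \<otimes>\<^bsub>A\<^esub> D y)"
      unfolding ps_degree_eq SymPS_carrier using leibniz by blast
  qed (use lin deg in auto)
  show "D (ps_gen scale V x) = \<pi> (G x)" if "x \<in> homog V"
    using that by (simp add: ps_gen_eq eq series_extend_const word_extend_letter)
qed

text \<open>This evaluates the definite description. The values \<open>g\<close> live in the
  quotient and \<open>G\<close> is a lift of them to representatives; the \<open>extensional\<close>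
  clause turns agreement on the carrier into equality of functions.\<close>

lemma derivation_extending:
  assumes G: "linear_on_generators G" "\<And>i v. v \<in> V i \<Longrightarrow> G (i, v) \<in> H (i + 1)"
    and g: "\<And>x. x \<in> homog V \<Longrightarrow> g x = \<pi> (G x)"
  shows "derivation_extending scale V g \<in> extensional (carrier A)"
    "degree1_derivation scale V (derivation_extending scale V g)"
    "x \<in> homog V \<Longrightarrow> derivation_extending scale V g (ps_gen scale V x) = \<pi> (G x)"
proof -
  have "\<exists>!D. D \<in> extensional (carrier A) \<and> degree1_derivation scale V D \<and>
      (\<forall>x\<in>homog V. D (ps_gen scale V x) = g x)"
  proof (rule ex_ex1I)
    show "\<exists>D. D \<in> extensional (carrier A) \<and> degree1_derivation scale V D \<and>
      (\<forall>x\<in>homog V. D (ps_gen scale V x) = g x)"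
      using derivation_exists[OF G] g by auto
    fix D D' assume *: "D \<in> extensional (carrier A) \<and> degree1_derivation scale V D \<and>
      (\<forall>x\<in>homog V. D (ps_gen scale V x) = g x)"
      "D' \<in> extensional (carrier A) \<and> degree1_derivation scale V D' \<and>
      (\<forall>x\<in>homog V. D' (ps_gen scale V x) = g x)"
    show "D = D'"
    proof (rule extensionalityI)
      show "D \<in> extensional (carrier A)" "D' \<in> extensional (carrier A)" using * by auto
      show "D x = D' x" if "x \<in> carrier A" for x
        by (rule degree1_derivation_unique) (use * that in auto)
    qed
  qed
  from theI'[OF this] show "derivation_extending scale V g \<in> extensional (carrier A)"
    "degree1_derivation scale V (derivation_extending scale V g)"
    "x \<in> homog V \<Longrightarrow> derivation_extending scale V g (ps_gen scale V x) = \<pi> (G x)"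
    unfolding derivation_extending_def using g by auto
qed

lemma morphism_exists:
  assumes G: "linear_on_generators G" "\<And>i v. v \<in> V i \<Longrightarrow> G (i, v) \<in> H i"
  defines "K \<equiv> induced_map (series_extend (morphism_word G))"
  shows "K \<in> extensional (carrier A)" "cga_morphism scale V K"
    "x \<in> homog V \<Longrightarrow> K (ps_gen scale V x) = \<pi> (G x)"
proof -
  let ?E = "series_extend (morphism_word G)"
  have WH: "morphism_word G xs \<in> H (total_degree xs + 0)" if "xs \<in> lists (homog V)" for xs
    using morphism_word_in_H[OF G(2) that] by simp
  have EP: "?E f \<in> P" if "f \<in> P" for f
    using WH that by (intro series_extend_in_P) (auto intro: H_subset)
  have eq: "K (\<pi> f) = \<pi> (?E f)" if "f \<in> P" for f
    unfolding K_def using that morphism_in_J[OF G]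
    by (intro induced_map_eq) (auto simp: series_extend_diff)
  show "K \<in> extensional (carrier A)" by (simp add: K_def induced_map_def)
  have lin: "ps_linear scale V K"
    unfolding K_def using WH morphism_in_J[OF G]
    by (intro ps_linear_induced) (auto intro: H_subset)
  have deg: "K ` ps_degree scale V d \<subseteq> ps_degree scale V d" for d
    unfolding ps_degree_eq using series_extend_in_H[OF WH, of _ d] by (auto simp: eq H_subset)
  have one: "?E 1 = 1"
    using series_extend_const[of "morphism_word G" 1] word_extend_monomial[of "morphism_word G"
        "[]"]
    by (simp add: monomial_Nil morphism_word_def)
  have hom: "K \<in> ring_hom A A"
    by (rule ring_hom_memI)
      (auto simp: SymPS_carrier SymPS_mult SymPS_add SymPS_one eq EP series_extend_add
        series_extend_morphism_mult one)
  show "cga_morphism scale V K"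
    unfolding cga_morphism_def using lin deg hom by auto
  show "K (ps_gen scale V x) = \<pi> (G x)" if "x \<in> homog V"
    using that by (simp add: ps_gen_eq eq series_extend_const word_extend_letter)
qed

lemma cga_morphism_unique:
  assumes K: "cga_morphism scale V K" and K': "cga_morphism scale V K'"
    and gen: "\<And>x. x \<in> homog V \<Longrightarrow> K (ps_gen scale V x) = K' (ps_gen scale V x)"
    and x: "x \<in> carrier A"
  shows "K x = K' x"
proof (rule ps_linear_eqI[where D = K and D' = K'])
  show "ps_linear scale V K" "ps_linear scale V K'" using K K' by (auto simp: cga_morphism_def)
  have hom: "K \<in> ring_hom A A" "K' \<in> ring_hom A A" using K K' by (auto simp: cga_morphism_def)
  show "K (\<pi> (fps_const (monomial xs))) = K' (\<pi> (fps_const (monomial xs)))"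
      if "xs \<in> lists (homog V)" for xs
    using that
  proof (induction xs)
    case Nil
    then show ?case
      using ring_hom_one[OF hom(1)] ring_hom_one[OF hom(2)] by (simp add: SymPS_one monomial_Nil)
  next
    case (Cons x xs)
    with gen ring_hom_mult[OF hom(1)] ring_hom_mult[OF hom(2)] show ?case
      by (simp add: series_class_monomial_Cons)
  qed
qed fact

end

section \<open>Koszul signs and the pairing\<close>

definition index_pairs :: "nat \<Rightarrow> (nat \<times> nat) set" where
  "index_pairs n = {(a, b). a < b \<and> b < n}"

definition inversions :: "nat \<Rightarrow> (nat \<Rightarrow> nat) \<Rightarrow> (nat \<times> nat) set" where
  "inversions n \<sigma> = {(a, b) \<in> index_pairs n. \<sigma> b < \<sigma> a}"

lemma finite_index_pairs [simp]: "finite (index_pairs n)"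
  by (rule finite_subset[of _ "{..<n} \<times> {..<n}"]) (auto simp: index_pairs_def)

lemma finite_inversions [simp]: "finite (inversions n \<sigma>)"
  by (rule finite_subset[OF _ finite_index_pairs[of n]]) (auto simp: inversions_def)

section \<open>Permutations as products of adjacent transpositions\<close>

abbreviation adjacent_swap :: "nat \<Rightarrow> nat \<Rightarrow> nat" where
  "adjacent_swap a \<equiv> transpose a (Suc a)"

lemma adjacent_swap_permutes: "Suc a < n \<Longrightarrow> adjacent_swap a permutes {..<n}"
  by (rule permutes_swap_id) auto

lemma adjacent_swap_pair:
  assumes "Suc a < n" "z \<in> index_pairs n - {(a, Suc a)}"
  shows "map_prod (adjacent_swap a) (adjacent_swap a) z \<in> index_pairs n - {(a, Suc a)}"
proof -
  obtain x y where z: "z = (x, y)" "x < y" "y < n" "x \<noteq> a \<or> y \<noteq> Suc a"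
    using assms(2) by (auto simp: index_pairs_def)
  have "adjacent_swap a x < adjacent_swap a y" using z by (auto simp: transpose_def)
  moreover have "adjacent_swap a y < n" using z assms(1) by (simp add: transpose_def)
  moreover have "adjacent_swap a x \<noteq> a \<or> adjacent_swap a y \<noteq> Suc a"
    using z by (auto simp: transpose_def)
  ultimately show ?thesis by (auto simp: z index_pairs_def)
qed

text \<open>The swap reverses the order of the pair (a, a + 1) and of no other, so it acts as an
  involution on the remaining pairs. The condition \<open>C\<close> is a parameter: the trivial one
  serves reversal signs, the inversion condition serves Koszul signs.\<close>

lemma adjacent_swap_pairs_restrict:
  assumes "Suc a < n" and C: "\<And>z. C (map_prod (adjacent_swap a) (adjacent_swap a) z) \<longleftrightarrow> C' z"
  shows "bij_betw (map_prod (adjacent_swap a) (adjacent_swap a))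
    {z \<in> index_pairs n - {(a, Suc a)}. C' z} {z \<in> index_pairs n - {(a, Suc a)}. C z}"
proof -
  let ?t = "map_prod (adjacent_swap a) (adjacent_swap a)" and ?Q = "index_pairs n - {(a, Suc a)}"
  have t: "?t (?t z) = z" for z by (cases z) simp
  have "?t ` {z \<in> ?Q. C' z} \<subseteq> {z \<in> ?Q. C z}" "?t ` {z \<in> ?Q. C z} \<subseteq> {z \<in> ?Q. C' z}"
    using adjacent_swap_pair[OF assms(1)] C t C[symmetric]
        by (metis (mono_tags, lifting) image_subsetI mem_Collect_eq)+
  then show ?thesis
    by (intro bij_betw_byWitness[where f' = ?t]) (simp_all add: t)
qed

lemma adjacent_swap_pairs:
  assumes "Suc a < n"
  shows "bij_betw (map_prod (adjacent_swap a) (adjacent_swap a))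
    (index_pairs n - {(a, Suc a)}) (index_pairs n - {(a, Suc a)})"
  using adjacent_swap_pairs_restrict[OF assms, of "\<lambda>_. True" "\<lambda>_. True"]
  by (simp only: simp_thms Collect_mem_eq)

lemma adjacent_swap_inversions:
  assumes "Suc a < n"
  shows "bij_betw (map_prod (adjacent_swap a) (adjacent_swap a))
    (inversions n (\<sigma> \<circ> adjacent_swap a) - {(a, Suc a)}) (inversions n \<sigma> - {(a, Suc a)})"
proof -
  have "inversions n \<rho> - {(a, Suc a)} = {z \<in> index_pairs n - {(a, Suc a)}. \<rho> (snd z) < \<rho> (fst z)}"
      for \<rho>
    by (auto simp: inversions_def)
  then show ?thesis
    using adjacent_swap_pairs_restrict[OF assms, of "\<lambda>z. \<sigma> (snd z) < \<sigma> (fst z)"] by simp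
qed

text \<open>Bubble sort: swapping at a descent removes exactly one inversion, and a permutation
  without descents is the identity.\<close>

lemma adjacent_swap_permutes_induct [consumes 1, case_names id swap]:
  assumes "\<sigma> permutes {..<n}"
    and id: "P id"
    and swap: "\<And>\<sigma> a. \<sigma> permutes {..<n} \<Longrightarrow> Suc a < n \<Longrightarrow> P \<sigma> \<Longrightarrow> P (\<sigma> \<circ> adjacent_swap a)"
  shows "P \<sigma>"
  using assms(1)
proof (induction "card (inversions n \<sigma>)" arbitrary: \<sigma> rule: less_induct)
  case less
  show ?case
  proof (cases "\<exists>a. Suc a < n \<and> \<sigma> (Suc a) < \<sigma> a")
    case True
    then obtain a where a: "Suc a < n" "\<sigma> (Suc a) < \<sigma> a" by blast
    let ?\<rho> = "\<sigma> \<circ> adjacent_swap a"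
    have perm: "?\<rho> permutes {..<n}"
      using less.prems a(1) by (intro permutes_compose adjacent_swap_permutes)
    have "(a, Suc a) \<in> inversions n \<sigma>" "(a, Suc a) \<notin> inversions n ?\<rho>"
      using a by (auto simp: inversions_def index_pairs_def)
    moreover have "card (inversions n ?\<rho> - {(a, Suc a)}) = card (inversions n \<sigma> - {(a, Suc a)})"
      using bij_betw_same_card[OF adjacent_swap_inversions[OF a(1)]] .
    ultimately have "card (inversions n ?\<rho>) < card (inversions n \<sigma>)"
      by (metis Diff_empty Diff_insert0 card_Diff1_less finite_inversions)
    then have "P ?\<rho>" using less perm by blast
    \<comment> \<open>Swapping the same two positions again restores \<sigma>.\<close>
    then have "P (?\<rho> \<circ> adjacent_swap a)" using swap perm a by blast
    then show ?thesis by (simp add: comp_assoc)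
  next
    case False
    have inj: "inj_on \<sigma> {..<n}" using less.prems permutes_inj_on by blast
    have step: "\<sigma> a < \<sigma> (Suc a)" if "Suc a < n" for a
    proof -
      have "\<sigma> a \<noteq> \<sigma> (Suc a)" using inj_onD[OF inj, of a "Suc a"] that by auto
      then show ?thesis using False that by (meson linorder_neqE_nat)
    qed
    \<comment> \<open>Without descents \<sigma> is increasing below \<open>n\<close>. Climbing from
      0 bounds it from below by the identity, going down from \<open>n - 1\<close> bounds it from
      above.\<close>
    have ge: "a \<le> \<sigma> a" if "a < n" for a
      using that
    proof (induction a)
      case (Suc a)
      then show ?case using step[of a] by simp
    qed simp
    have le: "\<sigma> (n - Suc k) \<le> n - Suc k" if "k < n" for k
      using that
    proof (induction k)
      case 0
      then show ?case using permutes_in_image[OF less.prems, of "n - 1"] by auto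
    next
      case (Suc k)
      have "Suc (n - Suc (Suc k)) = n - Suc k" using Suc by simp
      then show ?case using step[of "n - Suc (Suc k)"] Suc by simp
    qed
    have "\<sigma> = id"
    proof
      fix a show "\<sigma> a = id a"
      proof (cases "a < n")
        case True
        then show ?thesis using ge[OF True] le[of "n - Suc a"] by simp
      next
        case False
        then show ?thesis using less.prems by (simp add: permutes_def)
      qed
    qed
    then show ?thesis using id by simp
  qed
qed

lemma permute_list_adjacent_swap:
  assumes "Suc (length us) < length us + length (x # y # vs)"
  shows "permute_list (adjacent_swap (length us)) (us @ x # y # vs) = us @ y # x # vs"
  by (rule nth_equalityI)
    (auto simp: permute_list_nth[OF adjacent_swap_permutes] transpose_def nth_append nth_Cons'
        split: if_splits)

lemma split_at_adjacent:
  assumes "Suc a < length xs"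
  obtains us x y vs where "xs = us @ x # y # vs" "length us = a" "x = xs ! a" "y = xs ! Suc a"
  using assms
  by (metis Cons_nth_drop_Suc Suc_lessD append_take_drop_id length_take min.absorb4)

lemma koszul_sign_altdef:
  "koszul_sign \<sigma> xs = (\<Prod>(a, b)\<in>inversions (length xs) \<sigma>. parity_sign (fst (xs ! \<sigma> a) * fst (xs ! \<sigma>
      b)))"
  unfolding koszul_sign_def minus_one_powi by (rule prod.cong) (auto simp: inversions_def
      index_pairs_def)

lemma koszul_sign_id [simp]: "koszul_sign id xs = 1"
  unfolding koszul_sign_altdef by (rule prod.neutral) (auto simp: inversions_def index_pairs_def)

lemma koszul_sign_square: "koszul_sign \<sigma> xs * koszul_sign \<sigma> xs = 1"
  unfolding koszul_sign_altdef prod.distrib[symmetric]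
  by (rule prod.neutral) (auto simp: parity_sign_square)

text \<open>Only parities of degrees enter a Koszul sign. Passing to the dual basis negates degrees,
  so a basis word and its dual word carry the same signs.\<close>

lemma koszul_sign_map:
  assumes "\<sigma> permutes {..<length xs}" "\<And>x. even (fst (f x)) = even (fst x)"
  shows "koszul_sign \<sigma> (map f xs) = koszul_sign \<sigma> xs"
proof -
  have "\<sigma> a < length xs" if "a < length xs" for a
    using permutes_in_image[OF assms(1), of a] that by auto
  then show ?thesis
    unfolding koszul_sign_altdef
    by (intro prod.cong) (auto simp: inversions_def index_pairs_def parity_sign_def assms(2))
qed

text \<open>The inversions other than (a, a + 1) correspond under the swap. That pair is an
  inversion of exactly one of the two permutations, and its factor squares to 1, so it may be
  written on either side.\<close>

lemma koszul_sign_swap: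
  assumes "\<sigma> permutes {..<length xs}" "Suc a < length xs"
  shows "koszul_sign (\<sigma> \<circ> adjacent_swap a) xs =
    parity_sign (fst (xs ! \<sigma> a) * fst (xs ! \<sigma> (Suc a))) * koszul_sign \<sigma> xs"
proof -
  let ?n = "length xs" and ?t = "adjacent_swap a" and ?p = "(a, Suc a)"
  define h where "h \<rho> = (\<lambda>(x, y). parity_sign (fst (xs ! \<rho> x) * fst (xs ! \<rho> y)) :: 'b)"
      for \<rho> :: "nat \<Rightarrow> nat"
  have split: "koszul_sign \<rho> xs = (if ?p \<in> inversions ?n \<rho> then h \<rho> ?p else 1) * prod (h \<rho>)
      (inversions ?n \<rho> - {?p})" for \<rho>
    unfolding koszul_sign_altdef h_def[symmetric] by (simp add: prod.remove)
  have "prod (h (\<sigma> \<circ> ?t)) (inversions ?n (\<sigma> \<circ> ?t) - {?p}) =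
      (\<Prod>x\<in>inversions ?n (\<sigma> \<circ> ?t) - {?p}. h \<sigma> (map_prod ?t ?t x))"
    by (rule prod.cong) (auto simp: h_def)
  also have "\<dots> = prod (h \<sigma>) (inversions ?n \<sigma> - {?p})"
    by (rule prod.reindex_bij_betw[OF adjacent_swap_inversions[OF assms(2)]])
  finally have "prod (h (\<sigma> \<circ> ?t)) (inversions ?n (\<sigma> \<circ> ?t) - {?p}) =
      prod (h \<sigma>) (inversions ?n \<sigma> - {?p})" .
  moreover have "\<sigma> a \<noteq> \<sigma> (Suc a)"
    using injD[OF permutes_inj[OF assms(1)], of a "Suc a"] by auto
  then have "?p \<in> inversions ?n (\<sigma> \<circ> ?t) \<longleftrightarrow> ?p \<notin> inversions ?n \<sigma>"
    using assms(2) by (auto simp: inversions_def index_pairs_def)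
  moreover have "h (\<sigma> \<circ> ?t) ?p = h \<sigma> ?p" by (simp add: h_def mult.commute)
  moreover have "h \<sigma> ?p * h \<sigma> ?p = 1" by (simp add: h_def parity_sign_square)
  ultimately show ?thesis
    unfolding split[of "\<sigma> \<circ> ?t"] split[of \<sigma>]
    by (auto simp: h_def mult.assoc[symmetric])
qed

text \<open>The Koszul sign of reversing the word, for which every pair of positions is an
  inversion. It turns out to be the sign hidden in \<open>tensor_eval\<close>.\<close>

definition reversal_sign :: "(int \<times> 'v) list \<Rightarrow> 'k::field" where
  "reversal_sign xs = (\<Prod>(a, b)\<in>index_pairs (length xs). parity_sign (fst (xs ! a) * fst (xs ! b)))"

lemma reversal_sign_square: "reversal_sign xs * reversal_sign xs = 1"
  unfolding reversal_sign_def prod.distrib[symmetric]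
  by (rule prod.neutral) (auto simp: parity_sign_square)

lemma reversal_sign_cong:
  assumes "length xs = length ys" "\<And>a. a < length xs \<Longrightarrow> fst (xs ! a) = fst (ys ! a)"
  shows "reversal_sign xs = reversal_sign ys"
  unfolding reversal_sign_def using assms by (intro prod.cong) (auto simp: index_pairs_def)

text \<open>The factor is symmetric in its two positions, so the product runs over unordered pairs;
  an adjacent swap merely rearranges them.\<close>

lemma reversal_sign_permute:
  assumes "\<sigma> permutes {..<length xs}"
  shows "reversal_sign (permute_list \<sigma> xs) = reversal_sign xs"
  using assms
proof (induction rule: adjacent_swap_permutes_induct)
  case (swap \<sigma> a)
  let ?n = "length xs" and ?t = "adjacent_swap a" and ?p = "(a, Suc a)"
  define h where "h \<rho> = (\<lambda>(x, y). parity_sign (fst (xs ! \<rho> x) * fst (xs ! \<rho> y)) :: 'b)"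
      for \<rho> :: "nat \<Rightarrow> nat"
  have eq: "reversal_sign (permute_list \<rho> xs) = prod (h \<rho>) (index_pairs ?n)"
      if "\<rho> permutes {..<?n}" for \<rho>
    unfolding reversal_sign_def h_def
    using that by (intro prod.cong) (auto simp: index_pairs_def permute_list_nth)
  have p: "?p \<in> index_pairs ?n" using swap by (auto simp: index_pairs_def)
  have "prod (h (\<sigma> \<circ> ?t)) (index_pairs ?n - {?p}) = prod (\<lambda>x. h \<sigma> (map_prod ?t ?t x)) (index_pairs
      ?n - {?p})"
    by (rule prod.cong) (auto simp: h_def)
  also have "\<dots> = prod (h \<sigma>) (index_pairs ?n - {?p})"
    by (rule prod.reindex_bij_betw[OF adjacent_swap_pairs]) (rule swap)
  finally have "prod (h (\<sigma> \<circ> ?t)) (index_pairs ?n - {?p}) = prod (h \<sigma>) (index_pairs ?n - {?p})" .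
  moreover have "h (\<sigma> \<circ> ?t) ?p = h \<sigma> ?p" by (simp add: h_def mult.commute)
  ultimately have "prod (h (\<sigma> \<circ> ?t)) (index_pairs ?n) = prod (h \<sigma>) (index_pairs ?n)"
    by (simp add: prod.remove[OF finite_index_pairs p])
  then show ?case
    using swap eq[OF swap(1)] eq[OF permutes_compose[OF adjacent_swap_permutes[OF swap(2)] swap(1)]]
    by (simp only:)
qed (simp add: permute_list_id)

definition evaluate :: "(int \<times> ('v \<Rightarrow> 'k)) list \<Rightarrow> (int \<times> 'v) list \<Rightarrow> 'k::field" where
  "evaluate \<phi>s xs = (\<Prod>a<length xs. dual_eval (\<phi>s ! a) (xs ! a))"

lemma evaluate_Nil [simp]: "evaluate [] [] = 1"
  by (simp add: evaluate_def)

lemma evaluate_Cons [simp]: "evaluate (\<phi> # \<phi>s) (x # xs) = dual_eval \<phi> x * evaluate \<phi>s xs"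
  by (simp add: evaluate_def prod.lessThan_Suc_shift del: prod.lessThan_Suc)

lemma evaluate_nonzero_degree:
  assumes "evaluate \<phi>s xs \<noteq> 0" "a < length xs"
  shows "fst (\<phi>s ! a) = - fst (xs ! a)"
proof -
  have "dual_eval (\<phi>s ! a) (xs ! a) \<noteq> 0" using assms by (auto simp: evaluate_def)
  then show ?thesis by (auto simp: dual_eval_def split: if_splits)
qed

text \<open>If the evaluation is nonzero, each functional has the degree opposite to its argument,
  so the exponents of \<open>tensor_eval\<close> have the parity of those of
  \<open>reversal_sign\<close>. Otherwise both sides vanish. The sign thereby becomes independent of
  the functionals.\<close>

lemma tensor_eval_eq:
  fixes \<phi>s :: "(int \<times> ('v \<Rightarrow> 'k::field)) list"
  shows "tensor_eval \<phi>s xs = reversal_sign xs * evaluate \<phi>s xs"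
proof (cases "evaluate \<phi>s xs = 0")
  case False
  then have "(\<Prod>(a, b)\<in>{(a, b). a < b \<and> b < length xs}. parity_sign (fst (\<phi>s ! b) * fst (xs ! a))) =
      (reversal_sign xs :: 'k)"
    unfolding reversal_sign_def index_pairs_def
    by (intro prod.cong) (auto simp: evaluate_nonzero_degree parity_sign_def)
  then show ?thesis unfolding tensor_eval_def minus_one_powi evaluate_def by (simp only:)
qed (simp add: tensor_eval_def evaluate_def)

lemma word_pairing_eq:
  assumes "length \<phi>s = length xs"
  shows "word_pairing \<phi>s xs = reversal_sign xs *
    (\<Sum>\<sigma> | \<sigma> permutes {..<length xs}. koszul_sign \<sigma> xs * evaluate \<phi>s (permute_list \<sigma> xs))"
  using assms by (simp add: word_pairing_def tensor_eval_eq reversal_sign_permute sum_distrib_left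
      mult_ac)

lemma evaluate_swap:
  assumes "Suc a < length xs" "length \<phi>s = length xs"
  shows "evaluate \<phi>s (permute_list (adjacent_swap a) xs) =
      evaluate (permute_list (adjacent_swap a) \<phi>s) xs"
proof -
  let ?t = "adjacent_swap a"
  have t: "?t permutes {..<length xs}" using assms by (intro adjacent_swap_permutes)
  have "evaluate \<phi>s (permute_list ?t xs) = (\<Prod>b<length xs. dual_eval (\<phi>s ! b) (xs ! ?t b))"
    unfolding evaluate_def using t by (intro prod.cong) (auto simp: permute_list_nth)
  also have "\<dots> = (\<Prod>b<length xs. dual_eval (\<phi>s ! ?t b) (xs ! ?t (?t b)))"
    by (rule prod.permute[OF t, unfolded comp_def])
  also have "\<dots> = evaluate (permute_list ?t \<phi>s) xs"
    unfolding evaluate_def using t assms by (intro prod.cong) (auto simp: permute_list_nth)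
  finally show ?thesis .
qed

text \<open>Composing every permutation with the swap exchanges the two functionals and multiplies
  each Koszul sign by one factor, given by \<open>koszul_sign_swap\<close>.\<close>

lemma word_pairing_swap:
  "word_pairing (us @ \<phi> # \<psi> # vs) xs =
    parity_sign (fst \<phi> * fst \<psi>) * word_pairing (us @ \<psi> # \<phi> # vs) xs"
proof (cases "length (us @ \<phi> # \<psi> # vs) = length xs")
  case True
  let ?n = "length xs" and ?t = "adjacent_swap (length us)" and ?l = "us @ \<phi> # \<psi> # vs" and ?r =
      "us @ \<psi> # \<phi> # vs"
  have lt: "Suc (length us) < ?n" using True by auto
  have perm: "permute_list ?t ?l = ?r" by (rule permute_list_adjacent_swap) simp
  have "(\<Sum>\<sigma> | \<sigma> permutes {..<?n}. koszul_sign \<sigma> xs * evaluate ?l (permute_list \<sigma> xs)) =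
      (\<Sum>\<sigma> | \<sigma> permutes {..<?n}. koszul_sign (\<sigma> \<circ> ?t) xs * evaluate ?l (permute_list (\<sigma> \<circ> ?t) xs))"
    by (rule sum.reindex_bij_witness[where i = "\<lambda>\<sigma>. \<sigma> \<circ> ?t" and j = "\<lambda>\<sigma>. \<sigma> \<circ> ?t"])
      (simp_all add: comp_assoc permutes_compose adjacent_swap_permutes lt)
  also have "\<dots> = (\<Sum>\<sigma> | \<sigma> permutes {..<?n}. parity_sign (fst \<phi> * fst \<psi>) * (koszul_sign \<sigma> xs *
      evaluate ?r (permute_list \<sigma> xs)))"
  proof (rule sum.cong[OF refl])
    fix \<sigma> assume "\<sigma> \<in> {\<sigma>. \<sigma> permutes {..<?n}}"
    then have \<sigma>: "\<sigma> permutes {..<?n}" by simp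
    have e: "evaluate ?l (permute_list (\<sigma> \<circ> ?t) xs) = evaluate ?r (permute_list \<sigma> xs)"
      using evaluate_swap[of "length us" "permute_list \<sigma> xs" ?l] lt True perm
        permute_list_compose[OF adjacent_swap_permutes[OF lt], of \<sigma>] by simp
    show "koszul_sign (\<sigma> \<circ> ?t) xs * evaluate ?l (permute_list (\<sigma> \<circ> ?t) xs) =
      parity_sign (fst \<phi> * fst \<psi>) * (koszul_sign \<sigma> xs * evaluate ?r (permute_list \<sigma> xs))"
    \<comment> \<open>The factor is expressed by degrees of arguments and varies with \<sigma>. In
      the nonzero summands these degrees are opposite to those of the two functionals, so it becomes
      a common factor.\<close>
    proof (cases "evaluate ?r (permute_list \<sigma> xs) = 0")
      case False
      have "fst \<psi> = - fst (xs ! \<sigma> (length us))" "fst \<phi> = - fst (xs ! \<sigma> (Suc (length us)))"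
        using evaluate_nonzero_degree[OF False, of "length us"] evaluate_nonzero_degree[OF False,
            of "Suc (length us)"]
          lt \<sigma> by (simp_all add: permute_list_nth nth_append)
      then show ?thesis
        unfolding e koszul_sign_swap[OF \<sigma> lt] by (simp add: mult.commute)
    qed (simp add: e)
  qed
  finally show ?thesis
    using True by (simp add: word_pairing_eq sum_distrib_left mult_ac)
qed (simp add: word_pairing_def)

text \<open>The filler \<open>undefined\<close> makes the remaining product visibly independent of
  \<open>\<phi>\<close>, which is all that linearity in this slot requires.\<close>

lemma evaluate_append_Cons:
  assumes "length us < length xs"
  shows "evaluate (us @ \<phi> # vs) xs = dual_eval \<phi> (xs ! length us) *
    (\<Prod>a\<in>{..<length xs} - {length us}. dual_eval ((us @ undefined # vs) ! a) (xs ! a))"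
proof -
  have "(us @ \<phi> # vs) ! a = (us @ undefined # vs) ! a" if "a \<noteq> length us" for a
  proof (cases "a < length us")
    case False
    with that obtain b where "a = length us + Suc b"
      by (metis add_Suc_right less_imp_Suc_add linorder_neqE_nat)
    then show ?thesis by (simp add: nth_append)
  qed (simp add: nth_append)
  then show ?thesis
    unfolding evaluate_def using assms
    by (subst prod.remove[of _ "length us"]) (auto intro!: prod.cong)
qed

lemma word_pairing_add:
  "word_pairing (us @ (i, f + g) # vs) xs = word_pairing (us @ (i, f) # vs) xs + word_pairing (us
      @ (i, g) # vs) xs"
proof (cases "length us + Suc (length vs) = length xs")
  case True
  have "evaluate (us @ (i, f + g) # vs) ys = evaluate (us @ (i, f) # vs) ys + evaluate (us @ (i,
      g) # vs) ys"
    if "length us < length ys" for ys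
    unfolding evaluate_append_Cons[OF that] by (simp add: dual_eval_def algebra_simps)
  with True show ?thesis by (simp add: word_pairing_eq distrib_left sum.distrib)
qed (simp add: word_pairing_def)

lemma word_pairing_scale:
  "word_pairing (us @ (i, fun_scale c f) # vs) xs = c * word_pairing (us @ (i, f) # vs) xs"
proof (cases "length us + Suc (length vs) = length xs")
  case True
  have "evaluate (us @ (i, fun_scale c f) # vs) ys = c * evaluate (us @ (i, f) # vs) ys"
    if "length us < length ys" for ys
    unfolding evaluate_append_Cons[OF that] by (simp add: dual_eval_def fun_scale_def)
  with True show ?thesis by (simp add: word_pairing_eq sum_distrib_left mult_ac)
qed (simp add: word_pairing_def)

lemma pairing_add: "pairing (p + q) xs = pairing p xs + pairing q xs"
  unfolding pairing_def by (rule sum_keys_add) (simp_all add: algebra_simps)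

lemma pairing_0 [simp]: "pairing 0 xs = 0"
  by (simp add: pairing_def)

lemma pairing_const_monomial: "pairing (const c * monomial us) xs = c * word_pairing us xs"
proof -
  have "pairing (Poly_Mapping.single (Word us) c) xs = c * word_pairing us xs"
    unfolding pairing_def by (subst sum_keys_single) auto
  then show ?thesis by (simp add: single_eq_monomial)
qed

lemma pairing_const_mult: "pairing (const c * p) xs = c * pairing p xs"
proof (induction p rule: free_alg_induct)
  case (monomial us d)
  have "pairing (const (c * d) * monomial us) xs = c * d * word_pairing us xs"
    by (rule pairing_const_monomial)
  then show ?case by (simp add: const_mult mult.assoc pairing_const_monomial)
qed (simp_all add: distrib_left pairing_add)

lemma pairing_monomial: "pairing (monomial us) xs = word_pairing us xs"
  using pairing_const_monomial[of 1] by simp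

lemma pairing_uminus: "pairing (- p) xs = - pairing p xs"
  using pairing_const_mult[of "-1" p xs] by (simp add: const_uminus)

lemma pairing_diff: "pairing (p - q) xs = pairing p xs - pairing q xs"
  using pairing_add[of p "- q" xs] by (simp add: pairing_uminus)

lemma pairing_sum: "pairing (sum f S) xs = (\<Sum>x\<in>S. pairing (f x) xs)"
  by (induction S rule: infinite_finite_induct) (simp_all add: pairing_add)

context graded_vector_space
begin

lemma monomial_swap_in_ideal:
  assumes "us @ x # y # vs \<in> lists (homog V)"
  shows "monomial (us @ x # y # vs) - const (parity_sign (fst x * fst y)) * monomial (us @ y # x #
      vs) \<in> I"
proof -
  obtain i u j v where xy: "x = (i, u)" "y = (j, v)" by fastforce
  have mem: "u \<in> V i" "v \<in> V j" "us \<in> lists (homog V)" "vs \<in> lists (homog V)"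
    using assms xy by auto
  let ?r = "letter x * letter y - parity_sign (i * j) * (letter y * letter x)"
  have "letter (i, u) * letter (j, v) - const ((- 1) powi (i * j)) * letter (j, v) * letter (i, u)
      \<in> sym_relations scale V"
    unfolding sym_relations_def using mem by blast
  then have "?r \<in> I"
    using sym_relations_in_ideal by (auto simp: xy minus_one_powi const_parity_sign mult.assoc)
  then have "monomial us * ?r * monomial vs \<in> I"
    using mem by (intro ideal_mult_right ideal_mult_left) auto
  also have "monomial us * ?r * monomial vs =
      monomial (us @ x # y # vs) - const (parity_sign (fst x * fst y)) * monomial (us @ y # x # vs)"
    by (auto simp: xy monomial_append monomial_Cons const_parity_sign parity_sign_def
        algebra_simps const_uminus)
  finally show ?thesis .
qed

text \<open>The relations reproduce the Koszul sign exactly: each adjacent swap contributes the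
  factor from \<open>koszul_sign_swap\<close>.\<close>

lemma monomial_permute_in_ideal:
  assumes "xs \<in> lists (homog V)" "\<sigma> permutes {..<length xs}"
  shows "monomial xs - const (koszul_sign \<sigma> xs) * monomial (permute_list \<sigma> xs) \<in> I"
  using assms(2)
proof (induction rule: adjacent_swap_permutes_induct)
  case (swap \<sigma> a)
  let ?ys = "permute_list \<sigma> xs" and ?t = "adjacent_swap a"
  let ?s = "parity_sign (fst (xs ! \<sigma> a) * fst (xs ! \<sigma> (Suc a))) :: 'k"
  have "Suc a < length ?ys" using swap by simp
  then obtain us x y vs where ys: "?ys = us @ x # y # vs" "length us = a" "x = ?ys ! a" "y =
      ?ys ! Suc a"
    by (rule split_at_adjacent)
  have "set ?ys = set xs" using swap by (intro set_permute_list)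
  then have mem: "us @ x # y # vs \<in> lists (homog V)" using assms(1) by (auto simp: ys(1)[symmetric])
  have s: "?s = parity_sign (fst x * fst y)"
    unfolding ys(3,4) using swap(1,2) by (simp add: permute_list_nth)
  have perm: "permute_list (\<sigma> \<circ> ?t) xs = us @ y # x # vs"
    using permute_list_compose[OF adjacent_swap_permutes[OF swap(2)], of \<sigma>]
      permute_list_adjacent_swap[of us x y vs] ys(1,2) by simp
  have "monomial ?ys - const ?s * monomial (permute_list (\<sigma> \<circ> ?t) xs) \<in> I"
    unfolding perm s ys(1) by (rule monomial_swap_in_ideal[OF mem])
  then have "const (koszul_sign \<sigma> xs) * (monomial ?ys - const ?s * monomial (permute_list (\<sigma> \<circ> ?t)
      xs)) \<in> I"
    by (rule ideal_mult_left[rotated]) simp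
  \<comment> \<open>The two differences telescope, the monomial of the partly permuted word
    cancelling.\<close>
  from ideal_add[OF swap(3) this]
  have "monomial xs - const (koszul_sign \<sigma> xs * ?s) * monomial (permute_list (\<sigma> \<circ> ?t) xs) \<in> I"
    by (simp only: const_mult right_diff_distrib mult.assoc diff_add_eq_diff_diff_swap add_diff_eq
        diff_add_cancel)
  then show ?case
    unfolding koszul_sign_swap[OF swap(1,2)] by (simp only: mult.commute)
next
  case id
  show ?case unfolding koszul_sign_id permute_list_id by simp
qed

end

section \<open>The identification of words with symmetric functionals\<close>

lemma vector_space_fun_scale: "vector_space (fun_scale :: 'k::field \<Rightarrow> ('v \<Rightarrow> 'k) \<Rightarrow> 'v \<Rightarrow> 'k)"
  by standard (auto simp: fun_scale_def fun_eq_iff algebra_simps)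

lemma total_degree_permute:
  "\<sigma> permutes {..<length xs} \<Longrightarrow> total_degree (permute_list \<sigma> xs) = total_degree xs"
  unfolding total_degree_def sum_mset_sum_list[symmetric] mset_map
  by (simp add: mset_permute_list)

context graded_vector_space
begin

lemma letter_add_in_ideal:
  assumes "u \<in> V i" "v \<in> V i"
  shows "letter (i, u + v) - letter (i, u) - letter (i, v) \<in> I"
  by (rule subsetD[OF sym_relations_in_ideal]) (use assms in \<open>unfold sym_relations_def, blast\<close>)

lemma letter_scale_in_ideal:
  assumes "u \<in> V i"
  shows "letter (i, scale c u) - const c * letter (i, u) \<in> I"
  by (rule subsetD[OF sym_relations_in_ideal]) (use assms in \<open>unfold sym_relations_def, blast\<close>)

lemma letter_zero_in_ideal: "letter (i, 0) \<in> I"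
  using letter_scale_in_ideal[of 0 i 0] by simp

lemma letter_sum_in_ideal:
  assumes "\<And>x. x \<in> X \<Longrightarrow> v x \<in> V i"
  shows "letter (i, \<Sum>x\<in>X. scale (c x) (v x)) - (\<Sum>x\<in>X. const (c x) * letter (i, v x)) \<in> I"
  using assms
proof (induction X rule: infinite_finite_induct)
  case (insert x X)
  have "(\<Sum>x\<in>X. scale (c x) (v x)) \<in> V i"
    using insert.prems component_subspace[of i] by (intro subspace_sum subspace_scale) auto
  with insert have "letter (i, scale (c x) (v x) + (\<Sum>x\<in>X. scale (c x) (v x))) - letter (i, scale
      (c x) (v x))
      - letter (i, \<Sum>x\<in>X. scale (c x) (v x)) \<in> I"
    by (intro letter_add_in_ideal) auto
  moreover have "letter (i, scale (c x) (v x)) - const (c x) * letter (i, v x) \<in> I"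
    using insert by (intro letter_scale_in_ideal) auto
  moreover have "letter (i, \<Sum>x\<in>X. scale (c x) (v x)) - (\<Sum>x\<in>X. const (c x) * letter (i, v x)) \<in> I"
    using insert by auto
  ultimately have "(letter (i, scale (c x) (v x) + (\<Sum>x\<in>X. scale (c x) (v x))) - letter (i, scale
      (c x) (v x))
      - letter (i, \<Sum>x\<in>X. scale (c x) (v x))) + (letter (i, scale (c x) (v x)) - const (c x) *
          letter (i, v x))
      + (letter (i, \<Sum>x\<in>X. scale (c x) (v x)) - (\<Sum>x\<in>X. const (c x) * letter (i, v x))) \<in> I"
    by (intro ideal_add)
  with insert show ?case by (simp add: algebra_simps)
qed (simp_all add: letter_zero_in_ideal)

definition power_words :: "nat \<Rightarrow> int \<Rightarrow> ('w, 'k) free_alg set" where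
  "power_words n d = {p \<in> words. \<forall>w \<in> Poly_Mapping.keys p. length (letters w) =
      n \<and> total_degree (letters w) = d}"

lemma sym_power_degree_eq: "sym_power_degree scale V n d = cls ` power_words n d"
  by (simp add: sym_power_degree_def power_words_def)

lemma power_words_subset: "power_words n d \<subseteq> homog_words d"
  by (auto simp: power_words_def homog_words_def)

lemma power_words_0 [simp]: "0 \<in> power_words n d"
  by (simp add: power_words_def)

lemma power_words_diff: "p \<in> power_words n d \<Longrightarrow> q \<in> power_words n d \<Longrightarrow> p - q \<in> power_words n d"
  using keys_diff[of p q] by (auto simp: power_words_def)

lemma power_words_add: "p \<in> power_words n d \<Longrightarrow> q \<in> power_words n d \<Longrightarrow> p + q \<in> power_words n d"
  using Poly_Mapping.keys_add[of p q] by (auto simp: power_words_def)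

lemma power_words_sum: "(\<And>x. x \<in> X \<Longrightarrow> f x \<in> power_words n d) \<Longrightarrow> sum f X \<in> power_words n d"
  by (induction X rule: infinite_finite_induct) (auto intro: power_words_add)

lemma power_words_const_monomial:
  assumes "xs \<in> lists (homog V)" "c \<noteq> 0 \<Longrightarrow> length xs = n \<and> total_degree xs = d"
  shows "const c * monomial xs \<in> power_words n d"
proof -
  have "const c * monomial xs = Poly_Mapping.single (Word xs) c"
    by (simp add: single_eq_monomial)
  then show ?thesis
    using assms by (auto simp: power_words_def words_def)
qed

lemma power_words_induct [consumes 1, case_names zero monomial add]:
  assumes "p \<in> power_words n d" "Q 0"
    and "\<And>xs c. xs \<in> lists (homog V) \<Longrightarrow> length xs = n \<Longrightarrow> Q (const c * monomial xs)"
    and "\<And>a b. Q a \<Longrightarrow> Q b \<Longrightarrow> Q (a + b)"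
  shows "Q p"
proof -
  have "Poly_Mapping.keys p \<subseteq> {Word xs | xs. xs \<in> lists (homog V) \<and> length xs = n}"
    using assms(1) by (force simp: power_words_def words_def)
  then show ?thesis
    by (rule keys_span_induct) (use assms in \<open>auto simp: single_eq_monomial simp flip:
        in_lists_conv_set\<close>)
qed

end

section \<open>The pairing on the symmetric algebra of the dual\<close>

locale dual_graded_space = base: vector_space scale
  for scale :: "'k::field \<Rightarrow> 'v::ab_group_add \<Rightarrow> 'v" +
  fixes F :: "int \<Rightarrow> 'v set"
  assumes base_subspace: "base.subspace (F i)"
begin

lemma base_closed [simp]:
  "u \<in> F i \<Longrightarrow> v \<in> F i \<Longrightarrow> u + v \<in> F i" "u \<in> F i \<Longrightarrow> scale c u \<in> F i" "0 \<in> F i"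
  using base_subspace[of i] by (auto simp: base.subspace_def)

lemma dual_subspace: "module.subspace fun_scale (graded_dual scale F i)"
proof -
  interpret vector_space "fun_scale :: 'k \<Rightarrow> ('v \<Rightarrow> 'k) \<Rightarrow> 'v \<Rightarrow> 'k" by (rule vector_space_fun_scale)
  show ?thesis
    unfolding subspace_def by (auto simp: graded_dual_def fun_scale_def algebra_simps)
qed

sublocale graded_vector_space fun_scale "graded_dual scale F"
  using vector_space_fun_scale dual_subspace by (intro graded_vector_space.intro
      graded_vector_space_axioms.intro)

text \<open>This makes the pairing well defined on classes. The three families of relations
  correspond to \<open>word_pairing_add\<close>, \<open>word_pairing_scale\<close> and
  \<open>word_pairing_swap\<close>.\<close>

lemma pairing_ideal:
  assumes "p \<in> I"
  shows "pairing p xs = 0"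
  using assms
proof (induction rule: sym_ideal_induct)
  case (relation c us r vs)
  have mono: "pairing (monomial us * letter x * monomial vs) xs = word_pairing (us @ x # vs) xs"
      for x
    by (simp add: monomial_append monomial_Cons mult.assoc flip: pairing_monomial)
  have const: "pairing (monomial us * (const c * q) * monomial vs) xs =
      c * pairing (monomial us * q * monomial vs) xs" for c q
    using const_left_commute[of "monomial us" c "q * monomial vs"]
    by (simp add: mult.assoc pairing_const_mult)
  from relation(3) have "pairing (monomial us * r * monomial vs) xs = 0"
  proof (cases rule: sym_relations_cases)
    case (add i f g)
    then show ?thesis by (simp add: left_diff_distrib right_diff_distrib pairing_diff mono
        word_pairing_add)
  next
    case (scale i c f)
    then show ?thesis by (simp add: left_diff_distrib right_diff_distrib pairing_diff mono const
        word_pairing_scale)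
  next
    case (commute i j f g)
    have mono2: "pairing (monomial us * (letter x * letter y) * monomial vs) xs =
        word_pairing (us @ x # y # vs) xs" for x y
      by (simp add: monomial_append monomial_Cons mult.assoc flip: pairing_monomial)
    show ?thesis
      unfolding commute(3) const_parity_sign[symmetric] left_diff_distrib right_diff_distrib
          pairing_diff const mono2
      by (simp add: word_pairing_swap[of us "(i, f)" "(j, g)"])
  qed
  then show ?case by (simp add: pairing_const_mult)
qed (simp_all add: pairing_add)

end

text \<open>Duality of the bases is encoded by \<open>basis_expand\<close> alone. It expands
  vectors, hence multilinear functionals, and after applying a functional to it also the elements of
  the dual (\<open>dual_expand\<close>).\<close>

locale based_dual_space = dual_graded_space scale F
  for scale :: "'k::field \<Rightarrow> 'v::ab_group_add \<Rightarrow> 'v" and F +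
  fixes basis :: "(int \<times> 'v) set" and dual_basis :: "int \<times> 'v \<Rightarrow> int \<times> ('v \<Rightarrow> 'k)"
  assumes finite_basis: "finite basis" and basis_homog: "basis \<subseteq> homog F"
    and dual_basis_homog: "x \<in> basis \<Longrightarrow> dual_basis x \<in> homog (graded_dual scale F)"
    and dual_basis_degree: "fst (dual_basis x) = - fst x"
    and basis_expand: "v \<in> F j \<Longrightarrow> (\<Sum>x | x \<in> basis \<and> fst x =
        j. scale (snd (dual_basis x) v) (snd x)) = v"
begin

definition basis_words :: "nat \<Rightarrow> (int \<times> 'v) list set" where
  "basis_words n = {b. set b \<subseteq> basis \<and> length b = n}"

lemma finite_basis_words [simp]: "finite (basis_words n)"
  unfolding basis_words_def by (rule finite_lists_length_eq[OF finite_basis])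

lemma basis_words_0: "basis_words 0 = {[]}"
  by (auto simp: basis_words_def)

lemma sum_basis_words_Suc: "(\<Sum>b\<in>basis_words (Suc n). f b) = (\<Sum>x\<in>basis. \<Sum>b\<in>basis_words n. f (x # b))"
  unfolding sum.cartesian_product
  by (rule sum.reindex_bij_witness[where i = "\<lambda>(x, b). x # b" and j = "\<lambda>b. (hd b, tl b)"])
    (auto simp: basis_words_def length_Suc_conv)

lemma basis_words_homog: "b \<in> basis_words n \<Longrightarrow> b \<in> lists (homog F)"
  using basis_homog by (auto simp: basis_words_def)

lemma basis_words_dual_homog:
  assumes "b \<in> basis_words n"
  shows "map dual_basis b \<in> lists (homog (graded_dual scale F))"
proof -
  have "\<forall>x\<in>set b. dual_basis x \<in> homog (graded_dual scale F)"
    using assms dual_basis_homog unfolding basis_words_def by blast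
  then show ?thesis unfolding in_lists_conv_set set_map by blast
qed

lemma dual_linear_sum:
  assumes "f \<in> graded_dual scale F i" "\<And>x. x \<in> X \<Longrightarrow> v x \<in> F (- i)"
  shows "f (\<Sum>x\<in>X. scale (c x) (v x)) = (\<Sum>x\<in>X. c x * f (v x))"
  using assms(2)
proof (induction X rule: infinite_finite_induct)
  case (insert x X)
  have "(\<Sum>x\<in>X. scale (c x) (v x)) \<in> F (- i)"
    using insert.prems base_subspace[of "- i"] by (intro base.subspace_sum base.subspace_scale) auto
  with insert assms(1) show ?case by (simp add: graded_dual_def)
next
  case (infinite X)
  then show ?case using assms(1) base_closed(3)[of "- i"]
      by (simp add: graded_dual_def) (metis base.scale_zero_left mult_zero_left)
next
  case empty
  then show ?case using assms(1) base_closed(3)[of "- i"]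
      by (simp add: graded_dual_def) (metis base.scale_zero_left mult_zero_left)
qed

lemma dual_expand:
  assumes f: "f \<in> graded_dual scale F i"
  shows "f = (\<Sum>x | x \<in> basis \<and> fst x = - i. fun_scale (f (snd x)) (snd (dual_basis x)))"
proof
  fix v
  have mem: "snd x \<in> F (- i)" "snd (dual_basis x) \<in> graded_dual scale F i" if "x \<in> basis" "fst x =
      - i" for x
    using basis_homog dual_basis_homog[of x] dual_basis_degree[of x] that by (auto simp: homog_def)
  have sum: "(\<Sum>x\<in>X. g x) v = (\<Sum>x\<in>X. g x v)" for X and g :: "int \<times> 'v \<Rightarrow> 'v \<Rightarrow> 'k"
    by (induction X rule: infinite_finite_induct) auto
  show "f v = (\<Sum>x | x \<in> basis \<and> fst x = - i. fun_scale (f (snd x)) (snd (dual_basis x))) v"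
  proof (cases "v \<in> F (- i)")
    case True
    have "f v = f (\<Sum>x | x \<in> basis \<and> fst x = - i. scale (snd (dual_basis x) v) (snd x))"
      using basis_expand[OF True] by simp
    also have "\<dots> = (\<Sum>x | x \<in> basis \<and> fst x = - i. snd (dual_basis x) v * f (snd x))"
      by (rule dual_linear_sum[OF f]) (use mem in auto)
    finally show ?thesis by (simp add: sum fun_scale_def mult.commute)
  next
    case False
    then have "f v = 0" using f by (simp add: graded_dual_def)
    moreover have "snd (dual_basis x) v = 0" if "x \<in> basis" "fst x = - i" for x
      using mem(2)[OF that] False by (simp add: graded_dual_def)
    ultimately show ?thesis by (simp add: sum fun_scale_def)
  qed
qed

lemma letter_expand:
  assumes "\<phi> \<in> homog (graded_dual scale F)"
  shows "letter \<phi> - (\<Sum>x\<in>basis. const (dual_eval \<phi> x) * letter (dual_basis x)) \<in> I"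
proof -
  obtain i f where \<phi>: "\<phi> = (i, f)" "f \<in> graded_dual scale F i" using assms by (cases \<phi>) auto
  let ?B = "{x \<in> basis. fst x = - i}"
  have mem: "snd (dual_basis x) \<in> graded_dual scale F i" if "x \<in> ?B" for x
    using dual_basis_homog[of x] dual_basis_degree[of x] that by (auto simp: homog_def)
  \<comment> \<open>Summation over the whole basis is harmless, as \<open>dual_eval\<close> vanishes
    on basis vectors of the wrong degree.\<close>
  have "(\<Sum>x\<in>basis. const (dual_eval \<phi> x) * letter (dual_basis x)) =
      (\<Sum>x\<in>?B. const (f (snd x)) * letter (i, snd (dual_basis x)))"
    using finite_basis dual_basis_degree
    by (intro sum.mono_neutral_cong_right) (auto simp: dual_eval_def \<phi>(1) prod_eq_iff intro!:
        arg_cong2[where f = "(*)"] arg_cong[where f = letter])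
  then show ?thesis
    using letter_sum_in_ideal[of ?B "\<lambda>x. snd (dual_basis x)" i "\<lambda>x. f (snd x)"] mem dual_expand[OF
        \<phi>(2)] by (simp add: \<phi>(1))
qed

lemma monomial_expand:
  assumes "us \<in> lists (homog (graded_dual scale F))"
  shows "monomial us - (\<Sum>b\<in>basis_words (length us). const (evaluate us b) * monomial (map
      dual_basis b)) \<in> I"
  using assms
proof (induction us)
  case Nil
  then show ?case by (simp add: basis_words_0 monomial_Nil)
next
  case (Cons u us)
  let ?L = "\<Sum>x\<in>basis. const (dual_eval u x) * letter (dual_basis x)"
  let ?M = "\<Sum>b\<in>basis_words (length us). const (evaluate us b) * monomial (map dual_basis b)"
  have "?L * ?M = (\<Sum>b\<in>basis_words (length (u # us)). const (evaluate (u # us) b) * monomial (map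
      dual_basis b))"
    unfolding length_Cons sum_basis_words_Suc sum_product
  proof (intro sum.cong refl)
    fix x b
    have "const (dual_eval u x) * letter (dual_basis x) * (const (evaluate us b) * monomial (map
        dual_basis b)) =
        const (dual_eval u x) * (letter (dual_basis x) * (const (evaluate us b) * monomial (map
            dual_basis b)))"
      by (rule mult.assoc)
    also have "\<dots> = const (dual_eval u x) * (const (evaluate us b) * (letter (dual_basis x) *
        monomial (map dual_basis b)))"
      by (simp only: const_left_commute[of "letter (dual_basis x)"])
    finally show "const (dual_eval u x) * letter (dual_basis x) * (const (evaluate us b) *
        monomial (map dual_basis b)) =
        const (evaluate (u # us) (x # b)) * monomial (map dual_basis (x # b))"
      by (simp add: const_mult monomial_Cons mult.assoc)
  qed
  \<comment> \<open>A difference of products is split as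
    \<open>(letter u - ?L) * monomial us + ?L * (monomial us - ?M)\<close>.\<close>
  moreover have "(letter u - ?L) * monomial us \<in> I"
    using Cons by (intro ideal_mult_right letter_expand) auto
  moreover have "?L * (monomial us - ?M) \<in> I"
    using Cons dual_basis_homog by (intro ideal_mult_left words_sum words_mult) auto
  ultimately show ?case
    using ideal_add[of "(letter u - ?L) * monomial us" "?L * (monomial us - ?M)"]
    by (simp add: monomial_Cons left_diff_distrib right_diff_distrib)
qed

lemma ideal_const_cancel:
  fixes p :: "('v \<Rightarrow> 'k, 'k) free_alg"
  assumes "const (c :: 'k) * p \<in> I" "c \<noteq> 0"
  shows "p \<in> I"
proof -
  have "const (inverse c) * (const c * p) \<in> I" by (rule ideal_mult_left) (use assms in auto)
  then show ?thesis using assms(2) by (simp add: mult.assoc[symmetric] const_mult[symmetric])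
qed

text \<open>Every permutation yields an expansion of the same word in dual basis words, obtained by
  reordering the basis words at the price of a Koszul sign. Adding all of them collects the
  coefficients into \<open>word_pairing\<close>. Keeping the factor n! on the left makes this valid
  in any characteristic.\<close>

lemma monomial_pairing_expand:
  assumes "us \<in> lists (homog (graded_dual scale F))" "length us = n"
  shows "const (of_nat (fact n)) * monomial us -
    (\<Sum>b\<in>basis_words n. const (reversal_sign b * word_pairing us b) * monomial (map dual_basis b))
        \<in> I"
proof -
  let ?S = "{\<sigma>. \<sigma> permutes {..<n}}"
  have fin: "finite ?S" "card ?S = fact n" by (simp_all add: finite_permutations card_permutations)
  have "(\<Sum>b\<in>basis_words n. const (reversal_sign b * word_pairing us b) * monomial (map dual_basis
      b)) =
      (\<Sum>b\<in>basis_words n. \<Sum>\<sigma>\<in>?S. const (koszul_sign \<sigma> b * evaluate us (permute_list \<sigma> b)) *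
          monomial (map dual_basis b))"
  proof (rule sum.cong[OF refl])
    fix b assume "b \<in> basis_words n"
    then have len: "length b = n" by (simp add: basis_words_def)
    have "reversal_sign b * word_pairing us b =
        (\<Sum>\<sigma>\<in>?S. koszul_sign \<sigma> b * evaluate us (permute_list \<sigma> b))"
      using assms(2) len
      by (simp add: word_pairing_eq mult.assoc[symmetric] reversal_sign_square)
    then show "const (reversal_sign b * word_pairing us b) * monomial (map dual_basis b) =
      (\<Sum>\<sigma>\<in>?S. const (koszul_sign \<sigma> b * evaluate us (permute_list \<sigma> b)) * monomial (map dual_basis
          b))"
      by (simp add: const_sum sum_distrib_right)
  qed
  also have "\<dots> = (\<Sum>\<sigma>\<in>?S. \<Sum>b\<in>basis_words n. const (koszul_sign \<sigma> b * evaluate us (permute_list \<sigma>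
      b)) * monomial (map dual_basis b))"
    by (rule sum.swap)
  finally have eq: "const (of_nat (fact n)) * monomial us -
      (\<Sum>b\<in>basis_words n. const (reversal_sign b * word_pairing us b) * monomial (map dual_basis
          b)) =
    (\<Sum>\<sigma>\<in>?S. monomial us - (\<Sum>b\<in>basis_words n. const (koszul_sign \<sigma> b * evaluate us (permute_list \<sigma>
        b)) * monomial (map dual_basis b)))"
    using fin by (simp add: sum_subtractf const_def)
  also have "\<dots> \<in> I"
  proof (rule ideal_sum)
    fix \<sigma> assume "\<sigma> \<in> ?S"
    then have \<sigma>: "\<sigma> permutes {..<n}" by simp
    let ?c = "\<lambda>b. const (koszul_sign \<sigma> b * evaluate us (permute_list \<sigma> b)) * monomial (map
        dual_basis b)"
    let ?e = "\<lambda>b. const (evaluate us b) * monomial (map dual_basis b)"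
    \<comment> \<open>For fixed \<sigma> the sum in \<open>monomial_expand\<close> is reindexed by
      permuting the basis words.\<close>
    have bij: "bij_betw (permute_list \<sigma>) (basis_words n) (basis_words n)"
    proof (rule bij_betw_byWitness[where f' = "permute_list (inv_into UNIV \<sigma>)"])
      have inv: "inv_into UNIV \<sigma> permutes {..<n}" by (rule permutes_inv[OF \<sigma>])
      show "\<forall>b\<in>basis_words n. permute_list (inv_into UNIV \<sigma>) (permute_list \<sigma> b) = b"
        using inv by (auto simp: basis_words_def permute_list_id permutes_inv_o[OF \<sigma>] simp flip:
            permute_list_compose)
      show "\<forall>b\<in>basis_words n. permute_list \<sigma> (permute_list (inv_into UNIV \<sigma>) b) = b"
        using \<sigma> by (auto simp: basis_words_def permute_list_id permutes_inv_o[OF \<sigma>] simp flip: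
            permute_list_compose)
      show "permute_list \<sigma> ` basis_words n \<subseteq> basis_words n" "permute_list (inv_into UNIV \<sigma>) `
          basis_words n \<subseteq> basis_words n"
        using \<sigma> inv by (auto simp: basis_words_def set_permute_list)
    qed
    \<comment> \<open>Both terms have the same evaluation and differ by the order of the letters.
      Reordering costs a Koszul sign, and its square is 1.\<close>
    have "?e (permute_list \<sigma> b) - ?c b \<in> I" if b: "b \<in> basis_words n" for b
    proof -
      let ?k = "koszul_sign \<sigma> b :: 'k"
      have \<sigma>': "\<sigma> permutes {..<length b}" using \<sigma> b by (simp add: basis_words_def)
      have "koszul_sign \<sigma> (map dual_basis b) = ?k"
        by (rule koszul_sign_map[OF \<sigma>']) (simp add: dual_basis_degree)
      then have "monomial (map dual_basis b) - const ?k * monomial (permute_list \<sigma> (map dual_basis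
          b)) \<in> I"
        using monomial_permute_in_ideal[OF basis_words_dual_homog[OF b], of \<sigma>] \<sigma>' by simp
      then have "- const (?k * evaluate us (permute_list \<sigma> b)) *
          (monomial (map dual_basis b) - const ?k * monomial (permute_list \<sigma> (map dual_basis b)))
              \<in> I"
        by (rule ideal_mult_left[rotated]) simp
      moreover have "const (?k * evaluate us (permute_list \<sigma> b)) * (const ?k * monomial
          (permute_list \<sigma> (map dual_basis b))) =
          const (?k * ?k * evaluate us (permute_list \<sigma> b)) * monomial (permute_list \<sigma> (map
              dual_basis b))"
        unfolding mult.assoc[symmetric] const_mult[symmetric] by (simp only: mult_ac)
      ultimately show ?thesis
        using \<sigma>' by (simp add: right_diff_distrib koszul_sign_square permute_list_map)
    qed
    then have "(\<Sum>b\<in>basis_words n. ?e (permute_list \<sigma> b) - ?c b) \<in> I" by (rule ideal_sum)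
    then have "(\<Sum>b\<in>basis_words n. ?e b) - (\<Sum>b\<in>basis_words n. ?c b) \<in> I"
      unfolding sum_subtractf sum.reindex_bij_betw[OF bij, of ?e] .
    from ideal_add[OF monomial_expand[OF assms(1)] this[folded assms(2)]]
    show "monomial us - (\<Sum>b\<in>basis_words n. ?c b) \<in> I" by (simp add: assms(2))
  qed
  finally show ?thesis .
qed

end

text \<open>Averaging over the permutations turns the pairing into an explicit inverse of the
  identification of words with functionals, in characteristic zero only.\<close>

locale based_dual_space_char_0 = based_dual_space scale F basis dual_basis
  for scale :: "'k::field_char_0 \<Rightarrow> 'v::ab_group_add \<Rightarrow> 'v" and F basis dual_basis
begin

text \<open>By linearity from \<open>monomial_pairing_expand\<close>, n! times \<open>p\<close> is
  congruent to a combination of dual words whose coefficients are pairings of \<open>p\<close>.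
  These vanish, and n! can be cancelled.\<close>

lemma pairing_injective:
  assumes p: "p \<in> power_words n d"
    and zero: "\<And>xs. xs \<in> lists (homog F) \<Longrightarrow> length xs = n \<Longrightarrow> pairing p xs = 0"
  shows "p \<in> I"
proof -
  from p have "const (of_nat (fact n)) * p -
      (\<Sum>b\<in>basis_words n. const (reversal_sign b * pairing p b) * monomial (map dual_basis b)) \<in> I"
  proof (induction rule: power_words_induct)
    case (monomial us c)
    have "const c * (const (of_nat (fact n)) * monomial us -
        (\<Sum>b\<in>basis_words n. const (reversal_sign b * word_pairing us b) * monomial (map dual_basis
            b))) \<in> I"
      using monomial by (intro ideal_mult_left monomial_pairing_expand) auto
    moreover have "const c * (\<Sum>b\<in>basis_words n. const (reversal_sign b * word_pairing us b) *
        monomial (map dual_basis b)) =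
        (\<Sum>b\<in>basis_words n. const (reversal_sign b * pairing (const c * monomial us) b) * monomial
            (map dual_basis b))"
      unfolding sum_distrib_left pairing_const_monomial
      by (intro sum.cong refl) (simp only: const_mult mult.assoc[symmetric], simp only:
          const_mult[symmetric] mult_ac)
    moreover have "const c * (const (of_nat (fact n)) * monomial us) =
        const (of_nat (fact n)) * (const c * monomial us)"
      by (rule const_left_commute)
    ultimately show ?case by (simp only: right_diff_distrib)
  next
    case (add a b)
    from ideal_add[OF this] show ?case
      by (simp add: pairing_add distrib_left distrib_right const_add sum.distrib algebra_simps)
  qed simp
  moreover have "(\<Sum>b\<in>basis_words n. const (reversal_sign b * pairing p b) * monomial (map
      dual_basis b)) = 0"
    using zero basis_words_homog by (intro sum.neutral) (auto simp: basis_words_def)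
  ultimately have "const (of_nat (fact n) :: 'k) * p \<in> I" by simp
  then show ?thesis by (rule ideal_const_cancel) simp
qed

section \<open>Realising symmetric multilinear functionals by words\<close>

definition multilinear :: "nat \<Rightarrow> ((int \<times> 'v) list \<Rightarrow> 'k) \<Rightarrow> bool" where
  "multilinear n \<omega> \<longleftrightarrow> (\<forall>us\<in>lists (homog F). \<forall>vs\<in>lists (homog F). \<forall>i. length us + Suc (length vs) =
      n \<longrightarrow>
    (\<forall>u\<in>F i. \<forall>v\<in>F i. \<omega> (us @ (i, u + v) # vs) = \<omega> (us @ (i, u) # vs) + \<omega> (us @ (i, v) # vs)) \<and>
    (\<forall>c. \<forall>u\<in>F i. \<omega> (us @ (i, scale c u) # vs) = c * \<omega> (us @ (i, u) # vs)))"

lemma multilinear_expand_slot: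
  assumes \<omega>: "multilinear n \<omega>" and mem: "us \<in> lists (homog F)" "vs \<in> lists (homog F)" "y \<in> homog F"
    and len: "length us + Suc (length vs) = n"
  shows "\<omega> (us @ y # vs) = (\<Sum>x\<in>basis. dual_eval (dual_basis x) y * \<omega> (us @ x # vs))"
proof -
  obtain j v where y: "y = (j, v)" "v \<in> F j" using mem(3) by (cases y) (auto simp: homog_def)
  let ?f = "\<lambda>v. \<omega> (us @ (j, v) # vs)"
  have add: "?f (u + v) = ?f u + ?f v" and scale: "?f (scale c u) = c * ?f u"
      if "u \<in> F j" "v \<in> F j" for u v c
    using \<omega> mem(1,2) len that unfolding multilinear_def by blast+
  have zero: "?f 0 = 0" using scale[of 0 0 0] by simp
  have sum: "?f (\<Sum>x\<in>X. scale (c x) (snd x)) = (\<Sum>x\<in>X. c x * ?f (snd x))" if "\<And>x. x \<in> X \<Longrightarrow>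
      snd x \<in> F j" for X c
    using that
  proof (induction X rule: infinite_finite_induct)
    case (insert x X)
    have "(\<Sum>x\<in>X. scale (c x) (snd x)) \<in> F j"
      using insert.prems base_subspace[of j] by (intro base.subspace_sum base.subspace_scale) auto
    with insert show ?case by (simp add: add scale)
  qed (simp_all add: zero)
  have "\<omega> (us @ y # vs) = ?f (\<Sum>x | x \<in> basis \<and> fst x = j. scale (snd (dual_basis x) v) (snd x))"
    using basis_expand[OF y(2)] y(1) by simp
  also have "\<dots> = (\<Sum>x | x \<in> basis \<and> fst x = j. snd (dual_basis x) v * ?f (snd x))"
    by (rule sum) (use basis_homog in \<open>auto simp: homog_def\<close>)
  also have "\<dots> = (\<Sum>x\<in>basis. dual_eval (dual_basis x) y * \<omega> (us @ x # vs))"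
    using finite_basis dual_basis_degree
    by (intro sum.mono_neutral_cong_left) (auto simp: dual_eval_def y(1))
  finally show ?thesis .
qed

text \<open>The prefix \<open>us\<close> holds the slots already expanded; generalising over it lets
  the induction replace the remaining arguments by basis vectors one after another.\<close>

lemma multilinear_expand:
  assumes \<omega>: "multilinear n \<omega>" and "us \<in> lists (homog F)" "ys \<in> lists (homog F)"
    and "length us + length ys = n"
  shows "\<omega> (us @ ys) = (\<Sum>b\<in>basis_words (length ys). evaluate (map dual_basis b) ys * \<omega> (us @ b))"
  using assms(2-)
proof (induction ys arbitrary: us)
  case Nil
  then show ?case by (simp add: basis_words_0)
next
  case (Cons y ys)
  have "\<omega> (us @ y # ys) = (\<Sum>x\<in>basis. dual_eval (dual_basis x) y * \<omega> (us @ x # ys))"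
    using Cons.prems by (intro multilinear_expand_slot[OF \<omega>]) auto
  also have "\<dots> = (\<Sum>x\<in>basis. dual_eval (dual_basis x) y * (\<Sum>b\<in>basis_words (length ys). evaluate
      (map dual_basis b) ys * \<omega> (us @ x # b)))"
  proof (intro sum.cong refl arg_cong2[where f = "(*)"])
    fix x assume "x \<in> basis"
    then show "\<omega> (us @ x # ys) = (\<Sum>b\<in>basis_words (length ys). evaluate (map dual_basis b) ys * \<omega>
        (us @ x # b))"
      using Cons.IH[of "us @ [x]"] Cons.prems basis_homog by auto
  qed
  finally show ?case by (simp add: sum_basis_words_Suc sum_distrib_left mult.assoc)
qed

definition graded_symmetric :: "nat \<Rightarrow> ((int \<times> 'v) list \<Rightarrow> 'k) \<Rightarrow> bool" where
  "graded_symmetric n \<omega> \<longleftrightarrow> (\<forall>xs\<in>lists (homog F). \<forall>\<sigma>. length xs = n \<longrightarrow> \<sigma> permutes {..<n} \<longrightarrow>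
    koszul_sign \<sigma> xs * \<omega> (permute_list \<sigma> xs) = \<omega> xs)"

text \<open>A preimage of the functional under the identification: 1/n! compensates for the n!
  permutations summed in \<open>word_pairing\<close>, and \<open>reversal_sign\<close> for the sign
  in \<open>tensor_eval\<close>.\<close>

definition represent :: "nat \<Rightarrow> ((int \<times> 'v) list \<Rightarrow> 'k) \<Rightarrow> ('v \<Rightarrow> 'k, 'k) free_alg" where
  "represent n \<omega> = (\<Sum>b\<in>basis_words n. const (inverse (of_nat (fact n)) * reversal_sign b * \<omega> b) *
      monomial (map dual_basis b))"

text \<open>For fixed \<sigma> the sum over basis words is the expansion of \<omega> at the permuted
  arguments. Graded symmetry makes all n! of these values, with their signs, equal to
  \<open>\<omega> xs\<close>.\<close>

lemma pairing_represent:
  assumes \<omega>: "multilinear n \<omega>" "graded_symmetric n \<omega>"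
    and xs: "xs \<in> lists (homog F)" "length xs = n"
  shows "pairing (represent n \<omega>) xs = \<omega> xs"
proof -
  let ?S = "{\<sigma>. \<sigma> permutes {..<n}}"
  have fin: "finite ?S" "card ?S = fact n" by (simp_all add: finite_permutations card_permutations)
  \<comment> \<open>If the evaluation is nonzero, \<open>b\<close> has the degrees of the permuted
    arguments, so the two reversal signs agree and cancel.\<close>
  have sign: "reversal_sign b * reversal_sign xs * evaluate (map dual_basis b) (permute_list \<sigma> xs) =
      evaluate (map dual_basis b) (permute_list \<sigma> xs)" if b: "b \<in> basis_words n"
          and \<sigma>: "\<sigma> permutes {..<n}" for b \<sigma>
  proof (cases "evaluate (map dual_basis b) (permute_list \<sigma> xs) = 0")
    case False
    have "reversal_sign b = (reversal_sign (permute_list \<sigma> xs) :: 'k)"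
      using evaluate_nonzero_degree[OF False] b xs dual_basis_degree
      by (intro reversal_sign_cong) (auto simp: basis_words_def)
    also have "\<dots> = reversal_sign xs" using \<sigma> xs by (simp add: reversal_sign_permute)
    finally show ?thesis by (simp add: reversal_sign_square)
  qed simp
  have "pairing (represent n \<omega>) xs =
      (\<Sum>b\<in>basis_words n. inverse (of_nat (fact n)) * reversal_sign b * \<omega> b * word_pairing (map
          dual_basis b) xs)"
    by (simp add: represent_def pairing_sum pairing_const_monomial)
  also have "\<dots> = (\<Sum>b\<in>basis_words n. \<Sum>\<sigma>\<in>?S. inverse (of_nat (fact n)) * koszul_sign \<sigma> xs *
      (\<omega> b * (reversal_sign b * reversal_sign xs * evaluate (map dual_basis b) (permute_list \<sigma>
          xs))))"
    using xs by (intro sum.cong refl) (simp add: basis_words_def word_pairing_eq sum_distrib_left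
        mult_ac)
  also have "\<dots> = (\<Sum>b\<in>basis_words n. \<Sum>\<sigma>\<in>?S. inverse (of_nat (fact n)) * koszul_sign \<sigma> xs *
      (evaluate (map dual_basis b) (permute_list \<sigma> xs) * \<omega> b))"
    by (intro sum.cong refl) (simp add: sign)
  also have "\<dots> = (\<Sum>\<sigma>\<in>?S. inverse (of_nat (fact n)) * koszul_sign \<sigma> xs *
      (\<Sum>b\<in>basis_words n. evaluate (map dual_basis b) (permute_list \<sigma> xs) * \<omega> b))"
    by (subst sum.swap) (simp add: sum_distrib_left)
  also have "\<dots> = (\<Sum>\<sigma>\<in>?S. inverse (of_nat (fact n)) * \<omega> xs)"
  proof (rule sum.cong[OF refl])
    fix \<sigma> assume "\<sigma> \<in> ?S"
    then have \<sigma>: "\<sigma> permutes {..<n}" by simp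
    have "permute_list \<sigma> xs \<in> lists (homog F)" using xs \<sigma> by (auto simp: set_permute_list)
    then have "(\<Sum>b\<in>basis_words n. evaluate (map dual_basis b) (permute_list \<sigma> xs) * \<omega> b) =
        \<omega> (permute_list \<sigma> xs)"
      using multilinear_expand[OF \<omega>(1), of "[]" "permute_list \<sigma> xs"] xs by simp
    then show "inverse (of_nat (fact n)) * koszul_sign \<sigma> xs *
      (\<Sum>b\<in>basis_words n. evaluate (map dual_basis b) (permute_list \<sigma> xs) * \<omega> b) =
          inverse (of_nat (fact n)) * \<omega> xs"
      using \<omega>(2) xs \<sigma> by (simp add: graded_symmetric_def mult.assoc)
  qed
  also have "\<dots> = \<omega> xs" using fin by simp
  finally show ?thesis .
qed

lemma represent_add: "represent n (\<lambda>xs. \<omega> xs + \<omega>' xs) = represent n \<omega> + represent n \<omega>'"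
  by (simp add: represent_def distrib_left distrib_right const_add sum.distrib)

lemma represent_scale: "represent n (\<lambda>xs. c * \<omega> xs) = const c * represent n \<omega>"
  unfolding represent_def sum_distrib_left
  by (intro sum.cong refl) (simp only: const_mult mult.assoc[symmetric], simp only:
      const_mult[symmetric] mult_ac)

lemma represent_power_words:
  assumes "\<And>b. b \<in> basis_words n \<Longrightarrow> \<omega> b \<noteq> 0 \<Longrightarrow> total_degree b = - d"
  shows "represent n \<omega> \<in> power_words n d"
  unfolding represent_def
proof (intro power_words_sum power_words_const_monomial)
  fix b assume b: "b \<in> basis_words n"
  show "map dual_basis b \<in> lists (homog (graded_dual scale F))" using b
      by (rule basis_words_dual_homog)
  have "total_degree (map dual_basis b) = - total_degree b"
    by (induction b) (simp_all add: total_degree_def dual_basis_degree)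
  then show "length (map dual_basis b) = n \<and> total_degree (map dual_basis b) = d"
    if "inverse (of_nat (fact n)) * reversal_sign b * \<omega> b \<noteq> 0"
    using assms[OF b] that b by (auto simp: basis_words_def)
qed

end

section \<open>The Chevalley-Eilenberg differential\<close>

locale based_linf1_algebra = linf: linf1_algebra scale F br + based_dual_space_char_0 scale F
    basis dual_basis
  for scale :: "'k::field_char_0 \<Rightarrow> 'v::ab_group_add \<Rightarrow> 'v" and F br basis dual_basis
begin

abbreviation "V \<equiv> graded_dual scale F"

definition bracket_functional :: "int \<times> ('v \<Rightarrow> 'k) \<Rightarrow> (int \<times> 'v) list \<Rightarrow> 'k" where
  "bracket_functional \<phi> xs = - ((-1) powi fst \<phi>) * dual_eval \<phi> (total_degree xs + 1, br xs)"

lemma dual_eval_add: "\<phi> \<in> homog V \<Longrightarrow> u \<in> F d \<Longrightarrow> v \<in> F d \<Longrightarrow>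
    dual_eval \<phi> (d, u + v) = dual_eval \<phi> (d, u) + dual_eval \<phi> (d, v)"
  by (cases \<phi>) (auto simp: dual_eval_def graded_dual_def eq_neg_iff_add_eq_0[symmetric])

lemma dual_eval_scale: "\<phi> \<in> homog V \<Longrightarrow> u \<in> F d \<Longrightarrow>
    dual_eval \<phi> (d, scale c u) = c * dual_eval \<phi> (d, u)"
  by (cases \<phi>) (auto simp: dual_eval_def graded_dual_def eq_neg_iff_add_eq_0[symmetric])

lemma br_mem:
  assumes "us \<in> lists (homog F)" "vs \<in> lists (homog F)" "u \<in> F i"
  shows "br (us @ (i, u) # vs) \<in> F (total_degree us + i + total_degree vs + 1)"
proof -
  have "us @ (i, u) # vs \<in> lists (homog F)" using assms by (auto simp: homog_def)
  from linf.br_degree[OF this] show ?thesis by (simp add: total_degree_def add_ac)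
qed

lemma bracket_functional_multilinear:
  assumes "\<phi> \<in> homog V"
  shows "multilinear n (bracket_functional \<phi>)"
  unfolding multilinear_def
proof (intro ballI allI impI conjI)
  fix us vs i assume m: "us \<in> lists (homog F)" "vs \<in> lists (homog F)"
  let ?d = "total_degree us + i + total_degree vs + 1"
  have d: "total_degree (us @ (i, u) # vs) + 1 = ?d" for u
    by (simp add: total_degree_def)
  show "bracket_functional \<phi> (us @ (i, u + v) # vs) =
      bracket_functional \<phi> (us @ (i, u) # vs) + bracket_functional \<phi> (us @ (i, v) # vs)"
    if "u \<in> F i" "v \<in> F i" for u v
    unfolding bracket_functional_def d linf.br_add[OF m that]
      dual_eval_add[OF assms br_mem[OF m that(1)] br_mem[OF m that(2)]] by (rule distrib_left)
  show "bracket_functional \<phi> (us @ (i, scale c u) # vs) =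
      c * bracket_functional \<phi> (us @ (i, u) # vs)"
    if "u \<in> F i" for u c
    unfolding bracket_functional_def d linf.br_scale[OF m that]
      dual_eval_scale[OF assms br_mem[OF m that]] by (rule mult.left_commute)
qed

lemma bracket_functional_symmetric:
  assumes "\<phi> \<in> homog V" "n > 0"
  shows "graded_symmetric n (bracket_functional \<phi>)"
  unfolding graded_symmetric_def
proof (intro ballI allI impI)
  fix xs :: "(int \<times> 'v) list" and \<sigma>
  assume xs: "xs \<in> lists (homog F)" "length xs = n" and \<sigma>: "\<sigma> permutes {..<n}"
  have ne: "xs \<noteq> []" "permute_list \<sigma> xs \<noteq> []" using xs assms(2)
      by (auto simp flip: length_greater_0_conv)
  have \<sigma>': "\<sigma> permutes {..<length xs}" using \<sigma> xs by simp
  have td: "total_degree (permute_list \<sigma> xs) = total_degree xs" using \<sigma>'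
      by (rule total_degree_permute)
  have "permute_list \<sigma> xs \<in> lists (homog F)"
    using xs set_permute_list[OF \<sigma>'] by (simp only: in_lists_conv_set)
  from linf.br_degree[OF this ne(2)] have "br (permute_list \<sigma> xs) \<in> F (total_degree xs + 1)"
    unfolding td .
  from dual_eval_scale[OF assms(1) this, of "koszul_sign \<sigma> xs"]
  have "koszul_sign \<sigma> xs * dual_eval \<phi> (total_degree xs + 1, br (permute_list \<sigma> xs)) =
      dual_eval \<phi> (total_degree xs + 1, br xs)"
    unfolding linf.br_symmetric[OF xs(1) ne(1) \<sigma>'] by simp
  then show "koszul_sign \<sigma> xs * bracket_functional \<phi> (permute_list \<sigma> xs) = bracket_functional \<phi> xs"
    unfolding bracket_functional_def td by (metis mult.left_commute)
qed

lemma bracket_functional_represent_words: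
  "represent n (bracket_functional \<phi>) \<in> power_words n (fst \<phi> + 1)"
  by (rule represent_power_words) (auto simp: bracket_functional_def dual_eval_def split: if_splits)

text \<open>This evaluates the definite description: existence is \<open>pairing_represent\<close>,
  uniqueness is \<open>pairing_injective\<close>.\<close>

lemma dual_bracket_eq:
  assumes \<phi>: "\<phi> \<in> homog V" and n: "n > 0"
  shows "dual_bracket scale F br n \<phi> = cls (represent n (bracket_functional \<phi>))"
  unfolding dual_bracket_def bracket_functional_def[symmetric] sym_power_degree_eq
proof (rule the_equality)
  let ?r = "represent n (bracket_functional \<phi>)"
  have r: "pairing ?r xs = bracket_functional \<phi> xs" if "xs \<in> lists (homog F)" "length xs = n" for xs
    using that \<phi> n by (intro pairing_represent bracket_functional_multilinear
        bracket_functional_symmetric)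
  \<comment> \<open>The defining property speaks of every representative of the class;
    representatives differ by elements of the ideal, on which the pairing vanishes.\<close>
  have "pairing p xs = bracket_functional \<phi> xs"
    if "p \<in> cls ?r" "xs \<in> lists (homog F)" "length xs = n" for p xs
    using pairing_ideal[of "p - ?r" xs] that r by (simp add: sym_class_altdef pairing_diff)
  then show "cls ?r \<in> cls ` power_words n (fst \<phi> + 1) \<and> (\<forall>p\<in>cls ?r. \<forall>xs\<in>lists (homog F).
      length xs = n \<longrightarrow> pairing p xs = bracket_functional \<phi> xs)"
    using bracket_functional_represent_words by blast
  fix X
  assume X: "X \<in> cls ` power_words n (fst \<phi> + 1) \<and> (\<forall>p\<in>X. \<forall>xs\<in>lists (homog F).
      length xs = n \<longrightarrow> pairing p xs = bracket_functional \<phi> xs)"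
  then obtain q where q: "q \<in> power_words n (fst \<phi> + 1)" "X = cls q" by blast
  have "q \<in> X" by (simp add: q(2) sym_class_altdef)
  then have "q - ?r \<in> I"
    using X r by (intro pairing_injective[OF power_words_diff[OF q(1)
        bracket_functional_represent_words]])
      (simp add: pairing_diff)
  then show "X = cls ?r" unfolding q(2) by (rule sym_class_eqI)
qed

text \<open>A lift of \<delta> on generators. The bracket with k + 1 arguments sits at order k of
  \<lambda>, and there is no term of order 0. Unlike \<open>letter\<close>, this lift is linear
  already before passing to the quotient.\<close>

definition delta_gen :: "int \<times> ('v \<Rightarrow> 'k) \<Rightarrow> ('v \<Rightarrow> 'k, 'k) free_alg fps" where
  "delta_gen \<phi> = Abs_fps (\<lambda>k. if k = 0 then 0 else represent (k + 1) (bracket_functional \<phi>))"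

lemma bracket_functional_add:
  "bracket_functional (i, f + g) = (\<lambda>xs. bracket_functional (i, f) xs + bracket_functional (i, g)
      xs)"
  by (auto simp: bracket_functional_def dual_eval_def algebra_simps)

lemma bracket_functional_scale:
  "bracket_functional (i, fun_scale c f) = (\<lambda>xs. c * bracket_functional (i, f) xs)"
  by (auto simp: bracket_functional_def dual_eval_def fun_scale_def algebra_simps)

lemma delta_gen_add: "delta_gen (i, f + g) = delta_gen (i, f) + delta_gen (i, g)"
  by (rule fps_ext) (simp add: delta_gen_def bracket_functional_add represent_add)

lemma delta_gen_scale: "delta_gen (i, fun_scale c f) = fps_const (const c) * delta_gen (i, f)"
  by (rule fps_ext) (simp add: delta_gen_def bracket_functional_scale represent_scale)

lemma delta_gen_linear: "linear_on_generators delta_gen"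
  by (simp add: linear_on_generators_def delta_gen_add delta_gen_scale)

lemma delta_gen_in_H: "delta_gen (i, f) \<in> H (i + 1)"
  using bracket_functional_represent_words[of _ "(i, f)"] power_words_subset
  by (auto simp: delta_gen_def coeffs_in_def)

lemma br_linear:
  assumes "u \<in> F i" "v \<in> F i"
  shows "br [(i, u + v)] = br [(i, u)] + br [(i, v)]" "br [(i, scale c u)] = scale c (br [(i, u)])"
  using linf.br_add[of "[]" "[]" u i v] linf.br_scale[of "[]" "[]" u i c] assms by simp_all

lemma br_single: "u \<in> F i \<Longrightarrow> br [(i, u)] \<in> F (i + 1)"
  using linf.br_degree[of "[(i, u)]"] by (simp add: homog_def total_degree_def)

lemma dual_diff_in_dual:
  assumes "f \<in> V i"
  shows "dual_diff F br i f \<in> V (i + 1)"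
proof -
  have "br [(- i - 1, v)] \<in> F (- i)" if "v \<in> F (- i - 1)" for v
    using br_single[OF that] by simp
  moreover have e: "- (i + 1) = - i - 1" by simp
  ultimately show ?thesis
    using assms unfolding graded_dual_def mem_Collect_eq dual_diff_def e
    by (auto simp: br_linear distrib_left mult.left_commute)
qed

lemma dual_diff_add: "dual_diff F br i (f + g) = dual_diff F br i f + dual_diff F br i g"
  by (auto simp: dual_diff_def fun_eq_iff algebra_simps)

lemma dual_diff_scale: "dual_diff F br i (fun_scale c f) = fun_scale c (dual_diff F br i f)"
  by (auto simp: dual_diff_def fun_eq_iff fun_scale_def)

abbreviation "\<delta>\<^sub>0 \<equiv> delta0 scale F br"
abbreviation "\<delta> \<equiv> delta scale F br"
abbreviation "gen \<equiv> CE_gen scale F"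

lemma gen_eq: "gen x = \<pi> (fps_const (letter x))"
  by (simp add: CE_gen_def ps_gen_eq)

lemma gen_eq_ps_gen: "gen x = ps_gen fun_scale V x"
  by (simp add: CE_gen_def)

lemma delta0_derivation: "degree1_derivation fun_scale V \<delta>\<^sub>0"
  and delta0_on_generator: "(i, f) \<in> homog V \<Longrightarrow> \<delta>\<^sub>0 (gen (i, f)) = gen (i + 1, dual_diff F br i f)"
proof -
  \<comment> \<open>A lift of the prescribed values of \<open>delta0\<close>; letters make it linear
    modulo the relations only.\<close>
  define G where "G = (\<lambda>(i, f). fps_const (letter (i + 1, dual_diff F br i f)) :: ('v \<Rightarrow> 'k, 'k)
      free_alg fps)"
  have lin: "linear_on_generators G"
    unfolding linear_on_generators_def G_def
    using letter_add_in_ideal[OF dual_diff_in_dual dual_diff_in_dual]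
      letter_scale_in_ideal[OF dual_diff_in_dual]
    by (auto simp: dual_diff_add dual_diff_scale)
  have deg: "G (i, v) \<in> H (i + 1)" if "v \<in> V i" for i v
    unfolding G_def using that by (auto intro!: H_const homog_words_letter dual_diff_in_dual)
  have g: "(\<lambda>(i, \<phi>). gen (i + 1, dual_diff F br i \<phi>)) x = \<pi> (G x)" if "x \<in> homog V" for x
    by (simp add: G_def gen_eq split: prod.split)
  note D = derivation_extending[OF lin deg g, folded delta0_def]
  show "degree1_derivation fun_scale V \<delta>\<^sub>0" by (rule D(2))
  show "\<delta>\<^sub>0 (gen (i, f)) = gen (i + 1, dual_diff F br i f)" if "(i, f) \<in> homog V"
    using D(3)[OF _ _ that] by (simp add: G_def gen_eq flip: gen_eq_ps_gen)
qed

lemma delta_derivation: "degree1_derivation fun_scale V \<delta>"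
  and delta_on_generator: "x \<in> homog V \<Longrightarrow> \<delta> (gen x) = \<pi> (delta_gen x)"
proof -
  have g: "(\<lambda>\<phi> k. if k = 0 then \<zero>\<^bsub>S\<^esub> else dual_bracket scale F br (k + 1) \<phi>) x = \<pi> (delta_gen x)"
    if "x \<in> homog V" for x
    by (rule ext) (simp add: delta_gen_def series_class_def Sym_zero dual_bracket_eq[OF that])
  note D = derivation_extending[OF delta_gen_linear delta_gen_in_H g, folded delta_def]
  show "degree1_derivation fun_scale V \<delta>" by (rule D(2))
  show "\<delta> (gen x) = \<pi> (delta_gen x)" if "x \<in> homog V"
    using D(3)[OF _ that] by (simp flip: gen_eq_ps_gen)
qed

end

section \<open>Moller maps\<close>

context graded_vector_space
begin

lemma ps_gen_zero: "ps_gen scale V (i, 0) = \<zero>\<^bsub>A\<^esub>"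
  by (simp add: ps_gen_eq SymPS_zero series_class_eq_iff letter_zero_in_ideal)

lemma cga_morphism_closed: "cga_morphism scale V K \<Longrightarrow> x \<in> carrier A \<Longrightarrow> K x \<in> carrier A"
  by (auto simp: cga_morphism_def ps_linear_def)

lemma ps_linear_zero:
  assumes "ps_linear scale V D"
  shows "D \<zero>\<^bsub>A\<^esub> = \<zero>\<^bsub>A\<^esub>"
proof -
  interpret ring A by (rule ring_SymPS)
  have "D \<zero>\<^bsub>A\<^esub> = D \<zero>\<^bsub>A\<^esub> \<oplus>\<^bsub>A\<^esub> D \<zero>\<^bsub>A\<^esub>"
    using ps_linear_add[OF assms, of "\<zero>\<^bsub>A\<^esub>" "\<zero>\<^bsub>A\<^esub>"] by simp
  then show ?thesis
    using ps_linear_closed[OF assms zero_closed] by (metis add.l_cancel_one')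
qed

lemma ps_linear_comp:
  assumes "ps_linear scale V D" "ps_linear scale V E"
  shows "ps_linear scale V (\<lambda>x. D (E x))"
  using assms unfolding ps_linear_def by (auto simp: Pi_iff)

lemma ps_linear_sum:
  assumes D: "ps_linear scale V D" and E: "ps_linear scale V E"
  shows "ps_linear scale V (\<lambda>x. D x \<oplus>\<^bsub>A\<^esub> E x)"
proof -
  interpret ring A by (rule ring_SymPS)
  show ?thesis
    unfolding ps_linear_def
    using ps_linear_closed[OF D] ps_linear_closed[OF E]
    by (auto simp: ps_linear_add[OF D] ps_linear_add[OF E] ps_linear_scalar[OF D]
        ps_linear_scalar[OF E]
        r_distr a_ac)
qed

lemma degree1_derivation_leibniz:
  "degree1_derivation scale V D \<Longrightarrow> x \<in> ps_degree scale V d \<Longrightarrow> y \<in> carrier A \<Longrightarrow>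
    D (x \<otimes>\<^bsub>A\<^esub> y) = D x \<otimes>\<^bsub>A\<^esub> y \<oplus>\<^bsub>A\<^esub>
      ps_scalar scale V (fps_const ((-1) powi d)) \<otimes>\<^bsub>A\<^esub> (x \<otimes>\<^bsub>A\<^esub> D y)"
  unfolding degree1_derivation_def by blast

lemma intertwining_from_generators:
  assumes D: "degree1_derivation scale V D" and E: "degree1_derivation scale V E"
    and K: "cga_morphism scale V K"
    and gen: "\<And>x. x \<in> homog V \<Longrightarrow>
      D (K (ps_gen scale V x)) \<oplus>\<^bsub>A\<^esub> E (K (ps_gen scale V x)) = K (D (ps_gen scale V x))"
    and x: "x \<in> carrier A"
  shows "D (K x) \<oplus>\<^bsub>A\<^esub> E (K x) = K (D x)"
proof (rule ps_linear_eqI[where D = "\<lambda>x. D (K x) \<oplus>\<^bsub>A\<^esub> E (K x)" and D' = "\<lambda>x. K (D x)"])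
  interpret ring A by (rule ring_SymPS)
  have lin: "ps_linear scale V D" "ps_linear scale V E" "ps_linear scale V K"
    using D E K by (auto simp: degree1_derivation_def cga_morphism_def)
  have hom: "K \<in> ring_hom A A" using K by (simp add: cga_morphism_def)
  show "ps_linear scale V (\<lambda>x. D (K x) \<oplus>\<^bsub>A\<^esub> E (K x))" "ps_linear scale V (\<lambda>x. K (D x))"
    by (rule ps_linear_sum[OF ps_linear_comp[OF lin(1,3)] ps_linear_comp[OF lin(2,3)]])
      (rule ps_linear_comp[OF lin(3,1)])
  note cl [simp] = ps_linear_closed[OF lin(1)] ps_linear_closed[OF lin(2)] ps_linear_closed[OF
      lin(3)]
  show "D (K (\<pi> (fps_const (monomial xs)))) \<oplus>\<^bsub>A\<^esub> E (K (\<pi> (fps_const (monomial xs)))) =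
      K (D (\<pi> (fps_const (monomial xs))))" if "xs \<in> lists (homog V)" for xs
    using that
  proof (induction xs)
    case Nil
    have "K \<one>\<^bsub>A\<^esub> = \<one>\<^bsub>A\<^esub>" by (rule ring_hom_one[OF hom])
    then show ?case
      using degree1_derivation_one[OF D] degree1_derivation_one[OF E] ps_linear_zero[OF lin(3)]
      by (simp add: monomial_Nil flip: SymPS_one)
  next
    case (Cons x xs)
    let ?g = "ps_gen scale V x" and ?m = "\<pi> (fps_const (monomial xs))"
    let ?s = "ps_scalar scale V (fps_const ((-1) powi fst x))"
    have x: "x \<in> homog V" and m [simp]: "?m \<in> carrier A" using Cons by auto
    have g: "?g \<in> ps_degree scale V (fst x)" using x by (cases x) (auto intro: ps_gen_degree)
    have gc [simp]: "?g \<in> carrier A" using g ps_degree_subset by blast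
    \<comment> \<open>K preserves degrees, so the Leibniz rules before and after applying K carry
      the same sign \<open>?s\<close>.\<close>
    have Kg: "K ?g \<in> ps_degree scale V (fst x)" using K g by (auto simp: cga_morphism_def)
    have mult: "K (y \<otimes>\<^bsub>A\<^esub> z) = K y \<otimes>\<^bsub>A\<^esub> K z" if "y \<in> carrier A" "z \<in> carrier A" for y z
      using ring_hom_mult[OF hom that] .
    have "D (K (?g \<otimes>\<^bsub>A\<^esub> ?m)) \<oplus>\<^bsub>A\<^esub> E (K (?g \<otimes>\<^bsub>A\<^esub> ?m)) =
        (D (K ?g) \<oplus>\<^bsub>A\<^esub> E (K ?g)) \<otimes>\<^bsub>A\<^esub> K ?m \<oplus>\<^bsub>A\<^esub> ?s \<otimes>\<^bsub>A\<^esub> (K ?g \<otimes>\<^bsub>A\<^esub> (D (K ?m) \<oplus>\<^bsub>A\<^esub> E (K ?m)))"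
      by (simp add: mult degree1_derivation_leibniz[OF D Kg] degree1_derivation_leibniz[OF E Kg]
          l_distr r_distr a_ac)
    also have "\<dots> = K (D ?g) \<otimes>\<^bsub>A\<^esub> K ?m \<oplus>\<^bsub>A\<^esub> ?s \<otimes>\<^bsub>A\<^esub> (K ?g \<otimes>\<^bsub>A\<^esub> K (D ?m))"
      using Cons x gen by simp
    also have "\<dots> = K (D ?g \<otimes>\<^bsub>A\<^esub> ?m) \<oplus>\<^bsub>A\<^esub> K (?s \<otimes>\<^bsub>A\<^esub> (?g \<otimes>\<^bsub>A\<^esub> D ?m))"
      by (subst ps_linear_scalar[OF lin(3)]) (simp_all add: mult)
    also have "\<dots> = K (D (?g \<otimes>\<^bsub>A\<^esub> ?m))"
      by (simp add: degree1_derivation_leibniz[OF D g] ps_linear_add[OF lin(3)])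
    finally show ?case
      using Cons.hyps by (simp only: series_class_monomial_Cons)
  qed
qed fact

lemma SymPS_mult_nth_0:
  assumes "x \<in> carrier A" "y \<in> carrier A"
  shows "(x \<otimes>\<^bsub>A\<^esub> y) 0 = x 0 \<otimes>\<^bsub>S\<^esub> y 0"
proof -
  obtain f g where "f \<in> P" "x = \<pi> f" "g \<in> P" "y = \<pi> g" using assms by (auto simp: SymPS_carrier)
  then show ?thesis
    by (simp add: SymPS_mult) (simp add: series_class_def Sym_mult coeffs_in_nth)
qed

lemma ps_scalar_const_mult_nth:
  assumes "x \<in> carrier A"
  shows "(ps_scalar scale V (fps_const c) \<otimes>\<^bsub>A\<^esub> x) n = cls (const c) \<otimes>\<^bsub>S\<^esub> x n"
proof -
  obtain f where "f \<in> P" "x = \<pi> f" using assms by (auto simp: SymPS_carrier)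
  then show ?thesis
    by (simp add: ps_scalar_const SymPS_mult) (simp add: series_class_def Sym_mult coeffs_in_nth)
qed

text \<open>Every \<lambda>-linear map is a series of maps of the symmetric algebra: the n-th
  component takes x to the n-th coefficient of K on the constant series x. This is the form that
  \<open>moller_map\<close> asks for.\<close>

lemma ps_linear_components:
  assumes K: "ps_linear scale V K" and f: "f \<in> carrier A"
  shows "K f m = (\<Oplus>\<^bsub>S\<^esub>n\<in>{..m}. K (ps_const S (f (m - n))) n)"
proof -
  interpret ring S by (rule ring_Sym)
  obtain p where p: "p \<in> P" "f = \<pi> p" using f by (auto simp: SymPS_carrier)
  have mem: "K (ps_const S (\<pi> p k)) n \<in> carrier S" if "p \<in> P" for p k n
    using that by (intro SymPS_carrier_nth ps_linear_closed[OF K] ps_const_in_carrier)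
      (auto simp: SymPS_carrier_nth)
  have "K (\<pi> p) m = (\<Oplus>\<^bsub>S\<^esub>n\<in>{..m}. K (ps_const S (\<pi> p (m - n))) n)" using p(1)
  proof (induction m arbitrary: p)
    case (0 p)
    have "K (\<pi> (fps_const (fps_nth p 0))) 0 \<in> carrier S"
      using mem[OF 0, of 0 0] unfolding ps_const_eq[symmetric] by (simp add: series_class_def)
    then show ?case
      using mem[OF 0, of 0 0] unfolding ps_linear_expand_nth[OF K 0]
      by (simp add: series_class_def ps_const_eq)
  next
    case (Suc m p)
    have shift: "fps_shift 1 p \<in> P" using Suc.prems by (auto simp: coeffs_in_def)
    have "(\<Oplus>\<^bsub>S\<^esub>n\<in>{..m}. K (ps_const S (\<pi> (fps_shift 1 p) (m - n))) n) =
        (\<Oplus>\<^bsub>S\<^esub>n\<in>{..m}. K (ps_const S (\<pi> p (Suc m - n))) n)"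
      using mem[OF Suc.prems] by (intro finsum_cong') (auto simp: series_class_def Suc_diff_le)
    then show ?case
      unfolding ps_linear_expand_nth[OF K Suc.prems]
      using mem[OF Suc.prems] Suc.IH[OF shift]
      by (simp add: finsum_Suc) (simp add: series_class_def ps_const_eq)
  qed
  then show ?thesis by (simp add: p(2))
qed

lemma ps_linear_component_endomorphism:
  assumes K: "ps_linear scale V K" and deg: "\<And>d. K ` ps_degree scale V d \<subseteq> ps_degree scale V d"
  shows "degree0_endomorphism scale V (\<lambda>x. K (ps_const S x) n)"
  unfolding degree0_endomorphism_def
proof (intro conjI ballI allI subsetI)
  show "(\<lambda>x. K (ps_const S x) n) \<in> carrier S \<rightarrow> carrier S"
    by (auto intro!: SymPS_carrier_nth ps_linear_closed[OF K] ps_const_in_carrier)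
  show "K (ps_const S (x \<oplus>\<^bsub>S\<^esub> y)) n = K (ps_const S x) n \<oplus>\<^bsub>S\<^esub> K (ps_const S y) n"
    if "x \<in> carrier S" "y \<in> carrier S" for x y
    using that by (simp add: ps_const_add ps_linear_add[OF K] ps_const_in_carrier SymPS_add_nth)
  show "K (ps_const S (sym_scalar scale V c \<otimes>\<^bsub>S\<^esub> x)) n = sym_scalar scale V c \<otimes>\<^bsub>S\<^esub> K (ps_const S x) n"
    if "x \<in> carrier S" for c x
    using that unfolding sym_scalar_def
    by (simp add: ps_const_scalar ps_linear_scalar[OF K] ps_const_in_carrier ps_linear_closed[OF K]
        ps_scalar_const_mult_nth)
  show "y \<in> sym_degree scale V d" if y: "y \<in> (\<lambda>x. K (ps_const S x) n) ` sym_degree scale V d"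
      for y d
  proof -
    obtain x where x: "x \<in> sym_degree scale V d" "y = K (ps_const S x) n" using y by blast
    have "ps_const S x \<in> ps_degree scale V d"
      using x(1) by (auto simp: sym_degree_eq ps_const_eq ps_degree_eq intro!: imageI H_const)
    then have "K (ps_const S x) \<in> ps_degree scale V d" using deg by blast
    then show ?thesis unfolding x(2) ps_degree_def by blast
  qed
qed

text \<open>At order 0 of \<lambda> the product is that of the symmetric algebra, so the leading
  component is again multiplicative and is fixed by its values on letters.\<close>

lemma cga_morphism_leading_component:
  assumes K: "cga_morphism scale V K"
    and gen: "\<And>x. x \<in> homog V \<Longrightarrow> K (ps_gen scale V x) 0 = cls (letter x)"
    and x: "x \<in> carrier S"
  shows "K (ps_const S x) 0 = x"
proof (rule Sym_linear_eqI[where f = "\<lambda>x. K (ps_const S x) 0" and g = "\<lambda>x. x" and X = "carrier S"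
      and pl = "add S" and sc = "\<lambda>c x. cls (const c) \<otimes>\<^bsub>S\<^esub> x"])
  have lin: "ps_linear scale V K" and deg: "\<And>d. K ` ps_degree scale V d \<subseteq> ps_degree scale V d"
    and hom: "K \<in> ring_hom A A"
    using K by (auto simp: cga_morphism_def)
  note end0 = ps_linear_component_endomorphism[OF lin deg, of 0, unfolded degree0_endomorphism_def
      sym_scalar_def]
  show "(\<lambda>x. K (ps_const S x) 0) \<in> carrier S \<rightarrow> carrier S" using end0 by blast
  show "K (ps_const S (x \<oplus>\<^bsub>S\<^esub> y)) 0 = K (ps_const S x) 0 \<oplus>\<^bsub>S\<^esub> K (ps_const S y) 0"
    if "x \<in> carrier S" "y \<in> carrier S" for x y using end0 that by blast
  show "K (ps_const S (cls (const c) \<otimes>\<^bsub>S\<^esub> x)) 0 = cls (const c) \<otimes>\<^bsub>S\<^esub> K (ps_const S x) 0"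
    if "x \<in> carrier S" for c x using end0 that by blast
  show "K (ps_const S (cls (monomial xs))) 0 = cls (monomial xs)" if "xs \<in> lists (homog V)" for xs
    using that
  proof (induction xs)
    case Nil
    then show ?case
      using ring_hom_one[OF hom] by (simp add: ps_const_eq monomial_Nil SymPS_one) (simp add:
          series_class_def)
  next
    case (Cons x xs)
    then have "K (\<pi> (fps_const (monomial (x # xs)))) 0 = cls (letter x) \<otimes>\<^bsub>S\<^esub> cls (monomial xs)"
      using gen[of x]
      by (simp add: series_class_monomial_Cons ring_hom_mult[OF hom] SymPS_mult_nth_0
          cga_morphism_closed[OF K] ps_const_eq)
    with Cons show ?case by (simp add: ps_const_eq Sym_mult monomial_Cons)
  qed
qed (use x in auto)

end

section \<open>Complexes concentrated in degrees 0 and 1\<close>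

locale two_term_linf1_algebra = based_linf1_algebra scale F br basis dual_basis
  for scale :: "'k::field_char_0 \<Rightarrow> 'v::ab_group_add \<Rightarrow> 'v" and F br basis dual_basis +
  assumes concentrated: "i \<notin> {0, 1} \<Longrightarrow> F i = {0}"
begin

text \<open>A functional on the zero space vanishes there by homogeneity, and everywhere else by the
  convention in \<open>graded_dual\<close>.\<close>

lemma dual_concentrated:
  assumes "f \<in> V i" "i \<notin> {0, -1}"
  shows "f = 0"
proof
  fix v
  have "F (- i) = {0}" using assms(2) by (intro concentrated) auto
  moreover have "f (scale 0 0) = 0 * f 0" using assms(1) by (auto simp: graded_dual_def \<open>F (- i) =
      {0}\<close>)
  ultimately show "f v = 0 v" using assms(1) by (cases "v = 0") (auto simp: graded_dual_def)
qed

lemma monomial_positive_degree: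
  assumes "xs \<in> lists (homog V)" "total_degree xs > 0"
  shows "monomial xs \<in> I"
  using assms
proof (induction xs)
  case (Cons x xs)
  obtain i f where x: "x = (i, f)" "f \<in> V i" using Cons by (cases x) auto
  show ?case
  proof (cases "i > 0")
    case True
    then have "letter x \<in> I" using dual_concentrated[OF x(2)]
        by (simp add: x(1) letter_zero_in_ideal)
    then show ?thesis using Cons by (auto simp: monomial_Cons intro!: ideal_mult_right
        words_monomial)
  next
    case False
    then have "total_degree xs > 0" using Cons by (simp add: x(1) total_degree_def)
    then show ?thesis using Cons by (auto simp: monomial_Cons intro: ideal_mult_left)
  qed
qed (simp add: total_degree_def)

lemma ps_degree_positive:
  assumes "x \<in> ps_degree fun_scale V d" "d > 0"
  shows "x = \<zero>\<^bsub>A\<^esub>"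
proof -
  obtain f where f: "f \<in> H d" "x = \<pi> f" using assms(1) by (auto simp: ps_degree_eq)
  have "a \<in> I" if "a \<in> homog_words d" for a
    using that assms(2)
    by (induction rule: homog_words_induct) (auto intro!: ideal_mult_left monomial_positive_degree)
  then have "f \<in> J" using f(1) by (auto simp: coeffs_in_def)
  then show ?thesis by (simp add: f(2) SymPS_zero series_class_eq_iff)
qed

abbreviation "retraction s \<equiv> delta0_retraction scale F br s"

definition moller_gen :: "(('v \<Rightarrow> 'k) \<Rightarrow> 'v \<Rightarrow> 'k) \<Rightarrow> int \<times> ('v \<Rightarrow> 'k) \<Rightarrow> ('v \<Rightarrow> 'k, 'k) free_alg fps"
    where
  "moller_gen s = (\<lambda>(i, f). fps_const (letter (i, f)) + (if i = 0 then delta_gen (-1, s f) else 0))"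

lemma moller_gen_linear:
  assumes "retraction s"
  shows "linear_on_generators (moller_gen s)"
  unfolding linear_on_generators_def
proof (intro conjI allI ballI)
  show "moller_gen s (i, u + v) - moller_gen s (i, u) - moller_gen s (i, v) \<in> J"
    if "u \<in> V i" "v \<in> V i" for i u v
  proof -
    have "i = 0 \<Longrightarrow> s (u + v) = s u + s v" using assms that by (simp add: delta0_retraction_def)
    then have "moller_gen s (i, u + v) - moller_gen s (i, u) - moller_gen s (i, v) =
        fps_const (letter (i, u + v) - letter (i, u) - letter (i, v))"
      by (auto simp: moller_gen_def delta_gen_add simp flip: fps_const_sub)
    then show ?thesis using letter_add_in_ideal[OF that] by simp
  qed
  show "moller_gen s (i, fun_scale c u) - fps_const (const c) * moller_gen s (i, u) \<in> J"
    if "u \<in> V i" for i c u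
  proof -
    have "i = 0 \<Longrightarrow> s (fun_scale c u) = fun_scale c (s u)" using assms that
        by (simp add: delta0_retraction_def)
    then have "moller_gen s (i, fun_scale c u) - fps_const (const c) * moller_gen s (i, u) =
        fps_const (letter (i, fun_scale c u) - const c * letter (i, u))"
      by (auto simp: moller_gen_def delta_gen_scale distrib_left simp flip: fps_const_sub)
    then show ?thesis using letter_scale_in_ideal[OF that] by simp
  qed
qed

lemma moller_gen_in_H:
  assumes "u \<in> V i"
  shows "moller_gen s (i, u) \<in> H i"
  using assms delta_gen_in_H[of "-1" "s u"] by (auto simp: moller_gen_def intro!: H_add H_const
      homog_words_letter)

lemma retraction_mem: "retraction s \<Longrightarrow> f \<in> V 0 \<Longrightarrow> s f \<in> V (-1)"
  by (auto simp: delta0_retraction_def)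

lemma generator_cases:
  assumes "x \<in> homog V"
  obtains f where "x = (0, f)" "f \<in> V 0" | f where "x = (-1, f)" "f \<in> V (-1)"
  | i where "x = (i, 0)" "i \<notin> {0, -1}"
proof -
  obtain i f where "x = (i, f)" "f \<in> V i" using assms by (cases x) auto
  then show thesis using dual_concentrated[of f i] that by (cases "i \<in> {0, -1}") auto
qed

text \<open>Values are prescribed in degrees 0 and -1. A generator in any other degree is the class
  of a zero functional, which every linear map sends to zero.\<close>

lemma moller_on_generators_unique:
  assumes "moller_on_generators scale F br s K" "moller_on_generators scale F br s K'" "x \<in>
      carrier A"
  shows "K x = K' x"
proof (rule cga_morphism_unique[where K = K and K' = K'])
  show K: "cga_morphism fun_scale V K" "cga_morphism fun_scale V K'"
    using assms by (auto simp: moller_on_generators_def)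
  show "K (ps_gen fun_scale V y) = K' (ps_gen fun_scale V y)" if "y \<in> homog V" for y
    using that
  proof (cases rule: generator_cases)
    case (3 i)
    then show ?thesis
      using K ps_linear_zero[of K] ps_linear_zero[of K'] by (simp add: ps_gen_zero cga_morphism_def)
  qed (use assms in \<open>auto simp: moller_on_generators_def gen_eq_ps_gen\<close>)
qed fact

lemma moller_on_generators_exists:
  assumes s: "retraction s"
  shows "\<exists>K. K \<in> extensional (carrier A) \<and> moller_on_generators scale F br s K"
proof -
  note K = morphism_exists[OF moller_gen_linear[OF s] moller_gen_in_H]
  let ?K = "induced_map (series_extend (morphism_word (moller_gen s)))"
  have "?K (gen (0, f)) = gen (0, f) \<oplus>\<^bsub>A\<^esub> \<delta> (gen (-1, s f))" if f: "f \<in> V 0" for f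
  proof -
    have sf: "(-1, s f) \<in> homog V" using retraction_mem[OF s f] by simp
    have "delta_gen (-1, s f) \<in> P" using delta_gen_in_H[of "-1" "s f"] by (rule H_subset)
    then show ?thesis
      using K(3)[of "(0, f)"] f
      by (simp add: gen_eq_ps_gen[symmetric] delta_on_generator[OF sf] moller_gen_def) (simp add:
          gen_eq SymPS_add)
  qed
  moreover have "?K (gen (-1, f)) = gen (-1, f)" if f: "f \<in> V (-1)" for f
    using K(3)[of "(-1, f)"] f by (simp add: gen_eq_ps_gen[symmetric] moller_gen_def) (simp add:
        gen_eq)
  ultimately show ?thesis
    unfolding moller_on_generators_def using K(1,2) by blast
qed

lemma moller_intertwining:
  assumes s: "retraction s" and K: "moller_on_generators scale F br s K" and x: "x \<in> carrier A"
  shows "\<delta>\<^sub>0 (K x) \<oplus>\<^bsub>A\<^esub> \<delta> (K x) = K (\<delta>\<^sub>0 x)"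
proof (rule intertwining_from_generators[OF delta0_derivation delta_derivation _ _ x])
  interpret ring A by (rule ring_SymPS)
  show cga: "cga_morphism fun_scale V K" using K by (simp add: moller_on_generators_def)
  then have deg: "K ` ps_degree fun_scale V d \<subseteq> ps_degree fun_scale V d" for d
      by (simp add: cga_morphism_def)
  have deg0: "\<delta>\<^sub>0 ` ps_degree fun_scale V d \<subseteq> ps_degree fun_scale V (d + 1)"
    and deg1: "\<delta> ` ps_degree fun_scale V d \<subseteq> ps_degree fun_scale V (d + 1)" for d
    using delta0_derivation delta_derivation by (simp_all add: degree1_derivation_def)
  have lin: "ps_linear fun_scale V \<delta>\<^sub>0" "ps_linear fun_scale V \<delta>" "ps_linear fun_scale V K"
    using delta0_derivation delta_derivation cga by (simp_all add: degree1_derivation_def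
        cga_morphism_def)
  fix y assume "y \<in> homog V"
  then have "\<delta>\<^sub>0 (K (gen y)) \<oplus>\<^bsub>A\<^esub> \<delta> (K (gen y)) = K (\<delta>\<^sub>0 (gen y))"
  proof (cases rule: generator_cases)
    case (1 f)
    have g: "gen y \<in> ps_degree fun_scale V 0" using 1 ps_gen_degree[of f 0]
        by (simp add: gen_eq_ps_gen)
    have "\<delta>\<^sub>0 (K (gen y)) \<in> ps_degree fun_scale V 1" "\<delta> (K (gen y)) \<in> ps_degree fun_scale V 1"
      "K (\<delta>\<^sub>0 (gen y)) \<in> ps_degree fun_scale V 1"
      using g deg[of 0] deg[of 1] deg0[of 0] deg1[of 0] by (simp_all add: image_subset_iff)
    from this[THEN ps_degree_positive] show ?thesis by simp
  next
    case (2 f)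
    have yV: "(-1, f) \<in> homog V" using 2 by simp
    have df: "dual_diff F br (-1) f \<in> V 0" using dual_diff_in_dual[OF 2(2)] by simp
    have sd: "s (dual_diff F br (-1) f) = f" using s 2(2) by (simp add: delta0_retraction_def)
    have Ky: "K (gen (-1, f)) = gen (-1, f)" using K 2(2) by (simp add: moller_on_generators_def)
    have "K (\<delta>\<^sub>0 (gen (-1, f))) = K (gen (0, dual_diff F br (-1) f))"
        using delta0_on_generator[OF yV] by simp
    also have "\<dots> = gen (0, dual_diff F br (-1) f) \<oplus>\<^bsub>A\<^esub> \<delta> (gen (-1, f))"
      using K df by (simp add: moller_on_generators_def sd)
    also have "\<dots> = \<delta>\<^sub>0 (gen (-1, f)) \<oplus>\<^bsub>A\<^esub> \<delta> (gen (-1, f))" using delta0_on_generator[OF yV] by simp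
    finally show ?thesis by (simp add: 2(1) Ky)
  next
    case (3 i)
    then show ?thesis
      using ps_linear_zero[OF lin(1)] ps_linear_zero[OF lin(2)] ps_linear_zero[OF lin(3)]
      by (simp add: gen_eq_ps_gen ps_gen_zero)
  qed
  then show "\<delta>\<^sub>0 (K (ps_gen fun_scale V y)) \<oplus>\<^bsub>A\<^esub> \<delta> (K (ps_gen fun_scale V y)) =
      K (\<delta>\<^sub>0 (ps_gen fun_scale V y))"
    by (simp only: gen_eq_ps_gen)
qed

text \<open>The correction \<delta> s starts at order \<lambda>, since \<open>delta_gen\<close> has
  no constant coefficient.\<close>

lemma moller_leading_component:
  assumes s: "retraction s" and K: "moller_on_generators scale F br s K" and y: "y \<in> homog V"
  shows "K (ps_gen fun_scale V y) 0 = cls (letter y)"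
proof -
  have "K (gen y) 0 = cls (letter y)" using y
  proof (cases rule: generator_cases)
    case (1 f)
    have sf: "(-1, s f) \<in> homog V" using retraction_mem[OF s 1(2)] by simp
    have "K (gen y) = \<pi> (fps_const (letter y)) \<oplus>\<^bsub>A\<^esub> \<pi> (delta_gen (-1, s f))"
      using K 1 delta_on_generator[OF sf] by (simp add: moller_on_generators_def gen_eq)
    then show ?thesis
      using y by (simp add: SymPS_add_nth) (simp add: series_class_def delta_gen_def Sym_add)
  next
    case (2 f)
    then have "K (gen y) = \<pi> (fps_const (letter y))" using K
        by (simp add: moller_on_generators_def gen_eq)
    then show ?thesis by (simp add: series_class_def)
  next
    case (3 i)
    have "ps_linear fun_scale V K" using K by (simp add: moller_on_generators_def cga_morphism_def)
    then have "K (gen y) = \<pi> 0" using ps_linear_zero[of K] 3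
        by (simp add: gen_eq_ps_gen ps_gen_zero SymPS_zero)
    then show ?thesis using 3 by (simp add: series_class_def sym_class_eq_iff letter_zero_in_ideal)
  qed
  then show ?thesis by (simp only: gen_eq_ps_gen)
qed

lemma moller_on_generators_algebra_moller_map:
  assumes s: "retraction s" and K: "moller_on_generators scale F br s K"
  shows "algebra_moller_map scale F br K"
proof -
  have cga: "cga_morphism fun_scale V K" using K by (simp add: moller_on_generators_def)
  then have lin: "ps_linear fun_scale V K" and deg: "\<And>d. K ` ps_degree fun_scale V d \<subseteq> ps_degree
      fun_scale V d"
    and hom: "K \<in> ring_hom A A"
    by (auto simp: cga_morphism_def)
  show ?thesis
    unfolding algebra_moller_map_def moller_map_def
    using ps_linear_component_endomorphism[OF lin deg] ps_linear_components[OF lin]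
      cga_morphism_leading_component[OF cga moller_leading_component[OF s K]]
      moller_intertwining[OF s K] hom
    by (intro conjI exI[of _ "\<lambda>n x. K (ps_const S x) n"] allI ballI) auto
qed

lemma retraction_exists:
  assumes H1: "trivial_cohomology F br 1"
  shows "\<exists>s. retraction s"
proof -
  have "\<exists>u\<in>F 0. br [(0, u)] = v" if v: "v \<in> F 1" for v
  proof -
    \<comment> \<open>All of \<open>F 1\<close> consists of cocycles, because the component in
      degree 2 is zero.\<close>
    have "br [(1, v)] \<in> F 2" using br_single[OF v] by simp
    then have cocycle: "v \<in> cocycles F br 1" using v concentrated[of 2] by (simp add: cocycles_def)
    let ?R = "{(x, y). x \<in> cocycles F br 1 \<and> y \<in> cocycles F br 1 \<and> x - y \<in> coboundaries F br 1}"
    have "br [(0, 0)] = 0" using br_linear(2)[of 0 0 0 0] by simp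
    then have "0 \<in> coboundaries F br 1"
      unfolding coboundaries_def by (intro image_eqI[of _ _ 0]) auto
    \<comment> \<open>The class of \<open>v\<close> contains \<open>v\<close> and, by triviality,
      equals the set of coboundaries.\<close>
    then have "v \<in> ?R `` {v}" using cocycle by simp
    moreover have "?R `` {v} \<in> cohomology F br 1"
      unfolding cohomology_def using cocycle by (rule quotientI)
    ultimately have "v \<in> coboundaries F br 1" using H1 unfolding trivial_cohomology_def by blast
    then show ?thesis by (auto simp: coboundaries_def)
  qed
  \<comment> \<open>The preimages \<open>h v\<close> are arbitrary choices. Linearity is gained in
    \<open>r\<close>, which uses them on basis vectors only.\<close>
  then obtain h where h: "\<And>v. v \<in> F 1 \<Longrightarrow> h v \<in> F 0" "\<And>v. v \<in> F 1 \<Longrightarrow> br [(0, h v)] = v" by metis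
  define B where "B = {x \<in> basis. fst x = 1}"
  define r where "r v = (\<Sum>x\<in>B. scale (snd (dual_basis x) v) (h (snd x)))" for v
  have B: "snd x \<in> F 1" "snd (dual_basis x) \<in> V (-1)" if "x \<in> B" for x
    using that basis_homog dual_basis_homog[of x] dual_basis_degree[of x]
        by (auto simp: B_def homog_def)
  have sum0: "(\<Sum>x\<in>X. scale (c x) (h (snd x))) \<in> F 0" if "X \<subseteq> B" for X c
    using that base_subspace[of 0] h(1) B(1) by (intro linf.subspace_sum linf.subspace_scale) auto
  have r0: "r v \<in> F 0" for v unfolding r_def by (rule sum0) simp
  have r_add: "r (u + v) = r u + r v" if "u \<in> F 1" "v \<in> F 1" for u v
    using B(2) that by (simp add: r_def graded_dual_def linf.scale_left_distrib sum.distrib)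
  have r_scale: "r (scale c v) = scale c (r v)" if "v \<in> F 1" for c v
    using B(2) that by (simp add: r_def graded_dual_def linf.scale_sum_right)
  have br_sum: "br [(0, \<Sum>x\<in>X. scale (c x) (h (snd x)))] = (\<Sum>x\<in>X. scale (c x) (snd x))"
    if "finite X" "X \<subseteq> B" for X c
    using that
  proof (induction X rule: finite_induct)
    case empty
    then show ?case using br_linear(2)[of 0 0 0 0] by simp
  next
    case (insert x X)
    have "br [(0, scale (c x) (h (snd x)) + (\<Sum>x\<in>X. scale (c x) (h (snd x))))] =
        scale (c x) (br [(0, h (snd x))]) + br [(0, \<Sum>x\<in>X. scale (c x) (h (snd x)))]"
      using insert.prems h(1) B(1) sum0[of X c] by (simp add: br_linear)
    with insert B(1) h(2) show ?case by simp
  qed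
  have br_r: "br [(0, r v)] = v" if "v \<in> F 1" for v
    unfolding r_def using br_sum[of B "\<lambda>x. snd (dual_basis x) v"] basis_expand[OF that] finite_basis
    by (simp add: B_def)
  \<comment> \<open>Composition with \<open>r\<close>, cut off outside \<open>F 1\<close> as
    \<open>graded_dual\<close> requires. In degree -1 the sign of \<open>dual_diff\<close> is
    -(-1)^(-1) = 1, so \<open>s\<close> applied after it is composition with the differential after
    \<open>r\<close>, which is the identity.\<close>
  define s where "s f = (\<lambda>v. if v \<in> F 1 then f (r v) else 0)" for f :: "'v \<Rightarrow> 'k"
  have "retraction s"
    unfolding delta0_retraction_def
  proof (intro conjI ballI allI)
    show "s \<in> V 0 \<rightarrow> V (-1)"
      using r0 by (auto simp: s_def graded_dual_def r_add r_scale)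
    show "s (f + g) = s f + s g" for f g by (auto simp: s_def)
    show "s (fun_scale c f) = fun_scale c (s f)" for c f by (auto simp: s_def fun_scale_def)
    show "s (dual_diff F br (-1) f) = f" if "f \<in> V (-1)" for f
    proof
      fix v
      show "s (dual_diff F br (-1) f) v = f v"
        using that r0 by (cases "v \<in> F 1") (auto simp: s_def dual_diff_def br_r graded_dual_def)
    qed
  qed
  then show ?thesis by blast
qed

end

text \<open>Finite dimension is given by a finite spanning set. It bounds the size of a maximal
  independent subset, which is then a finite basis.\<close>

lemma (in vector_space) finite_basis_of_subspace:
  assumes "finite_dimensional_subspace scale T"
  obtains B where "finite B" "B \<subseteq> T" "independent B" "span B = T"
proof -
  obtain C where C: "finite C" "span C = T" using assms
      by (auto simp: finite_dimensional_subspace_def)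
  obtain B where B: "B \<subseteq> T" "independent B" "T \<subseteq> span B" by (rule maximal_independent_subset)
  have "finite B" using independent_span_bound[OF C(1) B(2)] B(1) C(2) by simp
  moreover have "span B = T" using B C(2) span_minimal[OF B(1)] by auto
  ultimately show thesis using that B by blast
qed

text \<open>Both the real and the complex numbers are instances of \<open>real_normed_field\<close>,
  whose characteristic 0 permits the averaging over permutations. Uniqueness of K is stated among
  \<open>extensional\<close> maps, since generators say nothing about values off the
  carrier.\<close>

theorem theorem4p5:
  fixes scale :: "'k::real_normed_field \<Rightarrow> 'v::ab_group_add \<Rightarrow> 'v"
    and F :: "int \<Rightarrow> 'v set"
    and br :: "(int \<times> 'v) list \<Rightarrow> 'v"
  assumes linf: "linf1_algebra scale F br"
    and concentrated: "\<And>i. i \<notin> {0, 1} \<Longrightarrow> F i = {0}"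
    and fin0: "finite_dimensional_subspace scale (F 0)"
    and fin1: "finite_dimensional_subspace scale (F 1)"
    and H1: "trivial_cohomology F br 1"
  shows "(\<exists>K. algebra_moller_map scale F br K) \<and>
    (\<exists>s. delta0_retraction scale F br s) \<and>
    (\<forall>s. delta0_retraction scale F br s \<longrightarrow>
       (\<exists>!K. K \<in> extensional (carrier (CE scale F)) \<and> moller_on_generators scale F br s K) \<and>
       (\<forall>K. moller_on_generators scale F br s K \<longrightarrow> algebra_moller_map scale F br K))"
proof -
  interpret linf: linf1_algebra scale F br by (rule linf)
  obtain B0 where B0: "finite B0" "B0 \<subseteq> F 0" "linf.independent B0" "linf.span B0 = F 0"
    using linf.finite_basis_of_subspace[OF fin0] .
  obtain B1 where B1: "finite B1" "B1 \<subseteq> F 1" "linf.independent B1" "linf.span B1 = F 1"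
    using linf.finite_basis_of_subspace[OF fin1] .
  \<comment> \<open>Only the values at 0 and 1 enter; the other components are zero and contribute
    no basis vectors.\<close>
  define B where "B i = (if i = (0::int) then B0 else B1)" for i
  have B: "finite (B i)" "B i \<subseteq> F i" "linf.independent (B i)" "linf.span (B i) = F i"
      if "i \<in> {0, 1}" for i
    using that B0 B1 by (auto simp: B_def)
  define basis where "basis = (SIGMA i:{0, 1}. B i)"
  \<comment> \<open>Coordinate functionals in the opposite degree, set to zero outside
    \<open>F i\<close> to match the encoding of \<open>graded_dual\<close>.\<close>
  define dual_basis where "dual_basis = (\<lambda>(i, b). (- i, \<lambda>v.
      if v \<in> F i then linf.representation (B i) v b else 0))"
  interpret two_term_linf1_algebra scale F br basis dual_basis
  proof unfold_locales
    show "linf.subspace (F i)" for i by (rule linf.component_subspace)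
    show "finite basis" unfolding basis_def using B(1) by (intro finite_SigmaI) auto
    show "basis \<subseteq> homog F" unfolding basis_def homog_def using B(2) by auto
    show "fst (dual_basis x) = - fst x" for x by (simp add: dual_basis_def split: prod.split)
    show "dual_basis x \<in> homog (graded_dual scale F)" if x: "x \<in> basis" for x
    proof -
      obtain i b where ib: "x = (i, b)" "i \<in> {0, 1}" using x by (auto simp: basis_def)
      note closed = linf.subspace_add[OF linf.component_subspace[of i]] linf.subspace_scale[OF
          linf.component_subspace[of i]]
      show ?thesis
        using B(3,4)[OF ib(2)] closed
        by (simp add: ib(1) dual_basis_def homog_def graded_dual_def linf.representation_add
            linf.representation_scale)
    qed
    show "(\<Sum>x | x \<in> basis \<and> fst x = j. scale (snd (dual_basis x) v) (snd x)) = v" if v: "v \<in> F j"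
        for v j
    proof (cases "j \<in> {0, 1}")
      case True
      have "(\<Sum>x | x \<in> basis \<and> fst x = j. scale (snd (dual_basis x) v) (snd x)) =
          (\<Sum>b\<in>B j. scale (linf.representation (B j) v b) b)"
        by (rule sum.reindex_bij_witness[where i = "\<lambda>b. (j, b)" and j = snd])
          (use True v in \<open>auto simp: basis_def dual_basis_def\<close>)
      also have "\<dots> = v" using B[OF True] v by (intro linf.sum_representation_eq) auto
      finally show ?thesis .
    next
      case False
      \<comment> \<open>In the remaining degrees the expansion is an empty sum, and the vector to be
        expanded is zero.\<close>
      then have "{x. x \<in> basis \<and> fst x = j} = {}" by (auto simp: basis_def)
      moreover have "v = 0" using concentrated[OF False] v by simp
      ultimately show ?thesis by (simp only: sum.empty)
    qed
  qed (use concentrated in auto)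
  have ex1: "\<exists>!K. K \<in> extensional (carrier (CE scale F)) \<and> moller_on_generators scale F br s K"
    if s: "delta0_retraction scale F br s" for s
  proof (rule ex_ex1I[OF moller_on_generators_exists[OF s]])
    fix K K'
    assume "K \<in> extensional (carrier (CE scale F)) \<and> moller_on_generators scale F br s K"
      "K' \<in> extensional (carrier (CE scale F)) \<and> moller_on_generators scale F br s K'"
    then show "K = K'"
      by (intro extensionalityI[of K "carrier (CE scale F)"] moller_on_generators_unique[of s])
          simp_all
  qed
  have moller: "algebra_moller_map scale F br K"
    if "delta0_retraction scale F br s" "moller_on_generators scale F br s K" for s K
    using that by (rule moller_on_generators_algebra_moller_map)
  obtain s where s: "delta0_retraction scale F br s" using retraction_exists[OF H1] by (elim exE)
  obtain K where "moller_on_generators scale F br s K"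
    using moller_on_generators_exists[OF s] by (elim exE conjE)
  then have "algebra_moller_map scale F br K" by (rule moller[OF s])
  with s ex1 moller show ?thesis by (intro conjI exI[of _ K] exI[of _ s] allI impI)
qed

end
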